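(* Let $M^5\subset\mathbb{C}^3$ be a real-analytic hypersurface in the class $\mathfrak{C}_{2,1}$ and let $p\in M$. For a local biholomorphism $\varphi$ sending $(M,p)$ to a hypersurface $(N,0)$ of equation $$u=z\overline z+\tfrac12\overline z^2\zeta+\tfrac12z^2\overline\zeta+z\overline z\zeta\overline\zeta+\tfrac12\overline z^2\zeta\zeta\overline\zeta+\tfrac12z^2\overline\zeta\zeta\overline\zeta+c\,z^3\overline\zeta^2+\overline c\,\overline z^3\zeta^2+\mathrm{O}_{z,\zeta,\overline z,\overline\zeta,v}(6)$$ for some $c\in\mathbb{C}$, put $$\Sigma^1_p:=\big(\varphi^{(1)}\big)^{-1}\big(\Sigma^1_0\big)\subset J^1_{M,p},\qquad \Sigma_0^1:=\{(x_1,y_1,s_1,t_1)\in J^1_{N,0}:\ s_1=-2x_1y_1,\ t_1=x_1^2-y_1^2\}.$$ Then the surface $\Sigma^1_p\subset J^1_{M,p}\cong\mathbb{R}^4$ is independent of the normalizing map $\varphi$.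
   Context: Coordinates on $\mathbb{C}^3$: $z=x+iy$, $\zeta=s+it$, $w=u+iv$. Hypersurfaces are local, real-analytic, graphed as $u=F(z,\zeta,\overline z,\overline\zeta,v)$, $F$ real. The remainder $\mathrm{O}_{z,\zeta,\overline z,\overline\zeta,v}(6)$ is weighted: all its monomials have weight $\geqslant6$ for $[z]=[\overline z]=[\zeta]=[\overline\zeta]=1$, $[v]=2$. Class $\mathfrak{C}_{2,1}$: real-analytic hypersurfaces $M^5\subset\mathbb{C}^3$ whose Levi form has constant rank $1$ and which are everywhere $2$-nondegenerate. Writing $M$ as $w=Q(z,\zeta,\overline z,\overline\zeta,\overline w)$, in coordinates for which the Levi form is nonzero in the direction $\partial_z+Q_z\partial_w$, $2$-nondegeneracy means that the determinant with rows $(Q_{\overline z},Q_{\overline\zeta},Q_{\overline w})$, $(Q_{z\overline z},Q_{z\overline\zeta},Q_{z\overline w})$, $(Q_{zz\overline z},Q_{zz\overline\zeta},Q_{zz\overline w})$ is nonzero. $J^1_{M,p}$ is the space of $1$-jets at $p$ of CR-transversal curves in $M$ (curves with tangent not in the complex tangent space $T^c_pM$). For $N$ as in the claim, such curves through $0$ are parametrized as $v\mapsto(x(v),y(v),s(v),t(v),v)$ and their $1$-jets have coordinates $(x_1,y_1,s_1,t_1)=(\dot x(0),\dot y(0),\dot s(0),\dot t(0))$. $\varphi^{(1)}:J^1_{M,p}\to J^1_{N,0}$ is the induced (first prolongation) map on $1$-jets. At every point $p\in M$ at least one such normalizing map exists. *)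

theory Defs
  imports "HOL-Analysis.Analysis"
begin

text \<open>Points of \<open>\<complex>\<^sup>3\<close> are vectors \<open>q\<close> with \<open>q$1 = z\<close>, \<open>q$2 = \<zeta>\<close>, \<open>q$3 = w\<close>. In the type
  \<open>5\<close>, the index \<open>5\<close> is the same as \<open>0\<close>; the five indices \<open>1, 2, 3, 4, 5\<close> are distinct.\<close>

lemma vector_5:
  "(vector [a, b, c, d, e] :: 'a::zero ^ 5) $ 1 = a"
  "(vector [a, b, c, d, e] :: 'a ^ 5) $ 2 = b"
  "(vector [a, b, c, d, e] :: 'a ^ 5) $ 3 = c"
  "(vector [a, b, c, d, e] :: 'a ^ 5) $ 4 = d"
  "(vector [a, b, c, d, e] :: 'a ^ 5) $ 5 = e"
  unfolding vector_def by simp_all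

section \<open>Holomorphic and real-analytic functions of several variables\<close>

definition monomial :: "nat ^ 'n \<Rightarrow> 'a::comm_monoid_mult ^ 'n \<Rightarrow> 'a" where
  "monomial \<alpha> x = (\<Prod>i\<in>UNIV. x $ i ^ (\<alpha> $ i))"

definition conj_vec :: "complex ^ 'n \<Rightarrow> complex ^ 'n" where
  "conj_vec x = (\<chi> i. cnj (x $ i))"

definition holomorphic_near :: "(complex ^ 'n \<Rightarrow> complex) \<Rightarrow> complex ^ 'n \<Rightarrow> bool" where
  "holomorphic_near f a \<longleftrightarrow> (\<exists>c :: nat ^ 'n \<Rightarrow> complex.
     \<forall>\<^sub>F x in nhds a. ((\<lambda>\<alpha>. c \<alpha> * monomial \<alpha> (x - a)) has_sum f x) UNIV)"

definition holomorphic_map_on :: "(complex ^ 'n \<Rightarrow> complex ^ 'm) \<Rightarrow> (complex ^ 'n) set \<Rightarrow> bool" where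
  "holomorphic_map_on f S \<longleftrightarrow> (\<forall>a\<in>S. \<forall>j. holomorphic_near (\<lambda>x. f x $ j) a)"

text \<open>A power series in the real and imaginary parts of the coordinates is the same thing as a
  power series in the coordinates and their conjugates.\<close>

definition real_analytic_near :: "(complex ^ 'n \<Rightarrow> real) \<Rightarrow> complex ^ 'n \<Rightarrow> bool" where
  "real_analytic_near r a \<longleftrightarrow> (\<exists>c :: nat ^ 'n \<Rightarrow> nat ^ 'n \<Rightarrow> complex.
     \<forall>\<^sub>F x in nhds a.
       ((\<lambda>(\<alpha>, \<beta>). c \<alpha> \<beta> * monomial \<alpha> (x - a) * monomial \<beta> (conj_vec (x - a)))
          has_sum complex_of_real (r x)) UNIV)"

text \<open>\<open>\<phi>\<close> is a biholomorphism between neighbourhoods of \<open>p\<close> and \<open>q\<close> (with inverse \<open>\<psi>\<close>) that sends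
  the germ of \<open>M\<close> at \<open>p\<close> to the germ of \<open>N\<close> at \<open>q\<close>; its values away from \<open>p\<close> are irrelevant.\<close>

definition local_biholomorphism ::
    "(complex ^ 'n \<Rightarrow> complex ^ 'n) \<Rightarrow> (complex ^ 'n) set \<Rightarrow> complex ^ 'n
      \<Rightarrow> (complex ^ 'n) set \<Rightarrow> complex ^ 'n \<Rightarrow> bool" where
  "local_biholomorphism \<phi> M p N q \<longleftrightarrow> (\<exists>U V \<psi>.
     open U \<and> open V \<and> p \<in> U \<and> \<phi> p = q \<and> \<phi> ` U = V \<and> (\<forall>x\<in>U. \<psi> (\<phi> x) = x) \<and>
     holomorphic_map_on \<phi> U \<and> holomorphic_map_on \<psi> V \<and> \<phi> ` (M \<inter> U) = N \<inter> V)"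

section \<open>Hypersurfaces and the Levi form\<close>

definition local_defining_function ::
    "(complex ^ 'n \<Rightarrow> real) \<Rightarrow> (complex ^ 'n) set \<Rightarrow> complex ^ 'n \<Rightarrow> bool" where
  "local_defining_function r M p \<longleftrightarrow>
     (\<exists>U. open U \<and> p \<in> U \<and> (\<forall>x\<in>U. real_analytic_near r x \<and> (x \<in> M \<longleftrightarrow> r x = 0))) \<and>
     frechet_derivative r (at p) \<noteq> (\<lambda>_. 0)"

definition real_analytic_hypersurface :: "(complex ^ 'n) set \<Rightarrow> bool" where
  "real_analytic_hypersurface M \<longleftrightarrow> (\<forall>p\<in>M. \<exists>r. local_defining_function r M p)"

text \<open>The Wirtinger derivatives with respect to the \<open>j\<close>-th coordinate and to its conjugate.\<close>

definition wirtinger :: "'n \<Rightarrow> (complex ^ 'n::finite \<Rightarrow> complex) \<Rightarrow> complex ^ 'n \<Rightarrow> complex" where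
  "wirtinger j f x =
     (frechet_derivative f (at x) (axis j 1) - \<i> * frechet_derivative f (at x) (axis j \<i>)) / 2"

definition wirtinger_bar :: "'n \<Rightarrow> (complex ^ 'n::finite \<Rightarrow> complex) \<Rightarrow> complex ^ 'n \<Rightarrow> complex" where
  "wirtinger_bar j f x =
     (frechet_derivative f (at x) (axis j 1) + \<i> * frechet_derivative f (at x) (axis j \<i>)) / 2"

definition holomorphic_tangent_space ::
    "(complex ^ 'n::finite \<Rightarrow> real) \<Rightarrow> complex ^ 'n \<Rightarrow> (complex ^ 'n) set" where
  "holomorphic_tangent_space r p =
     {X. (\<Sum>j\<in>UNIV. wirtinger j (\<lambda>x. complex_of_real (r x)) p * X $ j) = 0}"

definition levi_form ::
    "(complex ^ 'n::finite \<Rightarrow> real) \<Rightarrow> complex ^ 'n \<Rightarrow> complex ^ 'n \<Rightarrow> complex ^ 'n \<Rightarrow> complex" where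
  "levi_form r p X Y =
     (\<Sum>j\<in>UNIV. \<Sum>k\<in>UNIV.
        wirtinger j (wirtinger_bar k (\<lambda>x. complex_of_real (r x))) p * X $ j * cnj (Y $ k))"

text \<open>The rank of the Levi form is the codimension of its kernel in the holomorphic tangent space.
  Another defining function multiplies the Levi form by a nonzero real factor.\<close>

definition levi_rank :: "(complex ^ 'n::finite \<Rightarrow> real) \<Rightarrow> complex ^ 'n \<Rightarrow> nat" where
  "levi_rank r p =
     vec.dim (holomorphic_tangent_space r p) -
     vec.dim {X \<in> holomorphic_tangent_space r p.
                \<forall>Y\<in>holomorphic_tangent_space r p. levi_form r p X Y = 0}"

section \<open>The class \<open>\<CC>\<^sub>2\<^sub>,\<^sub>1\<close>\<close>

text \<open>Variables of \<open>Q\<close>: 1, 2, 3, 4, 5 stand for \<open>z, \<zeta>\<close>, conjugate of \<open>z\<close>, conjugate of \<open>\<zeta>\<close>,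
  conjugate of \<open>w\<close>.\<close>

definition complexified_point :: "complex ^ 3 \<Rightarrow> complex ^ 5" where
  "complexified_point q = vector [q $ 1, q $ 2, cnj (q $ 1), cnj (q $ 2), cnj (q $ 3)]"

definition complex_graph_near ::
    "(complex ^ 5 \<Rightarrow> complex) \<Rightarrow> (complex ^ 3) set \<Rightarrow> complex ^ 3 \<Rightarrow> bool" where
  "complex_graph_near Q M a \<longleftrightarrow>
     holomorphic_near Q (complexified_point a) \<and>
     (\<forall>\<^sub>F q in nhds a. q \<in> M \<longleftrightarrow> q $ 3 = Q (complexified_point q))"

definition partial_deriv :: "'n \<Rightarrow> (complex ^ 'n \<Rightarrow> complex) \<Rightarrow> complex ^ 'n \<Rightarrow> complex" where
  "partial_deriv i f x = deriv (\<lambda>t. f (\<chi> j. if j = i then t else x $ j)) (x $ i)"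

definition two_nondegeneracy_matrix ::
    "(complex ^ 5 \<Rightarrow> complex) \<Rightarrow> complex ^ 5 \<Rightarrow> complex ^ 3 ^ 3" where
  "two_nondegeneracy_matrix Q x =
     (let D = partial_deriv in vector
       [vector [D 3 Q x, D 4 Q x, D 5 Q x],
        vector [D 1 (D 3 Q) x, D 1 (D 4 Q) x, D 1 (D 5 Q) x],
        vector [D 1 (D 1 (D 3 Q)) x, D 1 (D 1 (D 4 Q)) x, D 1 (D 1 (D 5 Q)) x]])"

text \<open>\<open>\<psi>\<close> is a choice of holomorphic coordinates near \<open>p\<close> in which \<open>M\<close> can be written
  \<open>w = Q\<close> and in which the Levi form is nonzero in the direction \<open>\<partial>\<^sub>z + Q\<^sub>z \<partial>\<^sub>w\<close>.\<close>

definition two_nondegenerate_at :: "(complex ^ 3) set \<Rightarrow> complex ^ 3 \<Rightarrow> bool" where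
  "two_nondegenerate_at M p \<longleftrightarrow> (\<exists>\<psi> M' a r Q.
     local_biholomorphism \<psi> M p M' a \<and>
     local_defining_function r M' a \<and>
     complex_graph_near Q M' a \<and>
     (let X = vector [1, 0, partial_deriv 1 Q (complexified_point a)]
      in levi_form r a X X \<noteq> 0) \<and>
     det (two_nondegeneracy_matrix Q (complexified_point a)) \<noteq> 0)"

definition class_C21 :: "(complex ^ 3) set \<Rightarrow> bool" where
  "class_C21 M \<longleftrightarrow>
     real_analytic_hypersurface M \<and>
     (\<forall>p\<in>M. \<exists>r. local_defining_function r M p \<and> levi_rank r p = 1) \<and>
     (\<forall>p\<in>M. two_nondegenerate_at M p)"

section \<open>Jets of CR-transversal curves\<close>

definition curve_in :: "(complex ^ 'n) set \<Rightarrow> complex ^ 'n \<Rightarrow> (real \<Rightarrow> complex ^ 'n) \<Rightarrow> bool" where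
  "curve_in M p \<gamma> \<longleftrightarrow>
     \<gamma> 0 = p \<and> (\<exists>e>0. \<gamma> C1_differentiable_on {-e<..<e} \<and> \<gamma> ` {-e<..<e} \<subseteq> M)"

definition velocity :: "(real \<Rightarrow> complex ^ 'n) \<Rightarrow> complex ^ 'n" where
  "velocity \<gamma> = vector_derivative \<gamma> (at 0)"

definition tangent_space :: "(complex ^ 'n) set \<Rightarrow> complex ^ 'n \<Rightarrow> (complex ^ 'n) set" where
  "tangent_space M p = velocity ` {\<gamma>. curve_in M p \<gamma>}"

definition complex_tangent_space :: "(complex ^ 'n) set \<Rightarrow> complex ^ 'n \<Rightarrow> (complex ^ 'n) set" where
  "complex_tangent_space M p = {X \<in> tangent_space M p. \<i> *s X \<in> tangent_space M p}"

definition transversal_curves ::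
    "(complex ^ 'n) set \<Rightarrow> complex ^ 'n \<Rightarrow> (real \<Rightarrow> complex ^ 'n) set" where
  "transversal_curves M p = {\<gamma>. curve_in M p \<gamma> \<and> velocity \<gamma> \<notin> complex_tangent_space M p}"

text \<open>Jets are those of unparametrized curves: two curves have the same 1-jet iff, after a change
  of parameter fixing 0, they agree to first order at 0.\<close>

definition same_jet ::
    "(complex ^ 'n) set \<Rightarrow> complex ^ 'n \<Rightarrow> ((real \<Rightarrow> complex ^ 'n) \<times> (real \<Rightarrow> complex ^ 'n)) set" where
  "same_jet M p = {(\<gamma>, \<delta>). \<gamma> \<in> transversal_curves M p \<and> \<delta> \<in> transversal_curves M p \<and>
     (\<exists>l::real. l \<noteq> 0 \<and> velocity \<delta> = l *\<^sub>R velocity \<gamma>)}"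

definition jet_space ::
    "(complex ^ 'n) set \<Rightarrow> complex ^ 'n \<Rightarrow> (real \<Rightarrow> complex ^ 'n) set set" where
  "jet_space M p = transversal_curves M p // same_jet M p"

text \<open>The first prolongation sends the jet of \<open>\<gamma>\<close> to the jet at \<open>q\<close> of \<open>\<phi> \<circ> \<gamma>\<close>.\<close>

definition prolongation ::
    "(complex ^ 'n \<Rightarrow> complex ^ 'n) \<Rightarrow> (complex ^ 'n) set \<Rightarrow> complex ^ 'n
      \<Rightarrow> (real \<Rightarrow> complex ^ 'n) set \<Rightarrow> (real \<Rightarrow> complex ^ 'n) set" where
  "prolongation \<phi> N q J = same_jet N q `` ((\<lambda>\<gamma>. \<phi> \<circ> \<gamma>) ` J)"

section \<open>Normalized hypersurfaces and the surfaces \<open>\<Sigma>\<^sup>1\<close>\<close>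

definition weight :: "nat ^ 5 \<Rightarrow> nat" where
  "weight \<alpha> = \<alpha> $ 1 + \<alpha> $ 2 + \<alpha> $ 3 + \<alpha> $ 4 + 2 * \<alpha> $ 5"

definition normal_part :: "complex \<Rightarrow> complex \<Rightarrow> complex \<Rightarrow> complex" where
  "normal_part c z \<zeta> =
     z * cnj z + 1/2 * cnj z ^ 2 * \<zeta> + 1/2 * z ^ 2 * cnj \<zeta> + z * cnj z * \<zeta> * cnj \<zeta>
     + 1/2 * cnj z ^ 2 * \<zeta> * \<zeta> * cnj \<zeta> + 1/2 * z ^ 2 * cnj \<zeta> * \<zeta> * cnj \<zeta>
     + c * z ^ 3 * cnj \<zeta> ^ 2 + cnj c * cnj z ^ 3 * \<zeta> ^ 2"

text \<open>\<open>R\<close> lists the coefficients of the remainder, a convergent power series in \<open>z, \<zeta>\<close>, their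
  conjugates and \<open>v\<close> (in this order).\<close>

definition normalized_at_0 :: "(complex ^ 3) set \<Rightarrow> complex \<Rightarrow> bool" where
  "normalized_at_0 N c \<longleftrightarrow>
     (\<exists>(F :: complex \<Rightarrow> complex \<Rightarrow> real \<Rightarrow> real) (R :: nat ^ 5 \<Rightarrow> complex).
        (\<forall>\<alpha>. R \<alpha> \<noteq> 0 \<longrightarrow> weight \<alpha> \<ge> 6) \<and>
        (\<forall>\<^sub>F (z, \<zeta>, v) in nhds (0, 0, 0).
           ((\<lambda>\<alpha>. R \<alpha> * monomial \<alpha> (vector [z, \<zeta>, cnj z, cnj \<zeta>, complex_of_real v]))
              has_sum (complex_of_real (F z \<zeta> v) - normal_part c z \<zeta>)) UNIV) \<and>
        (\<forall>\<^sub>F q in nhds 0. q \<in> N \<longleftrightarrow> Re (q $ 3) = F (q $ 1) (q $ 2) (Im (q $ 3))))"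

definition normalizing_map ::
    "(complex ^ 3 \<Rightarrow> complex ^ 3) \<Rightarrow> (complex ^ 3) set \<Rightarrow> complex ^ 3 \<Rightarrow> (complex ^ 3) set \<Rightarrow> bool" where
  "normalizing_map \<phi> M p N \<longleftrightarrow>
     local_biholomorphism \<phi> M p N 0 \<and> (\<exists>c. normalized_at_0 N c)"

text \<open>The coordinates of a jet of \<open>N\<close> at 0 are read off from a representative parametrized by
  \<open>v\<close>, the imaginary part of the last coordinate.\<close>

definition Sigma_zero :: "(complex ^ 3) set \<Rightarrow> (real \<Rightarrow> complex ^ 3) set set" where
  "Sigma_zero N = {J \<in> jet_space N 0. \<exists>x y s t u :: real \<Rightarrow> real.
     (\<lambda>v. vector [Complex (x v) (y v), Complex (s v) (t v), Complex (u v) v]) \<in> J \<and>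
     (let x1 = deriv x 0; y1 = deriv y 0; s1 = deriv s 0; t1 = deriv t 0
      in s1 = - 2 * x1 * y1 \<and> t1 = x1\<^sup>2 - y1\<^sup>2)}"

definition Sigma_one ::
    "(complex ^ 3 \<Rightarrow> complex ^ 3) \<Rightarrow> (complex ^ 3) set \<Rightarrow> complex ^ 3 \<Rightarrow> (complex ^ 3) set
      \<Rightarrow> (real \<Rightarrow> complex ^ 3) set set" where
  "Sigma_one \<phi> M p N = {J \<in> jet_space M p. prolongation \<phi> N 0 J \<in> Sigma_zero N}"

end

theory Submission
  imports Defs "HOL-Complex_Analysis.Conformal_Mappings"
begin

text \<open>Composing one normalizing map with the inverse of the other gives a local biholomorphism \<open>h\<close> from
\<open>(N, 0)\<close> to \<open>(N', 0)\<close>, and the statement concerns only its differential \<open>D\<close> at 0. For the velocity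
\<open>V\<close> of a transversal curve through 0 the third component is imaginary and nonzero, and the two real
equations of \<open>\<Sigma>\<^sup>1\<^sub>0\<close> say that \<open>V\<close> lies on the complex conic \<open>V\<^sub>1\<^sup>2 + V\<^sub>2 V\<^sub>3 = 0\<close>
(\<open>prolongation_in_Sigma_zero_iff\<close>). So the point is that \<open>D\<close> multiplies the quadratic form
\<open>V\<^sub>1\<^sup>2 + V\<^sub>2 V\<^sub>3\<close> by a nonzero constant (\<open>conic_preserved\<close>).

The reason is that this conic is an envelope attached to the complexified hypersurface. Treat the
conjugate variables as independent parameters. For the parameter \<open>(\<xi>, 0, 0)\<close> the Segre variety of \<open>N\<close>
passes through 0, up to terms of high order in \<open>\<xi>\<close>, and its tangent plane there is
\<open>w = 2 \<xi> z + \<xi>\<^sup>2 \<zeta>\<close>, because the normal form has no further terms that are linear in \<open>(z, \<zeta>)\<close> and of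
weight at most 5. This quadratic equation for \<open>\<xi>\<close> has a double root exactly if \<open>z\<^sup>2 + \<zeta> w = 0\<close>: the conic
is the envelope of the planes. A biholomorphism maps Segre varieties to Segre varieties, hence \<open>D\<close> maps
the plane with parameter \<open>\<xi>\<close> to the plane with parameter \<open>A \<xi>\<close>, where \<open>A\<close> is the first component of
the conjugate of \<open>h\<close>. The remainder of weight 6 leaves an error of fifth order in \<open>\<xi>\<close>
(\<open>segre_tangent_estimate\<close>), and the coefficients of the first four powers of \<open>\<xi>\<close> are enough to
express all entries of \<open>D\<close> through two of them and the derivative of \<open>A\<close> at 0, in such a way that
the conic is preserved.

The identity between the defining functions of \<open>N\<close> and \<open>N'\<close> holds a priori only at points where the
conjugate variables are the conjugates of the others. It extends to independent variables since real vectors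
form a set of uniqueness for holomorphic functions (\<open>vanish_real_vectors\<close>, \<open>polarized_identity\<close>). The
differentiation along the Segre variety is done by Cauchy's inequality, so that of \<open>h\<close> only the
differential at 0 and the Taylor expansion in one variable enter. All analysis in several variables is
reduced to one variable by composing with holomorphic curves.\<close>

section \<open>Power series in several variables\<close>

definition abs_conv :: "(nat ^ 'n \<Rightarrow> complex) \<Rightarrow> real \<Rightarrow> bool" where
  "abs_conv c r \<longleftrightarrow> 0 < r \<and> (\<lambda>\<alpha>. norm (c \<alpha>) * r ^ (\<Sum>i\<in>UNIV. \<alpha> $ i)) summable_on UNIV"

definition psum :: "(nat ^ 'n \<Rightarrow> complex) \<Rightarrow> complex ^ 'n \<Rightarrow> complex" where
  "psum c y = (\<Sum>\<^sub>\<infinity>\<alpha>. c \<alpha> * monomial \<alpha> y)"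

text \<open>Holomorphy is tested on holomorphic curves. In this form it is evidently stable under composition,
and for a power series it follows from uniform convergence of the finite partial sums, without a theory of
derivatives in several variables.\<close>

definition curve_hol :: "(complex ^ 'n \<Rightarrow> complex) \<Rightarrow> real \<Rightarrow> bool" where
  "curve_hol f r \<longleftrightarrow> (\<forall>T x. open T \<longrightarrow> (\<forall>i. (\<lambda>t. x t $ i) holomorphic_on T) \<longrightarrow>
     (\<forall>t\<in>T. \<forall>i. norm (x t $ i) < r) \<longrightarrow> (\<lambda>t. f (x t)) holomorphic_on T)"

lemma norm_monomial_le:
  fixes y :: "complex ^ 'n" and w :: "'n \<Rightarrow> nat"
  assumes "\<And>i. norm (y $ i) \<le> \<theta> ^ w i * r" and "0 \<le> \<theta>" "0 \<le> r"
  shows "norm (monomial \<alpha> y) \<le> \<theta> ^ (\<Sum>i\<in>UNIV. w i * \<alpha> $ i) * r ^ (\<Sum>i\<in>UNIV. \<alpha> $ i)"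
proof -
  have "norm (monomial \<alpha> y) = (\<Prod>i\<in>UNIV. norm (y $ i) ^ (\<alpha> $ i))"
    by (simp add: monomial_def norm_power flip: prod_norm)
  also have "\<dots> \<le> (\<Prod>i\<in>UNIV. (\<theta> ^ w i * r) ^ (\<alpha> $ i))"
    by (intro prod_mono) (auto intro: power_mono assms)
  also have "\<dots> = \<theta> ^ (\<Sum>i\<in>UNIV. w i * \<alpha> $ i) * r ^ (\<Sum>i\<in>UNIV. \<alpha> $ i)"
    by (simp add: power_mult_distrib prod.distrib power_sum flip: power_mult)
  finally show ?thesis .
qed

text \<open>The weights \<open>w\<close> allow for coordinates of different orders of magnitude: a series with terms of weight at
least \<open>m\<close> is of order \<open>\<theta>\<^sup>m\<close> where the coordinates are of order \<open>\<theta> ^ w i\<close>.\<close>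

lemma norm_term_le:
  fixes y :: "complex ^ 'n" and w :: "'n \<Rightarrow> nat"
  assumes "\<And>i. norm (y $ i) \<le> \<theta> ^ w i * r" and "0 \<le> \<theta>" "\<theta> \<le> 1" "0 \<le> r"
    and "\<And>\<alpha>. c \<alpha> \<noteq> 0 \<Longrightarrow> m \<le> (\<Sum>i\<in>UNIV. w i * \<alpha> $ i)"
  shows "norm (c \<alpha> * monomial \<alpha> y) \<le> \<theta> ^ m * (norm (c \<alpha>) * r ^ (\<Sum>i\<in>UNIV. \<alpha> $ i))"
proof (cases "c \<alpha> = 0")
  case False
  have "norm (c \<alpha> * monomial \<alpha> y)
      \<le> norm (c \<alpha>) * (\<theta> ^ (\<Sum>i\<in>UNIV. w i * \<alpha> $ i) * r ^ (\<Sum>i\<in>UNIV. \<alpha> $ i))"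
    unfolding norm_mult by (intro mult_left_mono norm_monomial_le assms) auto
  also have "\<dots> \<le> norm (c \<alpha>) * (\<theta> ^ m * r ^ (\<Sum>i\<in>UNIV. \<alpha> $ i))"
    using False assms by (intro mult_left_mono mult_right_mono power_decreasing) auto
  finally show ?thesis by (simp add: mult_ac)
qed auto

lemma norm_term_le_polydisc:
  fixes y :: "complex ^ 'n"
  assumes "\<And>i. norm (y $ i) \<le> r" and "0 \<le> r"
  shows "norm (c \<alpha> * monomial \<alpha> y) \<le> norm (c \<alpha>) * r ^ (\<Sum>i\<in>UNIV. \<alpha> $ i)"
proof -
  have "norm (c \<alpha> * monomial \<alpha> y) \<le> 1 ^ 0 * (norm (c \<alpha>) * r ^ (\<Sum>i\<in>UNIV. \<alpha> $ i))"
    by (rule norm_term_le[where w = "\<lambda>_. 0"]) (use assms in auto)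
  then show ?thesis by (simp only: power_0 mult_1_left)
qed

lemma psum_abs_summable:
  assumes "abs_conv c r" "\<And>i. norm (y $ i) \<le> r"
  shows "(\<lambda>\<alpha>. norm (c \<alpha> * monomial \<alpha> y)) summable_on UNIV"
proof (rule summable_on_comparison_test)
  show "(\<lambda>\<alpha>. norm (c \<alpha>) * r ^ (\<Sum>i\<in>UNIV. \<alpha> $ i)) summable_on UNIV"
    using assms(1) by (simp add: abs_conv_def)
  show "norm (c \<alpha> * monomial \<alpha> y) \<le> norm (c \<alpha>) * r ^ (\<Sum>i\<in>UNIV. \<alpha> $ i)" for \<alpha>
    using assms by (intro norm_term_le_polydisc) (auto simp: abs_conv_def)
qed simp

lemma has_sum_psum:
  assumes "abs_conv c r" "\<And>i. norm (y $ i) \<le> r"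
  shows "((\<lambda>\<alpha>. c \<alpha> * monomial \<alpha> y) has_sum psum c y) UNIV"
  unfolding psum_def by (rule has_sum_infsum[OF Infinite_Sum.abs_summable_summable[OF psum_abs_summable[OF assms]]])

lemma norm_psum_le:
  fixes y :: "complex ^ 'n" and w :: "'n \<Rightarrow> nat"
  assumes c: "abs_conv c r" and y: "\<And>i. norm (y $ i) \<le> \<theta> ^ w i * r" and "0 \<le> \<theta>" "\<theta> \<le> 1"
    and "\<And>\<alpha>. c \<alpha> \<noteq> 0 \<Longrightarrow> m \<le> (\<Sum>i\<in>UNIV. w i * \<alpha> $ i)"
  shows "norm (psum c y) \<le> (\<Sum>\<^sub>\<infinity>\<alpha>. norm (c \<alpha>) * r ^ (\<Sum>i\<in>UNIV. \<alpha> $ i)) * \<theta> ^ m"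
proof -
  have r: "0 < r" and s: "(\<lambda>\<alpha>. norm (c \<alpha>) * r ^ (\<Sum>i\<in>UNIV. \<alpha> $ i)) summable_on UNIV"
    using c by (auto simp: abs_conv_def)
  have *: "norm (y $ i) \<le> r" for i
  proof -
    have "\<theta> ^ w i * r \<le> 1 * r" using r assms by (intro mult_right_mono power_le_one) auto
    with y[of i] show ?thesis by simp
  qed
  note a = psum_abs_summable[OF c *]
  have "norm (psum c y) \<le> (\<Sum>\<^sub>\<infinity>\<alpha>. norm (c \<alpha> * monomial \<alpha> y))"
    unfolding psum_def by (rule Infinite_Sum.norm_infsum_bound[OF a])
  also have "\<dots> \<le> (\<Sum>\<^sub>\<infinity>\<alpha>. \<theta> ^ m * (norm (c \<alpha>) * r ^ (\<Sum>i\<in>UNIV. \<alpha> $ i)))"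
  proof (rule infsum_mono[OF a])
    show "(\<lambda>\<alpha>. \<theta> ^ m * (norm (c \<alpha>) * r ^ (\<Sum>i\<in>UNIV. \<alpha> $ i))) summable_on UNIV"
      by (rule summable_on_cmult_right[OF s])
    show "norm (c \<alpha> * monomial \<alpha> y) \<le> \<theta> ^ m * (norm (c \<alpha>) * r ^ (\<Sum>i\<in>UNIV. \<alpha> $ i))" for \<alpha>
      by (rule norm_term_le[where w = w]) (use assms r in auto)
  qed
  finally show ?thesis by (simp add: infsum_cmult_right' mult_ac)
qed

lemma curve_holD:
  assumes "curve_hol f r" "open T" "\<And>i. (\<lambda>t. x t $ i) holomorphic_on T"
    "\<And>t i. t \<in> T \<Longrightarrow> norm (x t $ i) < r"
  shows "(\<lambda>t. f (x t)) holomorphic_on T"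
  using assms unfolding curve_hol_def by blast

lemma curve_hol_psum:
  assumes c: "abs_conv c r"
  shows "curve_hol (psum c) r"
  unfolding curve_hol_def
proof (intro allI impI)
  fix T and x :: "complex \<Rightarrow> complex ^ 'a"
  assume T: "open T" and hol: "\<forall>i. (\<lambda>t. x t $ i) holomorphic_on T"
    and b: "\<forall>t\<in>T. \<forall>i. norm (x t $ i) < r"
  have trm: "(\<lambda>t. \<Sum>\<alpha>\<in>A. c \<alpha> * monomial \<alpha> (x t)) holomorphic_on T" for A
    unfolding monomial_def using hol by (intro holomorphic_intros) auto
  show "(\<lambda>t. psum c (x t)) holomorphic_on T"
  proof (rule holomorphic_onI)
    fix z assume "z \<in> T"
    then obtain e where e: "e > 0" "cball z e \<subseteq> T" using T open_contains_cball by blast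
    have le: "norm (x t $ i) \<le> r" if "t \<in> cball z e" for t i
      using b e(2) that less_imp_le by blast
    have ul: "uniform_limit (cball z e) (\<lambda>A t. \<Sum>\<alpha>\<in>A. c \<alpha> * monomial \<alpha> (x t)) (\<lambda>t. psum c (x t))
                (finite_subsets_at_top UNIV)"
    proof (rule Weierstrass_m_test_general')
      fix \<alpha> t assume "t \<in> cball z e"
      then show "norm (c \<alpha> * monomial \<alpha> (x t)) \<le> norm (c \<alpha>) * r ^ (\<Sum>i\<in>UNIV. \<alpha> $ i)"
        using c by (intro norm_term_le_polydisc le) (auto simp: abs_conv_def)
    next
      fix t assume "t \<in> cball z e"
      then show "((\<lambda>\<alpha>. c \<alpha> * monomial \<alpha> (x t)) has_sum psum c (x t)) UNIV"
        by (intro has_sum_psum[OF c] le)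
    qed (use c in \<open>auto simp: abs_conv_def\<close>)
    have "(\<lambda>t. psum c (x t)) holomorphic_on ball z e"
    proof (rule holomorphic_uniform_limit[OF _ ul])
      have "(\<lambda>t. \<Sum>\<alpha>\<in>A. c \<alpha> * monomial \<alpha> (x t)) holomorphic_on cball z e" for A
        using holomorphic_on_subset[OF trm e(2)] .
      then show "\<forall>\<^sub>F A in finite_subsets_at_top UNIV.
          continuous_on (cball z e) (\<lambda>t. \<Sum>\<alpha>\<in>A. c \<alpha> * monomial \<alpha> (x t)) \<and>
          (\<lambda>t. \<Sum>\<alpha>\<in>A. c \<alpha> * monomial \<alpha> (x t)) holomorphic_on ball z e"
        by (intro always_eventually allI conjI holomorphic_on_imp_continuous_on)
           (auto intro: holomorphic_on_subset[OF _ ball_subset_cball])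
    qed auto
    then have "(\<lambda>t. psum c (x t)) field_differentiable at z"
      using e(1) by (rule_tac holomorphic_on_imp_differentiable_at[of _ "ball z e"]) auto
    then show "(\<lambda>t. psum c (x t)) field_differentiable at z within T"
      by (rule field_differentiable_at_within)
  qed
qed

text \<open>In \<open>\<complex>\<close> unconditional and absolute convergence agree, so convergence at one point with equal positive
coordinates gives normal convergence on a whole polydisc.\<close>

lemma abs_convI:
  assumes "0 < r" and "((\<lambda>\<alpha>. c \<alpha> * monomial \<alpha> (\<chi> i. complex_of_real r)) summable_on UNIV)"
  shows "abs_conv c r"
proof -
  have "norm (c \<alpha> * monomial \<alpha> (\<chi> i. complex_of_real r)) = norm (c \<alpha>) * r ^ (\<Sum>i\<in>UNIV. \<alpha> $ i)" for \<alpha>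
    using assms(1) by (simp add: monomial_def norm_mult norm_power power_sum flip: prod_norm)
  moreover have "(\<lambda>\<alpha>. norm (c \<alpha> * monomial \<alpha> (\<chi> i. complex_of_real r))) summable_on UNIV"
    using assms(2) by (simp add: summable_on_iff_abs_summable_on_complex)
  ultimately show ?thesis using assms(1) by (simp add: abs_conv_def)
qed

lemma holomorphic_near_psum:
  assumes "holomorphic_near f a"
  obtains c r where "abs_conv c r" "\<And>y. (\<And>i. norm (y $ i) \<le> r) \<Longrightarrow> f (a + y) = psum c y"
proof -
  obtain c where "\<forall>\<^sub>F x in nhds a. ((\<lambda>\<alpha>. c \<alpha> * monomial \<alpha> (x - a)) has_sum f x) UNIV"
    using assms unfolding holomorphic_near_def by blast
  then obtain e where e: "e > 0"
    "\<And>x. dist x a < e \<Longrightarrow> ((\<lambda>\<alpha>. c \<alpha> * monomial \<alpha> (x - a)) has_sum f x) UNIV"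
    unfolding eventually_nhds_metric by blast
  define r where "r = e / (2 * real CARD('a))"
  have r: "r > 0" using e by (simp add: r_def)
  have s: "((\<lambda>\<alpha>. c \<alpha> * monomial \<alpha> y) has_sum f (a + y)) UNIV" if "\<And>i. norm (y $ i) \<le> r" for y
  proof -
    have "norm y \<le> (\<Sum>i\<in>UNIV. norm (y $ i))"
      by (simp add: norm_vec_def L2_set_le_sum)
    also have "\<dots> \<le> (\<Sum>i\<in>(UNIV::'a set). r)" by (intro sum_mono that)
    also have "\<dots> < e" using e by (simp add: r_def)
    finally show ?thesis using e(2)[of "a + y"] by (simp add: dist_norm)
  qed
  show ?thesis
  proof
    show "abs_conv c r" using s[of "\<chi> i. complex_of_real r"] r
      by (intro abs_convI) (auto dest: has_sum_imp_summable)
    fix y :: "complex ^ 'a" assume "\<And>i. norm (y $ i) \<le> r"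
    from infsumI[OF s[OF this]] show "f (a + y) = psum c y" by (simp add: psum_def)
  qed
qed

section \<open>Holomorphic functions and their derivatives\<close>

text \<open>Cauchy's inequality on half the radius bounds the tail by a geometric series.\<close>

lemma holomorphic_taylor_bound:
  fixes g :: "complex \<Rightarrow> complex"
  assumes hol: "g holomorphic_on ball 0 r" and r: "0 < r"
    and K: "\<And>s. norm s < r \<Longrightarrow> norm (g s) \<le> K" and s: "norm s \<le> r / 4"
  shows "norm (g s - (\<Sum>j<n. (deriv ^^ j) g 0 / fact j * s ^ j)) \<le> 2 * K * (2 * norm s / r) ^ n"
proof -
  define a where "a = (\<lambda>j. (deriv ^^ j) g 0 / fact j)"
  define q where "q = 2 * norm s / r"
  have K0: "0 \<le> K" using order_trans[OF norm_ge_zero K[of 0]] r by simp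
  have q: "0 \<le> q" "q \<le> 1/2" using r s by (auto simp: q_def field_simps)
  have a: "norm (a j) \<le> K / (r/2) ^ j" for j
  proof -
    have "norm ((deriv ^^ j) g 0) \<le> fact j * K / (r/2) ^ j"
    proof (rule Cauchy_inequality)
      show "g holomorphic_on ball 0 (r/2)"
        using hol r by (auto elim!: holomorphic_on_subset)
      show "continuous_on (cball 0 (r/2)) g"
        using hol r by (intro holomorphic_on_imp_continuous_on) (auto elim!: holomorphic_on_subset)
    qed (use r K in auto)
    then show ?thesis by (simp add: a_def norm_divide field_simps)
  qed
  have "(\<lambda>j. a j * s ^ j) sums g s"
    using holomorphic_power_series[OF hol, of s] s r by (simp add: a_def)
  then have tail: "(\<lambda>i. a (i + n) * s ^ (i + n)) sums (g s - (\<Sum>j<n. a j * s ^ j))"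
    by (rule sums_split_initial_segment)
  have geo: "(\<lambda>i. K * q ^ n * q ^ i) sums (K * q ^ n * (1 / (1 - q)))"
    using q by (intro sums_mult geometric_sums) auto
  have "norm (g s - (\<Sum>j<n. a j * s ^ j)) \<le> K * q ^ n * (1 / (1 - q))"
  proof (rule norm_sums_le[OF tail geo])
    fix i
    have "norm (a (i + n) * s ^ (i + n)) \<le> K / (r/2) ^ (i + n) * norm s ^ (i + n)"
      unfolding norm_mult norm_power by (intro mult_right_mono a) auto
    also have "\<dots> = K * q ^ n * q ^ i"
      using r by (simp add: q_def power_add power_divide power_mult_distrib field_simps)
    finally show "norm (a (i + n) * s ^ (i + n)) \<le> K * q ^ n * q ^ i" .
  qed
  also have "\<dots> \<le> K * q ^ n * 2"
    using q K0 by (intro mult_left_mono) (auto simp: field_simps)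
  finally show ?thesis by (simp add: a_def q_def mult_ac)
qed

definition bounded_hol :: "(complex ^ 'n \<Rightarrow> complex) \<Rightarrow> real \<Rightarrow> real \<Rightarrow> bool" where
  "bounded_hol f r K \<longleftrightarrow> 0 < r \<and> curve_hol f r \<and> (\<forall>y. (\<forall>i. norm (y $ i) < r) \<longrightarrow> norm (f y) \<le> K)"

text \<open>This is the Taylor bound of order one for \<open>f\<close> restricted to the complex line through \<open>y\<close> and \<open>y'\<close>.\<close>

lemma bounded_hol_lipschitz:
  assumes f: "bounded_hol f r K" and y: "\<And>i. norm (y $ i) \<le> r / 2"
    and d: "\<And>i. norm (y' $ i - y $ i) \<le> \<eta>" and \<eta>: "\<eta> \<le> r / 8"
  shows "norm (f y' - f y) \<le> 8 * K / r * \<eta>"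
proof -
  have r: "0 < r" and K: "\<And>y. (\<And>i. norm (y $ i) < r) \<Longrightarrow> norm (f y) \<le> K" and cf: "curve_hol f r"
    using f by (auto simp: bounded_hol_def)
  have e0: "0 \<le> \<eta>" using d norm_ge_zero order_trans by blast
  show ?thesis
  proof (cases "\<eta> = 0")
    case True
    then have "y' = y" using d by (simp add: vec_eq_iff)
    then show ?thesis using True by simp
  next
    case False
    then have e: "\<eta> > 0" using e0 by simp
    \<comment> \<open>The line is parametrized so that \<open>y'\<close> is reached at \<open>s = \<eta>\<close> and the direction has coordinates
      of norm at most 1.\<close>
    define x where "x = (\<lambda>s::complex. \<chi> i. y $ i + s * ((y' $ i - y $ i) / of_real \<eta>))"
    have dn: "norm ((y' $ i - y $ i) / complex_of_real \<eta>) \<le> 1" for i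
      using d[of i] e by (simp add: norm_divide)
    have xb: "norm (x s $ i) < r" if "norm s < r/2" for s i
    proof -
      have "norm (x s $ i) \<le> norm (y $ i) + norm s * norm ((y' $ i - y $ i) / complex_of_real \<eta>)"
        unfolding x_def vec_lambda_beta using norm_triangle_ineq norm_mult by metis
      also have "\<dots> \<le> r/2 + norm s * 1"
        by (intro add_mono y mult_left_mono dn) auto
      also have "\<dots> < r" using that by simp
      finally show ?thesis .
    qed
    have hol: "(\<lambda>s. f (x s)) holomorphic_on ball 0 (r/2)"
      by (rule curve_holD[OF cf]) (use xb in \<open>auto simp: x_def intro!: holomorphic_intros\<close>)
    have "norm (f (x \<eta>) - (\<Sum>j<1. (deriv ^^ j) (\<lambda>s. f (x s)) 0 / fact j * (complex_of_real \<eta>) ^ j))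
         \<le> 2 * K * (2 * norm (complex_of_real \<eta>) / (r/2)) ^ 1"
      by (rule holomorphic_taylor_bound[OF hol]) (use r \<eta> e K xb in auto)
    moreover have "x \<eta> = y'" "x 0 = y" using e by (auto simp: x_def vec_eq_iff)
    ultimately show ?thesis using e by (simp add: field_simps)
  qed
qed

lemma bounded_hol_psum:
  assumes "abs_conv c r"
  shows "\<exists>K. bounded_hol (psum c) r K"
proof -
  have "norm (psum c y) \<le> (\<Sum>\<^sub>\<infinity>\<alpha>. norm (c \<alpha>) * r ^ (\<Sum>i\<in>UNIV. \<alpha> $ i)) * 1 ^ 0"
    if "\<And>i. norm (y $ i) < r" for y
    by (rule norm_psum_le[OF assms, where w = "\<lambda>_. 0"]) (use that in \<open>auto intro: less_imp_le\<close>)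
  then show ?thesis
    using assms curve_hol_psum[OF assms] unfolding bounded_hol_def abs_conv_def by (simp) blast
qed

text \<open>Subtracting the finitely many terms of degree at most one leaves a series whose terms have degree at least
two, to which the weighted bound applies.\<close>

lemma psum_linear_part:
  fixes c :: "nat ^ 'n \<Rightarrow> complex"
  assumes c: "abs_conv c r"
  obtains C where "\<And>y \<theta>. (\<And>i. norm (y $ i) \<le> \<theta> * r) \<Longrightarrow> 0 \<le> \<theta> \<Longrightarrow> \<theta> \<le> 1 \<Longrightarrow>
     norm (psum c y - psum c 0 - (\<Sum>i\<in>UNIV. c (axis i 1) * y $ i)) \<le> C * \<theta>\<^sup>2"
proof -
  have r: "0 < r" using c by (simp add: abs_conv_def)
  define A :: "(nat ^ 'n) set" where "A = range (\<lambda>i. axis i 1)"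
  define S where "S = insert 0 A"
  have fin: "finite A" "finite S" by (auto simp: S_def A_def)
  have ax: "axis i (1::nat) \<noteq> 0" for i :: 'n by (simp add: axis_eq_0_iff)
  have inj: "inj (\<lambda>i::'n. axis i (1::nat))" by (auto simp: inj_on_def axis_eq_axis)
  define c' where "c' = (\<lambda>\<alpha>. if \<alpha> \<in> S then 0 else c \<alpha>)"
  have c': "abs_conv c' r"
    unfolding abs_conv_def
  proof
    show "(\<lambda>\<alpha>. norm (c' \<alpha>) * r ^ (\<Sum>i\<in>UNIV. \<alpha> $ i)) summable_on UNIV"
      by (rule summable_on_comparison_test[where f = "\<lambda>\<alpha>. norm (c \<alpha>) * r ^ (\<Sum>i\<in>UNIV. \<alpha> $ i)"])
         (use c r in \<open>auto simp: abs_conv_def c'_def\<close>)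
  qed (rule r)
  have deg: "2 \<le> (\<Sum>i\<in>UNIV. 1 * \<alpha> $ i)" if "c' \<alpha> \<noteq> 0" for \<alpha>
  proof (rule ccontr)
    assume "\<not> ?thesis"
    then consider "(\<Sum>i\<in>UNIV. \<alpha> $ i) = 0" | "(\<Sum>i\<in>UNIV. \<alpha> $ i) = 1" by fastforce
    then have "\<alpha> \<in> S"
    proof cases
      case 1
      then show ?thesis by (simp add: S_def vec_eq_iff)
    next
      case 2
      then obtain i where "\<alpha> $ i = 1" "\<And>j. i \<noteq> j \<Longrightarrow> \<alpha> $ j = 0"
        using sum_eq_1_iff[of UNIV "\<lambda>i. \<alpha> $ i"] by auto
      then have "\<alpha> = axis i 1" by (auto simp: vec_eq_iff axis_def)
      then show ?thesis by (simp add: S_def A_def)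
    qed
    then show False using that by (simp add: c'_def)
  qed
  have mon0: "monomial 0 y = 1" for y :: "complex ^ 'n" by (simp add: monomial_def)
  have mon1: "monomial (axis i (Suc 0)) y = y $ i" for y :: "complex ^ 'n" and i
  proof -
    have "monomial (axis i (Suc 0)) y = (\<Prod>j\<in>UNIV. if j = i then y $ j else 1)"
      unfolding monomial_def by (intro prod.cong) (auto simp: axis_def)
    then show ?thesis by simp
  qed
  have split: "psum c y = psum c' y + (c 0 + (\<Sum>i\<in>UNIV. c (axis i 1) * y $ i))"
    if y: "\<And>i. norm (y $ i) \<le> r" for y
  proof -
    have s: "((\<lambda>\<alpha>. if \<alpha> \<in> S then c \<alpha> * monomial \<alpha> y else 0) has_sum (\<Sum>\<alpha>\<in>S. c \<alpha> * monomial \<alpha> y)) UNIV"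
      by (rule has_sum_finite_neutralI[where B = S]) (use fin in auto)
    have "(\<Sum>\<alpha>\<in>S. c \<alpha> * monomial \<alpha> y) = c 0 + (\<Sum>\<alpha>\<in>A. c \<alpha> * monomial \<alpha> y)"
      unfolding S_def using fin ax by (subst sum.insert) (auto simp: A_def mon0)
    also have "(\<Sum>\<alpha>\<in>A. c \<alpha> * monomial \<alpha> y) = (\<Sum>i\<in>UNIV. c (axis i 1) * y $ i)"
      unfolding A_def by (subst sum.reindex[OF inj]) (use mon1 in simp)
    finally have "((\<lambda>\<alpha>. c' \<alpha> * monomial \<alpha> y + (if \<alpha> \<in> S then c \<alpha> * monomial \<alpha> y else 0)) has_sum
        psum c' y + (c 0 + (\<Sum>i\<in>UNIV. c (axis i 1) * y $ i))) UNIV"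
      using has_sum_add[OF has_sum_psum[OF c' y] s] by simp
    also have "(\<lambda>\<alpha>. c' \<alpha> * monomial \<alpha> y + (if \<alpha> \<in> S then c \<alpha> * monomial \<alpha> y else 0))
        = (\<lambda>\<alpha>. c \<alpha> * monomial \<alpha> y)"
      by (auto simp: c'_def)
    finally show ?thesis using has_sum_psum[OF c y] has_sum_unique by blast
  qed
  define C where "C = (\<Sum>\<^sub>\<infinity>\<alpha>. norm (c' \<alpha>) * r ^ (\<Sum>i\<in>UNIV. \<alpha> $ i))"
  have b: "norm (psum c' y) \<le> C * \<theta>\<^sup>2"
    if "\<And>i. norm (y $ i) \<le> \<theta> * r" "0 \<le> \<theta>" "\<theta> \<le> 1" for y \<theta>
    unfolding C_def by (rule norm_psum_le[OF c', where w = "\<lambda>_. 1"]) (use that deg in auto)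
  have "psum c' 0 = 0" using b[of 0 0] by simp
  then have z: "psum c 0 = c 0" using split[of 0] r by simp
  show ?thesis
  proof
    fix y :: "complex ^ 'n" and \<theta>
    assume *: "\<And>i. norm (y $ i) \<le> \<theta> * r" "0 \<le> \<theta>" "\<theta> \<le> 1"
    have "norm (y $ i) \<le> r" for i
      using *(1)[of i] mult_right_mono[OF *(3), of r] r by linarith
    from split[OF this] b[OF *]
    show "norm (psum c y - psum c 0 - (\<Sum>i\<in>UNIV. c (axis i 1) * y $ i)) \<le> C * \<theta>\<^sup>2"
      by (simp add: z algebra_simps)
  qed
qed

lemma holomorphic_near_has_derivative:
  fixes f :: "complex ^ 'n \<Rightarrow> complex"
  assumes "holomorphic_near f a"
  shows "\<exists>L. (f has_derivative (\<lambda>y. \<Sum>i\<in>UNIV. L i * y $ i)) (at a)"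
proof -
  obtain c r where c: "abs_conv c r" and f: "\<And>y. (\<And>i. norm (y $ i) \<le> r) \<Longrightarrow> f (a + y) = psum c y"
    using holomorphic_near_psum[OF assms] by blast
  have r: "0 < r" using c by (simp add: abs_conv_def)
  obtain C where C: "\<And>y \<theta>. (\<And>i. norm (y $ i) \<le> \<theta> * r) \<Longrightarrow> 0 \<le> \<theta> \<Longrightarrow> \<theta> \<le> 1 \<Longrightarrow>
     norm (psum c y - psum c 0 - (\<Sum>i\<in>UNIV. c (axis i 1) * y $ i)) \<le> C * \<theta>\<^sup>2"
    using psum_linear_part[OF c] by blast
  define L where "L = (\<lambda>i. c (axis i 1))"
  have bl: "bounded_linear (\<lambda>y::complex^'n. \<Sum>i\<in>UNIV. L i * y $ i)"
    by (intro bounded_linear_sum bounded_linear_mult_const bounded_linear_const_mult bounded_linear_vec_nth)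
  have bd: "norm (f (a + y) - f a - (\<Sum>i\<in>UNIV. L i * y $ i)) \<le> C / r\<^sup>2 * (norm y)\<^sup>2"
    if "norm y \<le> r" for y
  proof -
    have yi: "norm (y $ i) \<le> norm y" for i by (rule Finite_Cartesian_Product.norm_nth_le)
    have "norm (psum c y - psum c 0 - (\<Sum>i\<in>UNIV. c (axis i 1) * y $ i)) \<le> C * (norm y / r)\<^sup>2"
      by (rule C) (use r that yi in auto)
    moreover have "f (a + y) = psum c y" using f[of y] yi that order_trans by blast
    moreover have "f a = psum c 0" using f[of 0] r by simp
    ultimately show ?thesis by (simp add: L_def power_divide)
  qed
  have "(f has_derivative (\<lambda>y. \<Sum>i\<in>UNIV. L i * y $ i)) (at a)"
    unfolding has_derivative_at
  proof (rule conjI[OF bl])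
    have lim: "((\<lambda>h::complex^'n. C / r\<^sup>2 * norm h) \<longlongrightarrow> 0) (at 0)"
      by (rule tendsto_mult_right_zero[OF tendsto_norm_zero[OF tendsto_ident_at]])
    show "(\<lambda>h. norm (f (a + h) - f a - (\<Sum>i\<in>UNIV. L i * h $ i)) / norm h) \<midarrow>0\<rightarrow> 0"
    proof (rule tendsto_sandwich[OF _ _ tendsto_const lim])
      have "\<forall>\<^sub>F h::complex^'n in at 0. norm h < r \<and> h \<noteq> 0"
        using r by (auto simp: eventually_at intro!: exI[of _ r])
      then show "\<forall>\<^sub>F h in at 0. norm (f (a + h) - f a - (\<Sum>i\<in>UNIV. L i * h $ i)) / norm h \<le> C / r\<^sup>2 * norm h"
      proof eventually_elim
        case (elim h)
        then show ?case using bd[of h] by (simp add: field_simps power2_eq_square)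
      qed
    qed auto
  qed
  then show ?thesis by blast
qed

text \<open>Unlike \<open>partial_deriv\<close>, the line is parametrized so that the point corresponds to 0; this fits
the chain rule for \<open>axis\<close>.\<close>

definition cpartial :: "'n \<Rightarrow> (complex ^ 'n \<Rightarrow> complex) \<Rightarrow> complex ^ 'n \<Rightarrow> complex" where
  "cpartial i f x = deriv (\<lambda>s. f (x + axis i s)) 0"

lemma bounded_linear_axis: "bounded_linear (\<lambda>s::complex. axis i s :: complex ^ 'n)"
proof (rule bounded_linear_intro[where K = 1])
  show "norm (axis i s :: complex ^ 'n) \<le> norm s * 1" for s
  proof -
    have "norm (axis i s :: complex ^ 'n) = sqrt (\<Sum>j\<in>UNIV. if j = i then (norm s)\<^sup>2 else 0)"
      unfolding norm_vec_def L2_set_def by (intro arg_cong[where f = sqrt] sum.cong) (auto simp: axis_def)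
    then show ?thesis by simp
  qed
qed (auto simp: axis_def vec_eq_iff)

lemma has_derivative_axis:
  "((\<lambda>s. x + axis i s :: complex ^ 'n) has_derivative (\<lambda>s::complex. axis i s)) (at s0)"
  using has_derivative_add[OF has_derivative_const[of x] bounded_linear_imp_has_derivative[OF bounded_linear_axis]]
  by simp

lemma has_derivative_componentwise_vec:
  fixes f :: "'a::real_normed_vector \<Rightarrow> complex ^ 'm"
  assumes "\<And>j. ((\<lambda>x. f x $ j) has_derivative (\<lambda>h. f' h $ j)) (at a)"
  shows "(f has_derivative f') (at a)"
proof -
  have *: "(\<Sum>j\<in>UNIV. axis j (v $ j)) = v" for v :: "complex ^ 'm"
    by (auto simp: vec_eq_iff axis_def if_distrib cong: if_cong)
  have "((\<lambda>x. \<Sum>j\<in>UNIV. axis j (f x $ j)) has_derivative (\<lambda>h. \<Sum>j\<in>UNIV. axis j (f' h $ j))) (at a)"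
    by (intro has_derivative_sum bounded_linear.has_derivative[OF bounded_linear_axis] assms)
  then show ?thesis by (simp only: *)
qed

lemma holomorphic_near_has_cpartial:
  fixes f :: "complex ^ 'n \<Rightarrow> complex"
  assumes "holomorphic_near f a"
  shows "(f has_derivative (\<lambda>y. \<Sum>i\<in>UNIV. cpartial i f a * y $ i)) (at a)"
proof -
  obtain L where L: "(f has_derivative (\<lambda>y. \<Sum>i\<in>UNIV. L i * y $ i)) (at a)"
    using holomorphic_near_has_derivative[OF assms] by blast
  have "cpartial i f a = L i" for i
  proof -
    have ax0: "a + axis i 0 = a" by (simp add: axis_def vec_eq_iff)
    have "(f has_derivative (\<lambda>y. \<Sum>i\<in>UNIV. L i * y $ i)) (at (a + axis i 0))"
      unfolding ax0 by (rule L)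
    from has_derivative_compose[OF has_derivative_axis this]
    have "((\<lambda>s. f (a + axis i s)) has_derivative (\<lambda>s. \<Sum>j\<in>UNIV. L j * axis i s $ j)) (at 0)" .
    also have "(\<lambda>s. \<Sum>j\<in>UNIV. L j * axis i s $ j) = (*) (L i)"
      by (auto simp: axis_def if_distrib cong: if_cong)
    finally show ?thesis
      unfolding cpartial_def by (intro DERIV_imp_deriv) (simp add: has_field_derivative_def)
  qed
  then show ?thesis using L by simp
qed

text \<open>The partial derivatives are even Lipschitz at \<open>a\<close>: by Cauchy's inequality for the difference of \<open>f\<close>
along two parallel lines, which is small by the Lipschitz bound. Continuity is needed because curves are
required to be \<open>C\<^sup>1\<close>, and so must be their images.\<close>

lemma isCont_cpartial:
  fixes f :: "complex ^ 'n \<Rightarrow> complex"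
  assumes "holomorphic_near f a"
  shows "isCont (cpartial i f) a"
proof -
  obtain c r where c: "abs_conv c r" and f: "\<And>y. (\<And>i. norm (y $ i) \<le> r) \<Longrightarrow> f (a + y) = psum c y"
    using holomorphic_near_psum[OF assms] by blast
  have r: "0 < r" using c by (simp add: abs_conv_def)
  obtain K where K: "bounded_hol (psum c) r K" using bounded_hol_psum[OF c] by blast
  have lip: "norm (cpartial i f (a + y) - cpartial i f a) \<le> (8 * K / r * norm y) / (r/8)"
    if y: "norm y \<le> r / 8" for y
  proof -
    define g where "g = (\<lambda>y s. psum c (y + axis i s))"
    have yi: "norm (y $ j) \<le> norm y" for j by (rule Finite_Cartesian_Product.norm_nth_le)
    have b: "norm ((v + axis i s) $ j) < r / 2" if "norm s < r / 4" "\<And>j. norm (v $ j) \<le> r/8" for s v j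
    proof -
      have "norm ((v + axis i s) $ j) \<le> norm (v $ j) + norm (axis i s $ j)"
        by (simp add: norm_triangle_ineq)
      also have "\<dots> \<le> r / 8 + norm s" by (intro add_mono that) (simp add: axis_def)
      finally show ?thesis using that(1) r by linarith
    qed
    have y8: "norm (y $ j) \<le> r/8" "norm ((0::complex^'n) $ j) \<le> r/8" for j
      using yi[of j] y r by auto
    have hol: "g v holomorphic_on ball 0 (r/4)" if "\<And>j. norm (v $ j) \<le> r/8" for v
      unfolding g_def
    proof (rule curve_holD[OF curve_hol_psum[OF c]])
      show "(\<lambda>t. (v + axis i t) $ j) holomorphic_on ball 0 (r/4)" for j
        by (cases "j = i") (auto simp: axis_def intro!: holomorphic_intros)
      show "norm ((v + axis i t) $ j) < r" if "t \<in> ball 0 (r/4)" for t j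
        using b[of t v j] that \<open>\<And>j. norm (v $ j) \<le> r/8\<close> r by force
    qed auto
    have eq: "cpartial i f (a + v) = deriv (g v) 0" if "\<And>j. norm (v $ j) \<le> r/8" for v
      unfolding cpartial_def
    proof (rule deriv_cong_ev)
      have "\<forall>\<^sub>F s::complex in nhds 0. norm s < r/4"
        using r by (auto simp: eventually_nhds_metric intro!: exI[of _ "r/4"])
      then show "\<forall>\<^sub>F s in nhds 0. f (a + v + axis i s) = g v s"
      proof eventually_elim
        case (elim s)
        have "norm ((v + axis i s) $ j) \<le> r" for j using b[OF elim that, of j] r by linarith
        then show ?case using f[of "v + axis i s"] by (simp add: g_def add.assoc)
      qed
    qed simp
    have dd: "g v field_differentiable at 0" if "\<And>j. norm (v $ j) \<le> r/8" for v
      using holomorphic_on_imp_differentiable_at[OF hol[OF that]] r by simp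
    have "cpartial i f (a + y) - cpartial i f (a + 0) = deriv (\<lambda>s. g y s - g 0 s) 0"
      unfolding eq[OF y8(1)] eq[OF y8(2)] by (rule deriv_diff[OF dd dd, OF y8, symmetric])
    moreover have "norm ((deriv ^^ 1) (\<lambda>s. g y s - g 0 s) 0) \<le> fact 1 * (8 * K / r * norm y) / (r/8) ^ 1"
    proof (rule Cauchy_inequality)
      have h: "(\<lambda>s. g y s - g 0 s) holomorphic_on ball 0 (r/4)"
        using y8 by (intro holomorphic_intros hol) auto
      then show "(\<lambda>s. g y s - g 0 s) holomorphic_on ball 0 (r/8)"
        "continuous_on (cball 0 (r/8)) (\<lambda>s. g y s - g 0 s)"
        using r by (auto intro!: holomorphic_on_imp_continuous_on elim!: holomorphic_on_subset)
      fix s :: complex assume "norm (0 - s) = r/8"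
      then have s: "norm s < r / 4" using r by simp
      show "norm (g y s - g 0 s) \<le> 8 * K / r * norm y"
        unfolding g_def
      proof (rule bounded_hol_lipschitz[OF K])
        show "norm ((0 + axis i s) $ j) \<le> r / 2" for j using b[OF s y8(2), of j] by simp
        show "norm ((y + axis i s) $ j - (0 + axis i s) $ j) \<le> norm y" for j using yi by simp
      qed (rule y)
    qed (use r in auto)
    ultimately show ?thesis by simp
  qed
  show ?thesis
    unfolding continuous_at_eps_delta
  proof (intro allI impI)
    fix e :: real assume e: "e > 0"
    define L where "L = \<bar>64 * K / r\<^sup>2\<bar> + 1"
    have L: "L > 0" "64 * K / r\<^sup>2 \<le> L" unfolding L_def by linarith+
    have "dist (cpartial i f x) (cpartial i f a) < e" if x: "dist x a < min (r/8) (e / L)" for x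
    proof -
      have "norm (cpartial i f (a + (x - a)) - cpartial i f a) \<le> (8 * K / r * norm (x - a)) / (r/8)"
        using x by (intro lip) (simp add: dist_norm)
      also have "\<dots> = 64 * K / r\<^sup>2 * norm (x - a)" by (simp add: power2_eq_square)
      also have "\<dots> \<le> L * norm (x - a)" by (intro mult_right_mono L) auto
      also have "\<dots> < e" using x L(1) by (simp add: dist_norm field_simps)
      finally show ?thesis by (simp add: dist_norm)
    qed
    moreover have "0 < min (r/8) (e / L)" using r e L by simp
    ultimately show "\<exists>d>0. \<forall>x. dist x a < d \<longrightarrow> dist (cpartial i f x) (cpartial i f a) < e" by blast
  qed
qed

definition jac :: "(complex ^ 'n \<Rightarrow> complex ^ 'm) \<Rightarrow> complex ^ 'n \<Rightarrow> complex ^ 'n ^ 'm" where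
  "jac f x = (\<chi> j i. cpartial i (\<lambda>x. f x $ j) x)"

lemma has_derivative_jac:
  fixes f :: "complex ^ 'n \<Rightarrow> complex ^ 'm"
  assumes "\<And>j. holomorphic_near (\<lambda>x. f x $ j) a"
  shows "(f has_derivative (\<lambda>y. jac f a *v y)) (at a)"
proof -
  have "((\<lambda>x. f x $ j) has_derivative (\<lambda>y. (jac f a *v y) $ j)) (at a)" for j
    using holomorphic_near_has_cpartial[OF assms[of j]] by (simp add: jac_def matrix_vector_mult_def)
  then show ?thesis by (rule has_derivative_componentwise_vec)
qed

lemma continuous_on_jac:
  fixes f :: "complex ^ 'n \<Rightarrow> complex ^ 'm"
  assumes "holomorphic_map_on f U"
  shows "continuous_on U (jac f)"
  unfolding jac_def
  by (intro continuous_on_vec_lambda continuous_at_imp_continuous_on ballI isCont_cpartial)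
     (use assms in \<open>auto simp: holomorphic_map_on_def\<close>)

section \<open>Images of curves and jets\<close>

lemma matrix_vector_mult_scaleR_complex:
  "A *v (l *\<^sub>R x) = l *\<^sub>R (A *v x)" for A :: "complex ^ 'n ^ 'm"
  by (simp add: matrix_vector_mult_def vec_eq_iff scaleR_sum_right)

lemma holomorphic_map_on_has_derivative:
  assumes "holomorphic_map_on \<phi> U" "x \<in> U"
  shows "(\<phi> has_derivative (\<lambda>y. jac \<phi> x *v y)) (at x)"
  using assms by (intro has_derivative_jac) (auto simp: holomorphic_map_on_def)

lemma curve_in_compose:
  assumes \<phi>: "local_biholomorphism \<phi> M p N q" and \<gamma>: "curve_in M p \<gamma>"
  shows "curve_in N q (\<phi> \<circ> \<gamma>)" and "velocity (\<phi> \<circ> \<gamma>) = jac \<phi> p *v velocity \<gamma>"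
proof -
  obtain U V \<psi> where U: "open U" "p \<in> U" and \<phi>p: "\<phi> p = q" and hol: "holomorphic_map_on \<phi> U"
    and MN: "\<phi> ` (M \<inter> U) = N \<inter> V"
    using \<phi> unfolding local_biholomorphism_def by blast
  obtain e D where e: "e > 0" and \<gamma>0: "\<gamma> 0 = p" and \<gamma>M: "\<gamma> ` {-e<..<e} \<subseteq> M"
    and D: "\<And>t. t \<in> {-e<..<e} \<Longrightarrow> (\<gamma> has_vector_derivative D t) (at t)"
    and D_cont: "continuous_on {-e<..<e} D"
    using \<gamma> unfolding curve_in_def C1_differentiable_on_def by blast
  have cont: "continuous_on {-e<..<e} \<gamma>"
    using D by (intro continuous_at_imp_continuous_on) (blast intro: has_vector_derivative_continuous)
  have "open ({-e<..<e} \<inter> \<gamma> -` U)"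
    by (intro continuous_open_preimage cont U) auto
  moreover have "0 \<in> {-e<..<e} \<inter> \<gamma> -` U" using e U \<gamma>0 by auto
  ultimately obtain d where d: "d > 0" "ball 0 d \<subseteq> {-e<..<e} \<inter> \<gamma> -` U"
    using open_contains_ball by blast
  have sub: "{-d<..<d} \<subseteq> {-e<..<e} \<inter> \<gamma> -` U" using d(2) by (auto simp: ball_def dist_real_def subset_iff)
  define E where "E = (\<lambda>t. jac \<phi> (\<gamma> t) *v D t)"
  have E: "((\<phi> \<circ> \<gamma>) has_vector_derivative E t) (at t)" if "t \<in> {-d<..<d}" for t
  proof -
    have "(\<phi> has_derivative (\<lambda>y. jac \<phi> (\<gamma> t) *v y)) (at (\<gamma> t))"
      using sub that by (intro holomorphic_map_on_has_derivative[OF hol]) auto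
    moreover have "(\<gamma> has_derivative (\<lambda>h. h *\<^sub>R D t)) (at t)"
      using D[of t] sub that by (auto simp: has_vector_derivative_def)
    ultimately have "((\<lambda>t. \<phi> (\<gamma> t)) has_derivative (\<lambda>h. jac \<phi> (\<gamma> t) *v (h *\<^sub>R D t))) (at t)"
      using has_derivative_compose by blast
    then show ?thesis
      by (simp add: has_vector_derivative_def E_def matrix_vector_mult_scaleR_complex o_def)
  qed
  have jc: "continuous_on {-d<..<d} (\<lambda>t. jac \<phi> (\<gamma> t))"
    by (rule continuous_on_compose2[OF continuous_on_jac[OF hol] continuous_on_subset[OF cont]])
       (use sub in auto)
  have Dc: "continuous_on {-d<..<d} D" by (rule continuous_on_subset[OF D_cont]) (use sub in auto)
  have "continuous_on {-d<..<d} E"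
    unfolding E_def matrix_vector_mult_def by (intro continuous_intros jc Dc)
  then have "(\<phi> \<circ> \<gamma>) C1_differentiable_on {-d<..<d}"
    unfolding C1_differentiable_on_def using E by blast
  moreover have "(\<phi> \<circ> \<gamma>) ` {-d<..<d} \<subseteq> N" using sub MN \<gamma>M by fastforce
  ultimately show "curve_in N q (\<phi> \<circ> \<gamma>)"
    unfolding curve_in_def using d(1) \<gamma>0 \<phi>p by auto
  have "velocity \<gamma> = D 0" unfolding velocity_def using D[of 0] e by (auto intro: vector_derivative_at)
  then show "velocity (\<phi> \<circ> \<gamma>) = jac \<phi> p *v velocity \<gamma>"
    unfolding velocity_def using E[of 0] d(1) \<gamma>0 by (auto simp: E_def dest!: vector_derivative_at)
qed

text \<open>The inverse is again a local biholomorphism, so that everything which is transported forward by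
\<open>\<phi>\<close> (tangent vectors, complex tangent vectors) can be transported back.\<close>

lemma local_biholomorphism_inverse:
  assumes "local_biholomorphism \<phi> M p N q"
  obtains \<psi> where "local_biholomorphism \<psi> N q M p"
    "\<And>X. jac \<psi> q *v (jac \<phi> p *v X) = X" "\<And>Y. jac \<phi> p *v (jac \<psi> q *v Y) = Y"
proof -
  obtain U V \<psi> where U: "open U" "p \<in> U" and V: "open V" and \<phi>p: "\<phi> p = q" and UV: "\<phi> ` U = V"
    and inv: "\<And>x. x \<in> U \<Longrightarrow> \<psi> (\<phi> x) = x"
    and hol: "holomorphic_map_on \<phi> U" "holomorphic_map_on \<psi> V"
    and MN: "\<phi> ` (M \<inter> U) = N \<inter> V"
    using assms unfolding local_biholomorphism_def by blast
  have q: "q \<in> V" "\<psi> q = p" using U UV \<phi>p inv by auto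
  have inv': "\<phi> (\<psi> y) = y" if "y \<in> V" for y using that UV inv by auto
  have VU: "\<psi> ` V = U" unfolding UV[symmetric] using inv by force
  have NM: "\<psi> ` (N \<inter> V) = M \<inter> U" unfolding MN[symmetric] using inv by force
  have "local_biholomorphism \<psi> N q M p"
    unfolding local_biholomorphism_def
    by (intro exI[of _ V] exI[of _ U] exI[of _ \<phi>] conjI ballI V U q hol VU NM inv')
  moreover have "jac \<psi> q *v (jac \<phi> p *v X) = X" for X
  proof -
    have "(\<phi> has_derivative (\<lambda>y. jac \<phi> p *v y)) (at p)"
      by (rule holomorphic_map_on_has_derivative[OF hol(1) U(2)])
    moreover have "(\<psi> has_derivative (\<lambda>y. jac \<psi> q *v y)) (at (\<phi> p))"
      unfolding \<phi>p by (rule holomorphic_map_on_has_derivative[OF hol(2) q(1)])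
    ultimately have "((\<lambda>x. \<psi> (\<phi> x)) has_derivative (\<lambda>y. jac \<psi> q *v (jac \<phi> p *v y))) (at p)"
      by (rule has_derivative_compose)
    then have "((\<lambda>x. x) has_derivative (\<lambda>y. jac \<psi> q *v (jac \<phi> p *v y))) (at p)"
      using U inv by (rule has_derivative_transform_within_open)
    from has_derivative_unique[OF this has_derivative_ident] show ?thesis by meson
  qed
  moreover have "jac \<phi> p *v (jac \<psi> q *v X) = X" for X
  proof -
    have "(\<phi> has_derivative (\<lambda>y. jac \<phi> p *v y)) (at (\<psi> q))"
      unfolding q by (rule holomorphic_map_on_has_derivative[OF hol(1) U(2)])
    moreover have "(\<psi> has_derivative (\<lambda>y. jac \<psi> q *v y)) (at q)"
      by (rule holomorphic_map_on_has_derivative[OF hol(2) q(1)])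
    ultimately have "((\<lambda>x. \<phi> (\<psi> x)) has_derivative (\<lambda>y. jac \<phi> p *v (jac \<psi> q *v y))) (at q)"
      by (rule has_derivative_compose[rotated])
    then have "((\<lambda>x. x) has_derivative (\<lambda>y. jac \<phi> p *v (jac \<psi> q *v y))) (at q)"
      using V q(1) inv' by (rule has_derivative_transform_within_open)
    from has_derivative_unique[OF this has_derivative_ident] show ?thesis by meson
  qed
  ultimately show ?thesis using that by blast
qed

lemma tangent_space_push:
  assumes "local_biholomorphism \<phi> M p N q" "X \<in> tangent_space M p"
  shows "jac \<phi> p *v X \<in> tangent_space N q"
proof -
  obtain \<gamma> where "curve_in M p \<gamma>" "X = velocity \<gamma>" using assms(2) by (auto simp: tangent_space_def)
  then show ?thesis
    unfolding tangent_space_def using curve_in_compose[OF assms(1)]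
    by (intro image_eqI[of _ _ "\<phi> \<circ> \<gamma>"]) auto
qed

lemma complex_tangent_space_push:
  assumes "local_biholomorphism \<phi> M p N q" "X \<in> complex_tangent_space M p"
  shows "jac \<phi> p *v X \<in> complex_tangent_space N q"
  using assms tangent_space_push[OF assms(1)]
  by (auto simp: complex_tangent_space_def vector_scalar_commute[symmetric])

lemma transversal_curves_push:
  assumes \<phi>: "local_biholomorphism \<phi> M p N q" and \<gamma>: "\<gamma> \<in> transversal_curves M p"
  shows "\<phi> \<circ> \<gamma> \<in> transversal_curves N q"
proof -
  obtain \<psi> where \<psi>: "local_biholomorphism \<psi> N q M p" and inv: "\<And>X. jac \<psi> q *v (jac \<phi> p *v X) = X"
    using local_biholomorphism_inverse[OF \<phi>] by metis
  have c: "curve_in M p \<gamma>" "velocity \<gamma> \<notin> complex_tangent_space M p"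
    using \<gamma> by (auto simp: transversal_curves_def)
  have "jac \<phi> p *v velocity \<gamma> \<notin> complex_tangent_space N q"
    using complex_tangent_space_push[OF \<psi>, of "jac \<phi> p *v velocity \<gamma>"] inv c by auto
  then show ?thesis
    using curve_in_compose[OF \<phi> c(1)] by (simp add: transversal_curves_def)
qed

lemma equiv_same_jet: "equiv (transversal_curves M p) (same_jet M p)"
proof (rule equivI)
  show "refl_on (transversal_curves M p) (same_jet M p)"
    by (auto simp: refl_on_def same_jet_def intro!: exI[of _ 1])
  show "sym (same_jet M p)"
  proof (rule symI)
    fix \<gamma> \<delta> assume "(\<gamma>, \<delta>) \<in> same_jet M p"
    then obtain l where "l \<noteq> 0" "velocity \<delta> = l *\<^sub>R velocity \<gamma>"
      "\<gamma> \<in> transversal_curves M p" "\<delta> \<in> transversal_curves M p"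
      by (auto simp: same_jet_def)
    then show "(\<delta>, \<gamma>) \<in> same_jet M p"
      by (auto simp: same_jet_def intro!: exI[of _ "inverse l"])
  qed
  show "trans (same_jet M p)"
  proof (rule transI)
    fix \<gamma> \<delta> \<eta> assume "(\<gamma>, \<delta>) \<in> same_jet M p" "(\<delta>, \<eta>) \<in> same_jet M p"
    then obtain l m where "l \<noteq> 0" "m \<noteq> 0" "velocity \<delta> = l *\<^sub>R velocity \<gamma>" "velocity \<eta> = m *\<^sub>R velocity \<delta>"
      "\<gamma> \<in> transversal_curves M p" "\<eta> \<in> transversal_curves M p"
      by (auto simp: same_jet_def)
    then show "(\<gamma>, \<eta>) \<in> same_jet M p"
      by (auto simp: same_jet_def intro!: exI[of _ "m * l"])
  qed
qed (auto simp: same_jet_def)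

text \<open>A 1-jet is determined by the line spanned by the velocity, and the velocity is transformed linearly;
hence the image of a jet is represented by the image of any representative.\<close>

lemma prolongation_class:
  assumes \<phi>: "local_biholomorphism \<phi> M p N q" and \<gamma>: "\<gamma> \<in> transversal_curves M p"
  shows "prolongation \<phi> N q (same_jet M p `` {\<gamma>}) = same_jet N q `` {\<phi> \<circ> \<gamma>}"
proof -
  have *: "(\<phi> \<circ> \<gamma>, \<phi> \<circ> \<gamma>') \<in> same_jet N q" if rel: "(\<gamma>, \<gamma>') \<in> same_jet M p" for \<gamma>'
  proof -
    obtain l where "l \<noteq> 0" "velocity \<gamma>' = l *\<^sub>R velocity \<gamma>" and t: "\<gamma>' \<in> transversal_curves M p"
      using rel by (auto simp: same_jet_def)
    moreover have "curve_in M p \<gamma>" "curve_in M p \<gamma>'" using \<gamma> t by (auto simp: transversal_curves_def)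
    ultimately show ?thesis
      using transversal_curves_push[OF \<phi> \<gamma>] transversal_curves_push[OF \<phi> t]
      by (auto simp: same_jet_def curve_in_compose(2)[OF \<phi>] matrix_vector_mult_scaleR_complex)
  qed
  have eq: "same_jet N q `` {\<phi> \<circ> \<gamma>'} = same_jet N q `` {\<phi> \<circ> \<gamma>}" if "(\<gamma>, \<gamma>') \<in> same_jet M p" for \<gamma>'
    using equiv_class_eq[OF equiv_same_jet *[OF that]] by (rule sym)
  have self: "\<gamma> \<in> same_jet M p `` {\<gamma>}" by (rule equiv_class_self[OF equiv_same_jet \<gamma>])
  have "prolongation \<phi> N q (same_jet M p `` {\<gamma>})
      = (\<Union>\<gamma>'\<in>same_jet M p `` {\<gamma>}. same_jet N q `` {\<phi> \<circ> \<gamma>'})"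
    unfolding prolongation_def by blast
  also have "\<dots> = (\<Union>\<gamma>'\<in>same_jet M p `` {\<gamma>}. same_jet N q `` {\<phi> \<circ> \<gamma>})"
    by (rule SUP_cong) (use eq in auto)
  also have "\<dots> = same_jet N q `` {\<phi> \<circ> \<gamma>}" using self by blast
  finally show ?thesis .
qed

section \<open>Hypersurfaces in normal form\<close>

lemma exhaust_5:
  fixes x :: 5
  shows "x = 1 \<or> x = 2 \<or> x = 3 \<or> x = 4 \<or> x = 5"
proof (induct x)
  case (of_int z)
  then have "z = 0 \<or> z = 1 \<or> z = 2 \<or> z = 3 \<or> z = 4" by fastforce
  then show ?case by auto
qed

lemma forall_5: "(\<forall>i::5. P i) \<longleftrightarrow> P 1 \<and> P 2 \<and> P 3 \<and> P 4 \<and> P 5"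
  by (metis exhaust_5)

lemma UNIV_5: "UNIV = {1, 2, 3, 4, 5::5}"
  using exhaust_5 by auto

lemma sum_5: "sum f (UNIV::5 set) = f 1 + f 2 + f 3 + f 4 + f 5"
  unfolding UNIV_5 by (simp add: ac_simps)

text \<open>The polarization of \<open>normal_part\<close>: the conjugates of \<open>z\<close> and \<open>\<zeta>\<close> are replaced by
independent variables.\<close>

definition normal_poly :: "complex \<Rightarrow> complex \<Rightarrow> complex \<Rightarrow> complex \<Rightarrow> complex \<Rightarrow> complex" where
  "normal_poly c z \<zeta> \<xi> \<eta> =
     z * \<xi> + 1/2 * \<xi>\<^sup>2 * \<zeta> + 1/2 * z\<^sup>2 * \<eta> + z * \<xi> * \<zeta> * \<eta>
     + 1/2 * \<xi>\<^sup>2 * \<zeta> * \<zeta> * \<eta> + 1/2 * z\<^sup>2 * \<eta> * \<zeta> * \<eta>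
     + c * z ^ 3 * \<eta>\<^sup>2 + cnj c * \<xi> ^ 3 * \<zeta>\<^sup>2"

definition graph_fun :: "complex \<Rightarrow> (nat ^ 5 \<Rightarrow> complex) \<Rightarrow> complex ^ 5 \<Rightarrow> complex" where
  "graph_fun c R X = normal_poly c (X $ 1) (X $ 2) (X $ 3) (X $ 4) + psum R X"

definition real_point :: "complex \<Rightarrow> complex \<Rightarrow> real \<Rightarrow> complex ^ 5" where
  "real_point z \<zeta> v = vector [z, \<zeta>, cnj z, cnj \<zeta>, complex_of_real v]"

lemma normal_poly_cnj: "normal_poly c z \<zeta> (cnj z) (cnj \<zeta>) = normal_part c z \<zeta>"
  by (simp add: normal_poly_def normal_part_def)

text \<open>A quantitative version of \<open>normalized_at_0\<close> with one radius \<open>r\<close> for convergence and for the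
equation of \<open>N\<close>. The bound \<open>r \<le> 1\<close> makes higher powers of the coordinates smaller than lower ones.\<close>

definition normal_form :: "complex \<Rightarrow> (nat ^ 5 \<Rightarrow> complex) \<Rightarrow> real \<Rightarrow> (complex ^ 3) set \<Rightarrow> bool" where
  "normal_form c R r N \<longleftrightarrow> abs_conv R r \<and> r \<le> 1 \<and> (\<forall>\<alpha>. R \<alpha> \<noteq> 0 \<longrightarrow> 6 \<le> weight \<alpha>) \<and>
     (\<forall>z \<zeta> v. norm z < r \<and> norm \<zeta> < r \<and> \<bar>v\<bar> < r \<longrightarrow> Im (graph_fun c R (real_point z \<zeta> v)) = 0) \<and>
     (\<forall>q. (\<forall>i. norm (q $ i) < r) \<longrightarrow>
        (q \<in> N \<longleftrightarrow> Re (q $ 3) = Re (graph_fun c R (real_point (q $ 1) (q $ 2) (Im (q $ 3))))))"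

lemma normalized_at_0_normal_form:
  assumes "normalized_at_0 N c"
  obtains R r where "normal_form c R r N"
proof -
  obtain F :: "complex \<Rightarrow> complex \<Rightarrow> real \<Rightarrow> real" and R :: "nat ^ 5 \<Rightarrow> complex"
    where w: "\<And>\<alpha>. R \<alpha> \<noteq> 0 \<Longrightarrow> weight \<alpha> \<ge> 6"
    and ev1: "\<forall>\<^sub>F (z, \<zeta>, v) in nhds (0, 0, 0).
           ((\<lambda>\<alpha>. R \<alpha> * monomial \<alpha> (real_point z \<zeta> v))
              has_sum (complex_of_real (F z \<zeta> v) - normal_part c z \<zeta>)) UNIV"
    and ev2: "\<forall>\<^sub>F q in nhds 0. q \<in> N \<longleftrightarrow> Re (q $ 3) = F (q $ 1) (q $ 2) (Im (q $ 3))"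
    using assms unfolding normalized_at_0_def real_point_def by blast
  obtain e1 where e1: "e1 > 0" and s: "\<And>z \<zeta> v. dist (z, \<zeta>, v) (0, 0, 0) < e1 \<Longrightarrow>
           ((\<lambda>\<alpha>. R \<alpha> * monomial \<alpha> (real_point z \<zeta> v))
              has_sum (complex_of_real (F z \<zeta> v) - normal_part c z \<zeta>)) UNIV"
    using ev1 unfolding eventually_nhds_metric by (auto simp: case_prod_unfold)
  obtain e2 where e2: "e2 > 0" and n: "\<And>q. dist q 0 < e2 \<Longrightarrow>
      q \<in> N \<longleftrightarrow> Re (q $ 3) = F (q $ 1) (q $ 2) (Im (q $ 3))"
    using ev2 unfolding eventually_nhds_metric by auto
  define r where "r = min 1 (min (e1/4) (e2/4))"
  have r: "0 < r" "r \<le> 1" "4 * r \<le> e1" "4 * r \<le> e2" using e1 e2 by (auto simp: r_def)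
  have s': "((\<lambda>\<alpha>. R \<alpha> * monomial \<alpha> (real_point z \<zeta> v))
              has_sum (complex_of_real (F z \<zeta> v) - normal_part c z \<zeta>)) UNIV"
    if "norm z \<le> r" "norm \<zeta> \<le> r" "\<bar>v\<bar> \<le> r" for z \<zeta> v
  proof (rule s)
    have "norm (z, \<zeta>, v) \<le> norm z + (norm \<zeta> + norm v)"
      using norm_Pair_le[of z "(\<zeta>, v)"] norm_Pair_le[of \<zeta> v] by linarith
    also have "\<dots> < e1" using that r by simp
    finally show "dist (z, \<zeta>, v) (0, 0, 0) < e1" by (simp add: dist_norm)
  qed
  have conv: "abs_conv R r"
  proof (rule abs_convI)
    have "real_point (of_real r) (of_real r) r = (\<chi> i. complex_of_real r)"
      by (simp add: real_point_def vec_eq_iff forall_5 vector_5)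
    then show "(\<lambda>\<alpha>. R \<alpha> * monomial \<alpha> (\<chi> i. complex_of_real r)) summable_on UNIV"
      using s'[of "of_real r" "of_real r" r] r by (auto dest: has_sum_imp_summable)
  qed (rule r)
  have F: "complex_of_real (F z \<zeta> v) = graph_fun c R (real_point z \<zeta> v)"
    if "norm z < r" "norm \<zeta> < r" "\<bar>v\<bar> < r" for z \<zeta> v
  proof -
    have "psum R (real_point z \<zeta> v) = complex_of_real (F z \<zeta> v) - normal_part c z \<zeta>"
      unfolding psum_def using that by (intro infsumI s') auto
    then show ?thesis by (simp add: graph_fun_def real_point_def vector_5 normal_poly_cnj)
  qed
  have "normal_form c R r N"
    unfolding normal_form_def
  proof (intro conjI allI impI conv r w)
    fix z \<zeta> :: complex and v :: real assume "norm z < r \<and> norm \<zeta> < r \<and> \<bar>v\<bar> < r"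
    then show "Im (graph_fun c R (real_point z \<zeta> v)) = 0"
      by (subst F[symmetric]) auto
  next
    fix q :: "complex ^ 3" assume q: "\<forall>i. norm (q $ i) < r"
    have "norm q \<le> (\<Sum>i\<in>UNIV. norm (q $ i))" by (simp add: norm_vec_def L2_set_le_sum)
    also have "\<dots> < e2" using q[rule_format, of 1] q[rule_format, of 2] q[rule_format, of 3] r
      by (simp add: sum_3)
    finally have "q \<in> N \<longleftrightarrow> Re (q $ 3) = F (q $ 1) (q $ 2) (Im (q $ 3))" by (intro n) simp
    moreover have "\<bar>Im (q $ 3)\<bar> < r" using abs_Im_le_cmod[of "q $ 3"] q[rule_format, of 3] by linarith
    ultimately show "q \<in> N \<longleftrightarrow> Re (q $ 3) = Re (graph_fun c R (real_point (q $ 1) (q $ 2) (Im (q $ 3))))"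
      using F[of "q $ 1" "q $ 2" "Im (q $ 3)"] q by (metis Re_complex_of_real)
  qed (auto intro: w)
  then show ?thesis by (rule that)
qed

lemma norm_normal_poly_le:
  assumes "norm z \<le> m" "norm \<zeta> \<le> m" "norm \<xi> \<le> m" "norm \<eta> \<le> m" "m \<le> 1"
  shows "norm (normal_poly c z \<zeta> \<xi> \<eta>) \<le> (5 + 2 * norm c) * m\<^sup>2"
proof -
  have m: "0 \<le> m" using assms(1) norm_ge_zero order_trans by blast
  have p: "m ^ k \<le> m\<^sup>2" if "2 \<le> k" for k using that m assms(5) by (rule power_decreasing)
  have 3: "m * m * m \<le> m\<^sup>2" "m * m * m * m \<le> m\<^sup>2" "m * m * m * m * m \<le> m\<^sup>2"
    using p[of 3] p[of 4] p[of 5] by (simp_all add: eval_nat_numeral mult_ac)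
  have t1: "norm (z * \<xi>) \<le> m\<^sup>2"
    unfolding norm_mult power2_eq_square by (intro mult_mono assms) (use m in auto)
  have t2: "norm (1/2 * \<xi>\<^sup>2 * \<zeta>) \<le> m\<^sup>2 / 2"
  proof -
    have "norm \<xi> * norm \<xi> * norm \<zeta> \<le> m * m * m" by (intro mult_mono assms mult_nonneg_nonneg) (use m in auto)
    then show ?thesis using 3 by (simp add: norm_mult norm_power power2_eq_square)
  qed
  have t3: "norm (1/2 * z\<^sup>2 * \<eta>) \<le> m\<^sup>2 / 2"
  proof -
    have "norm z * norm z * norm \<eta> \<le> m * m * m" by (intro mult_mono assms mult_nonneg_nonneg) (use m in auto)
    then show ?thesis using 3 by (simp add: norm_mult norm_power power2_eq_square)
  qed
  have t4: "norm (z * \<xi> * \<zeta> * \<eta>) \<le> m\<^sup>2"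
  proof -
    have "norm z * norm \<xi> * norm \<zeta> * norm \<eta> \<le> m * m * m * m" by (intro mult_mono assms mult_nonneg_nonneg) (use m in auto)
    then show ?thesis using 3 by (simp add: norm_mult)
  qed
  have t5: "norm (1/2 * \<xi>\<^sup>2 * \<zeta> * \<zeta> * \<eta>) \<le> m\<^sup>2 / 2"
  proof -
    have "norm \<xi> * norm \<xi> * norm \<zeta> * norm \<zeta> * norm \<eta> \<le> m * m * m * m * m" by (intro mult_mono assms mult_nonneg_nonneg) (use m in auto)
    then show ?thesis using 3 by (simp add: norm_mult norm_power power2_eq_square)
  qed
  have t6: "norm (1/2 * z\<^sup>2 * \<eta> * \<zeta> * \<eta>) \<le> m\<^sup>2 / 2"
  proof -
    have "norm z * norm z * norm \<eta> * norm \<zeta> * norm \<eta> \<le> m * m * m * m * m" by (intro mult_mono assms mult_nonneg_nonneg) (use m in auto)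
    then show ?thesis using 3 by (simp add: norm_mult norm_power power2_eq_square)
  qed
  have t7: "norm (c * z ^ 3 * \<eta>\<^sup>2) \<le> norm c * m\<^sup>2"
  proof -
    have "norm z * norm z * norm z * norm \<eta> * norm \<eta> \<le> m * m * m * m * m" by (intro mult_mono assms mult_nonneg_nonneg) (use m in auto)
    then have "norm c * (norm z * norm z * norm z * norm \<eta> * norm \<eta>) \<le> norm c * m\<^sup>2" using 3 by (intro mult_left_mono) auto
    then show ?thesis by (simp add: norm_mult norm_power power2_eq_square power3_eq_cube mult_ac)
  qed
  have t8: "norm (cnj c * \<xi> ^ 3 * \<zeta>\<^sup>2) \<le> norm c * m\<^sup>2"
  proof -
    have "norm \<xi> * norm \<xi> * norm \<xi> * norm \<zeta> * norm \<zeta> \<le> m * m * m * m * m" by (intro mult_mono assms mult_nonneg_nonneg) (use m in auto)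
    then have "norm c * (norm \<xi> * norm \<xi> * norm \<xi> * norm \<zeta> * norm \<zeta>) \<le> norm c * m\<^sup>2" using 3 by (intro mult_left_mono) auto
    then show ?thesis by (simp add: norm_mult norm_power power2_eq_square power3_eq_cube mult_ac)
  qed
  have "norm (normal_poly c z \<zeta> \<xi> \<eta>) \<le> norm (z * \<xi>) + norm (1/2 * \<xi>\<^sup>2 * \<zeta>) + norm (1/2 * z\<^sup>2 * \<eta>)
     + norm (z * \<xi> * \<zeta> * \<eta>) + norm (1/2 * \<xi>\<^sup>2 * \<zeta> * \<zeta> * \<eta>) + norm (1/2 * z\<^sup>2 * \<eta> * \<zeta> * \<eta>)
     + norm (c * z ^ 3 * \<eta>\<^sup>2) + norm (cnj c * \<xi> ^ 3 * \<zeta>\<^sup>2)"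
    unfolding normal_poly_def by (intro order_trans[OF norm_triangle_ineq] add_right_mono order_refl)
  also have "\<dots> \<le> m\<^sup>2 + m\<^sup>2/2 + m\<^sup>2/2 + m\<^sup>2 + m\<^sup>2/2 + m\<^sup>2/2 + norm c * m\<^sup>2 + norm c * m\<^sup>2"
    by (intro add_mono t1 t2 t3 t4 t5 t6 t7 t8)
  also have "\<dots> \<le> (5 + 2 * norm c) * m\<^sup>2" by (simp add: algebra_simps)
  finally show ?thesis .
qed

text \<open>The weight of the remainder counts \<open>v\<close> twice; the estimate holds where \<open>v\<close> is of second order.\<close>

lemma normal_form_remainder:
  assumes N: "normal_form c R r N"
  obtains C where "\<And>X \<theta>. (\<And>i. i \<noteq> 5 \<Longrightarrow> norm (X $ i) \<le> \<theta> * r) \<Longrightarrow> norm (X $ 5) \<le> \<theta>\<^sup>2 * r \<Longrightarrow>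
      0 \<le> \<theta> \<Longrightarrow> \<theta> \<le> 1 \<Longrightarrow> norm (psum R X) \<le> C * \<theta> ^ 6"
proof
  fix X :: "complex ^ 5" and \<theta>
  assume X: "\<And>i. i \<noteq> 5 \<Longrightarrow> norm (X $ i) \<le> \<theta> * r" "norm (X $ 5) \<le> \<theta>\<^sup>2 * r" and \<theta>: "0 \<le> \<theta>" "\<theta> \<le> 1"
  define w :: "5 \<Rightarrow> nat" where "w = (\<lambda>i. if i = 5 then 2 else 1)"
  have conv: "abs_conv R r" and wt: "\<And>\<alpha>. R \<alpha> \<noteq> 0 \<Longrightarrow> 6 \<le> weight \<alpha>"
    using N by (auto simp: normal_form_def)
  show "norm (psum R X) \<le> (\<Sum>\<^sub>\<infinity>\<alpha>. norm (R \<alpha>) * r ^ (\<Sum>i\<in>UNIV. \<alpha> $ i)) * \<theta> ^ 6"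
  proof (rule norm_psum_le[OF conv _ \<theta>, where w = w])
    show "norm (X $ i) \<le> \<theta> ^ w i * r" for i using X by (cases "i = 5") (auto simp: w_def)
    have "weight \<alpha> = (\<Sum>i\<in>UNIV. w i * \<alpha> $ i)" for \<alpha>
      by (simp add: weight_def w_def sum_5)
    then show "6 \<le> (\<Sum>i\<in>UNIV. w i * \<alpha> $ i)" if "R \<alpha> \<noteq> 0" for \<alpha>
      using wt[OF that] by simp
  qed
qed

text \<open>Here \<open>v\<close> is only of first order like the other variables. A monomial of weight at least 6 has degree at
least 3, so the graphing function is still of second order.\<close>

lemma normal_form_quadratic:
  assumes N: "normal_form c R r N"
  obtains C where "\<And>X \<theta>. (\<And>i. norm (X $ i) \<le> \<theta> * r) \<Longrightarrow>
      0 \<le> \<theta> \<Longrightarrow> \<theta> \<le> 1 \<Longrightarrow> norm (graph_fun c R X) \<le> C * \<theta>\<^sup>2"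
proof
  fix X :: "complex ^ 5" and \<theta>
  assume X: "\<And>i. norm (X $ i) \<le> \<theta> * r" and \<theta>: "0 \<le> \<theta>" "\<theta> \<le> 1"
  have conv: "abs_conv R r" and wt: "\<And>\<alpha>. R \<alpha> \<noteq> 0 \<Longrightarrow> 6 \<le> weight \<alpha>" and r: "r \<le> 1"
    using N by (auto simp: normal_form_def)
  define K where "K = (\<Sum>\<^sub>\<infinity>\<alpha>. norm (R \<alpha>) * r ^ (\<Sum>i\<in>UNIV. \<alpha> $ i))"
  have "norm (psum R X) \<le> K * \<theta>\<^sup>2"
    unfolding K_def
  proof (rule norm_psum_le[OF conv _ \<theta>, where w = "\<lambda>_. 1"])
    show "norm (X $ i) \<le> \<theta> ^ 1 * r" for i using X by simp
    show "2 \<le> (\<Sum>i\<in>UNIV. 1 * \<alpha> $ i)" if "R \<alpha> \<noteq> 0" for \<alpha>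
      using wt[OF that] by (simp add: weight_def sum_5)
  qed
  moreover have "norm (normal_poly c (X $ 1) (X $ 2) (X $ 3) (X $ 4)) \<le> (5 + 2 * norm c) * \<theta>\<^sup>2"
  proof (rule norm_normal_poly_le)
    have "\<theta> * r \<le> \<theta> * 1" using r \<theta> by (intro mult_left_mono) auto
    then have "norm (X $ i) \<le> \<theta>" for i using X[of i] by simp
    then show "norm (X $ 1) \<le> \<theta>" "norm (X $ 2) \<le> \<theta>" "norm (X $ 3) \<le> \<theta>" "norm (X $ 4) \<le> \<theta>" by auto
  qed (rule \<theta>)
  moreover have "norm (graph_fun c R X) \<le> norm (normal_poly c (X $ 1) (X $ 2) (X $ 3) (X $ 4)) + norm (psum R X)"
    unfolding graph_fun_def by (rule norm_triangle_ineq)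
  ultimately show "norm (graph_fun c R X) \<le> ((5 + 2 * norm c) + K) * \<theta>\<^sup>2"
    by (simp add: distrib_right)
qed

lemma bounded_hol_graph_fun:
  assumes N: "normal_form c R r N"
  obtains K where "bounded_hol (graph_fun c R) r K"
proof -
  have conv: "abs_conv R r" using N by (simp add: normal_form_def)
  have r: "0 < r" using conv by (simp add: abs_conv_def)
  obtain C where C: "\<And>X \<theta>. (\<And>i. norm (X $ i) \<le> \<theta> * r) \<Longrightarrow>
      0 \<le> \<theta> \<Longrightarrow> \<theta> \<le> 1 \<Longrightarrow> norm (graph_fun c R X) \<le> C * \<theta>\<^sup>2"
    using normal_form_quadratic[OF N] by blast
  have "curve_hol (graph_fun c R) r"
    unfolding curve_hol_def
  proof (intro allI impI)
    fix T and x :: "complex \<Rightarrow> complex ^ 5"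
    assume T: "open T" and hol: "\<forall>i. (\<lambda>t. x t $ i) holomorphic_on T"
      and b: "\<forall>t\<in>T. \<forall>i. norm (x t $ i) < r"
    have "(\<lambda>t. psum R (x t)) holomorphic_on T"
      by (rule curve_holD[OF curve_hol_psum[OF conv] T]) (use hol b in auto)
    then show "(\<lambda>t. graph_fun c R (x t)) holomorphic_on T"
      unfolding graph_fun_def normal_poly_def by (intro holomorphic_intros hol[rule_format])
  qed
  moreover have "norm (graph_fun c R X) \<le> C" if "\<forall>i. norm (X $ i) < r" for X
    using C[of X 1] that by (auto intro: less_imp_le)
  ultimately have "bounded_hol (graph_fun c R) r C" using r by (simp add: bounded_hol_def)
  then show ?thesis by (rule that)
qed

lemma graph_fun_has_derivative_0:
  assumes N: "normal_form c R r N"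
  shows "graph_fun c R 0 = 0" and "(graph_fun c R has_derivative (\<lambda>_. 0)) (at 0)"
proof -
  have r: "0 < r" using N by (simp add: normal_form_def abs_conv_def)
  obtain C where C: "\<And>X \<theta>. (\<And>i. norm (X $ i) \<le> \<theta> * r) \<Longrightarrow>
      0 \<le> \<theta> \<Longrightarrow> \<theta> \<le> 1 \<Longrightarrow> norm (graph_fun c R X) \<le> C * \<theta>\<^sup>2"
    using normal_form_quadratic[OF N] by blast
  show z: "graph_fun c R 0 = 0" using C[of 0 0] by simp
  show "(graph_fun c R has_derivative (\<lambda>_. 0)) (at 0)"
  proof (rule has_derivativeI_sandwich[OF r])
    fix X :: "complex ^ 5" assume X: "X \<noteq> 0" "dist X 0 < r"
    have "norm (X $ i) \<le> norm X" for i by (rule Finite_Cartesian_Product.norm_nth_le)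
    then have "norm (graph_fun c R X) \<le> C * (norm X / r)\<^sup>2"
      using X r by (intro C) auto
    then show "norm (graph_fun c R X - graph_fun c R 0 - 0) / norm (X - 0) \<le> C / r\<^sup>2 * norm X"
      using X by (simp add: z field_simps power2_eq_square)
  next
    show "((\<lambda>X::complex^5. C / r\<^sup>2 * norm X) \<longlongrightarrow> 0) (at 0)"
      by (rule tendsto_mult_right_zero[OF tendsto_norm_zero[OF tendsto_ident_at]])
  qed simp_all
qed

lemma normal_form_tangent:
  assumes N: "normal_form c R r N" and \<gamma>: "curve_in N 0 \<gamma>"
  shows "Re (velocity \<gamma> $ 3) = 0"
proof -
  have r: "0 < r" using N by (simp add: normal_form_def abs_conv_def)
  obtain e D where e: "e > 0" and \<gamma>0: "\<gamma> 0 = 0" and \<gamma>N: "\<gamma> ` {-e<..<e} \<subseteq> N"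
    and D: "\<And>t. t \<in> {-e<..<e} \<Longrightarrow> (\<gamma> has_vector_derivative D t) (at t)"
    using \<gamma> unfolding curve_in_def C1_differentiable_on_def by blast
  define V where "V = velocity \<gamma>"
  have d: "(\<gamma> has_derivative (\<lambda>h. h *\<^sub>R V)) (at 0)"
    using D[of 0] e vector_derivative_at[OF D[of 0]]
    by (simp add: has_vector_derivative_def V_def velocity_def)
  define P where "P = (\<lambda>q::complex^3. real_point (q $ 1) (q $ 2) (Im (q $ 3)))"
  have P0: "P 0 = 0" by (simp add: P_def real_point_def vec_eq_iff forall_5 vector_5)
  have comp: "((\<lambda>t. \<gamma> t $ i) has_derivative (\<lambda>h. (h *\<^sub>R V) $ i)) (at 0)" for i
    by (rule bounded_linear.has_derivative[OF bounded_linear_vec_nth d])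
  have "((\<lambda>t. P (\<gamma> t) $ j) has_derivative (\<lambda>h. P (h *\<^sub>R V) $ j)) (at 0)" for j
    using exhaust_5[of j] unfolding P_def real_point_def
    by (elim disjE; simp only: vector_5)
       (rule comp bounded_linear.has_derivative[OF bounded_linear_cnj]
          bounded_linear.has_derivative[OF bounded_linear_of_real]
          bounded_linear.has_derivative[OF bounded_linear_Im])+
  then have dP: "((\<lambda>t. P (\<gamma> t)) has_derivative (\<lambda>h. P (h *\<^sub>R V))) (at 0)"
    by (rule has_derivative_componentwise_vec)
  have "(graph_fun c R has_derivative (\<lambda>_. 0)) (at (P (\<gamma> 0)))"
    using graph_fun_has_derivative_0(2)[OF N] by (simp add: \<gamma>0 P0)
  from has_derivative_compose[OF dP this]
  have "((\<lambda>t. graph_fun c R (P (\<gamma> t))) has_derivative (\<lambda>h. 0)) (at 0)" .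
  from bounded_linear.has_derivative[OF bounded_linear_Re this]
  have F: "((\<lambda>t. Re (graph_fun c R (P (\<gamma> t)))) has_derivative (\<lambda>h. 0)) (at 0)" by simp
  have "continuous (at 0) \<gamma>" using d has_derivative_continuous by blast
  then have "\<forall>\<^sub>F t in nhds 0. dist (\<gamma> t) 0 < r"
    using tendstoD[OF _ r, of \<gamma> 0 "at 0"] r by (auto simp: isCont_def \<gamma>0 eventually_at_filter elim!: eventually_mono)
  moreover have "\<forall>\<^sub>F t in nhds 0. t \<in> {-e<..<e}" using e by (intro eventually_nhds_in_open) auto
  ultimately have "\<forall>\<^sub>F t in nhds 0. Re (graph_fun c R (P (\<gamma> t))) = Re (\<gamma> t $ 3)"
  proof eventually_elim
    case (elim t)
    have "norm (\<gamma> t $ i) < r" for i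
      using elim(1) Finite_Cartesian_Product.norm_nth_le[of "\<gamma> t" i] by simp
    moreover have "\<gamma> t \<in> N" using elim(2) \<gamma>N by blast
    ultimately show ?case using N unfolding normal_form_def P_def by metis
  qed
  then have "\<forall>\<^sub>F t in at 0. Re (graph_fun c R (P (\<gamma> t))) = Re (\<gamma> t $ 3)"
    by (simp add: eventually_at_filter eventually_mono)
  from has_derivative_transform_eventually[OF F this] \<gamma>0
  have "((\<lambda>t. Re (\<gamma> t $ 3)) has_derivative (\<lambda>h. 0)) (at 0)"
    by (simp add: P0 graph_fun_has_derivative_0(1)[OF N])
  from has_derivative_unique[OF this bounded_linear.has_derivative[OF bounded_linear_Re comp]]
  have "0 = Re ((1 *\<^sub>R V) $ 3)" by meson
  then show ?thesis by (simp add: V_def)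
qed

text \<open>The curve is the graph over a real line. It is \<open>C\<^sup>1\<close> because the complexified graphing function is
holomorphic along the complexified line.\<close>

lemma normal_form_curve:
  fixes a b :: complex and v :: real
  assumes N: "normal_form c R r N"
  obtains u :: "real \<Rightarrow> real" where
    "curve_in N 0 (\<lambda>t. vector [Complex (Re a * t) (Im a * t), Complex (Re b * t) (Im b * t), Complex (u t) (v * t)])"
    "velocity (\<lambda>t. vector [Complex (Re a * t) (Im a * t), Complex (Re b * t) (Im b * t), Complex (u t) (v * t)])
      = (vector [a, b, \<i> * of_real v] :: complex ^ 3)"
proof -
  obtain K where K: "bounded_hol (graph_fun c R) r K" using bounded_hol_graph_fun[OF N] by blast
  then have ch: "curve_hol (graph_fun c R) r" and r: "0 < r" by (auto simp: bounded_hol_def)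
  define x :: "complex \<Rightarrow> complex ^ 5" where
    "x = (\<lambda>s. vector [s * a, s * b, s * cnj a, s * cnj b, s * of_real v])"
  define G where "G = (\<lambda>s. graph_fun c R (x s))"
  define d where "d = r / (2 * (1 + norm a + norm b + \<bar>v\<bar>))"
  have B: "1 + norm a + norm b + \<bar>v\<bar> > 0" using norm_ge_zero[of a] norm_ge_zero[of b] by linarith
  have d: "d > 0" using r B by (simp add: d_def)
  have small: "norm s * m < r / 2" if "norm s < d" "0 \<le> m" "m \<le> 1 + norm a + norm b + \<bar>v\<bar>" for s :: complex and m
  proof -
    have "norm s * m \<le> norm s * (1 + norm a + norm b + \<bar>v\<bar>)" by (intro mult_left_mono that) auto
    also have "\<dots> < d * (1 + norm a + norm b + \<bar>v\<bar>)" using that(1) B by (rule mult_strict_right_mono)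
    also have "\<dots> = r / 2" using B by (simp add: d_def field_simps)
    finally show ?thesis .
  qed
  have sm: "norm s * norm a < r/2" "norm s * norm b < r/2" "norm s * \<bar>v\<bar> < r/2" if "norm s < d" for s :: complex
    by (intro small that; simp)+
  have xb: "norm (x s $ i) < r" if "norm s < d" for s i
    using exhaust_5[of i] sm[OF that] r by (elim disjE) (auto simp: x_def vector_5 norm_mult)
  have hol: "G holomorphic_on ball 0 d"
    unfolding G_def
  proof (rule curve_holD[OF ch])
    show "(\<lambda>t. x t $ i) holomorphic_on ball 0 d" for i
      using exhaust_5[of i] unfolding x_def
      by (elim disjE; simp only: vector_5) (intro holomorphic_intros)+
  qed (use xb in auto)
  have "continuous_on (ball 0 d) G" by (rule holomorphic_on_imp_continuous_on[OF hol])
  then have "isCont G 0" using d by (simp add: continuous_on_eq_continuous_at)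
  moreover have "x 0 = 0" by (simp add: x_def vec_eq_iff forall_5 vector_5)
  then have G0: "G 0 = 0" by (simp add: G_def graph_fun_has_derivative_0(1)[OF N])
  ultimately obtain d1 where d1: "d1 > 0" "\<And>s. norm s < d1 \<Longrightarrow> norm (G s) < r / 2"
    using r unfolding continuous_at_eps_delta dist_norm by (metis diff_zero half_gt_zero)
  define e where "e = min d d1"
  have e: "e > 0" "e \<le> d" "e \<le> d1" using d d1 by (auto simp: e_def)
  define u where "u = (\<lambda>t::real. Re (G (of_real t)))"
  define \<gamma> :: "real \<Rightarrow> complex ^ 3" where
    "\<gamma> = (\<lambda>t. vector [Complex (Re a * t) (Im a * t), Complex (Re b * t) (Im b * t), Complex (u t) (v * t)])"
  define D :: "real \<Rightarrow> complex ^ 3" where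
    "D = (\<lambda>t. vector [a, b, of_real (Re (deriv G (of_real t))) + \<i> * of_real v])"
  have g1: "\<gamma> t $ 1 = of_real t * a" and g2: "\<gamma> t $ 2 = of_real t * b" for t
    by (auto simp: \<gamma>_def complex_eq_iff)
  have g3: "\<gamma> t $ 3 = of_real (u t) + of_real t * (\<i> * of_real v)" for t
    by (simp add: \<gamma>_def complex_eq_iff)
  have dG: "(G has_field_derivative deriv G (of_real t)) (at (of_real t))" if "t \<in> {-e<..<e}" for t
    using that e by (intro holomorphic_derivI[OF hol]) auto
  have du: "((\<lambda>t. complex_of_real (u t)) has_vector_derivative of_real (Re (deriv G (of_real t)))) (at t)"
    if "t \<in> {-e<..<e}" for t
    unfolding u_def
    by (intro bounded_linear.has_vector_derivative[OF bounded_linear_of_real]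
        bounded_linear.has_vector_derivative[OF bounded_linear_Re] has_vector_derivative_real_field dG that)
  have dl: "((\<lambda>t. complex_of_real t * z) has_vector_derivative z) (at t)" for z t
    by (auto intro!: derivative_eq_intros)
  have dD: "(\<gamma> has_vector_derivative D t) (at t)" if t: "t \<in> {-e<..<e}" for t
  proof -
    have "((\<lambda>t. \<gamma> t $ 1) has_vector_derivative D t $ 1) (at t)"
      using dl[of a t] by (simp add: g1 D_def)
    moreover have "((\<lambda>t. \<gamma> t $ 2) has_vector_derivative D t $ 2) (at t)"
      using dl[of b t] by (simp add: g2 D_def)
    moreover have "((\<lambda>t. \<gamma> t $ 3) has_vector_derivative D t $ 3) (at t)"
      using has_vector_derivative_add[OF du[OF t] dl[of "\<i> * of_real v" t]] by (simp add: g3 D_def)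
    ultimately have "\<forall>j. ((\<lambda>t. \<gamma> t $ j) has_vector_derivative D t $ j) (at t)"
      unfolding forall_3 by blast
    then have "((\<lambda>t. \<gamma> t $ j) has_derivative (\<lambda>h. (h *\<^sub>R D t) $ j)) (at t)" for j
      by (simp add: has_vector_derivative_def)
    then show ?thesis
      unfolding has_vector_derivative_def by (rule has_derivative_componentwise_vec)
  qed
  have "continuous_on (ball 0 d) (deriv G)"
    by (intro holomorphic_on_imp_continuous_on holomorphic_deriv hol) auto
  then have cG: "continuous_on {-e<..<e} (\<lambda>t. deriv G (of_real t))"
    by (rule continuous_on_compose2) (use e in \<open>auto intro!: continuous_intros\<close>)
  have "continuous_on {-e<..<e} (\<lambda>t. D t $ 1)" "continuous_on {-e<..<e} (\<lambda>t. D t $ 2)"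
    "continuous_on {-e<..<e} (\<lambda>t. D t $ 3)"
    by (auto simp: D_def intro!: continuous_intros cG)
  then have "\<forall>j. continuous_on {-e<..<e} (\<lambda>t. D t $ j)" unfolding forall_3 by blast
  then have "continuous_on {-e<..<e} (\<lambda>t. \<chi> j. D t $ j)" by (intro continuous_on_vec_lambda) auto
  then have "\<gamma> C1_differentiable_on {-e<..<e}"
    unfolding C1_differentiable_on_def using dD by (intro exI[of _ D]) auto
  moreover have "\<gamma> 0 = 0" by (simp add: vec_eq_iff forall_3 g1 g2 g3 u_def G0)
  moreover have "\<gamma> t \<in> N" if t: "t \<in> {-e<..<e}" for t
  proof -
    have nt: "norm (complex_of_real t) < d" "norm (complex_of_real t) < d1" using t e by auto
    have "norm (of_real (u t) + of_real t * (\<i> * of_real v)) \<le> norm (complex_of_real (u t)) + norm (of_real t * (\<i> * complex_of_real v))"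
      by (rule norm_triangle_ineq)
    also have "\<dots> < r / 2 + r / 2"
    proof (rule add_strict_mono)
      show "norm (complex_of_real (u t)) < r / 2"
        using d1(2)[OF nt(2)] abs_Re_le_cmod[of "G (of_real t)"] by (simp add: u_def)
      show "norm (of_real t * (\<i> * complex_of_real v)) < r / 2"
        using sm(3)[OF nt(1)] by (simp add: norm_mult)
    qed
    finally have n3: "norm (\<gamma> t $ 3) < r" by (simp add: g3)
    have "norm (\<gamma> t $ 1) < r" "norm (\<gamma> t $ 2) < r"
      using sm[OF nt(1)] r by (auto simp: g1 g2 norm_mult)
    with n3 have "\<forall>i. norm (\<gamma> t $ i) < r" unfolding forall_3 by blast
    moreover have "real_point (\<gamma> t $ 1) (\<gamma> t $ 2) (Im (\<gamma> t $ 3)) = x (of_real t)"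
      by (simp add: real_point_def x_def vec_eq_iff forall_5 vector_5 g1 g2 g3)
    moreover have "Re (\<gamma> t $ 3) = Re (G (of_real t))" by (simp add: g3 u_def)
    ultimately show ?thesis using N unfolding normal_form_def G_def by metis
  qed
  ultimately have cin: "curve_in N 0 \<gamma>"
    unfolding curve_in_def using e(1) by blast
  have vel: "velocity \<gamma> = D 0"
    unfolding velocity_def using dD[of 0] e by (intro vector_derivative_at) auto
  \<comment> \<open>The derivative of \<open>u\<close> at 0 vanishes because the curve lies in \<open>N\<close>.\<close>
  have "Re (D 0 $ 3) = 0" using normal_form_tangent[OF N cin] vel by simp
  then have "D 0 = vector [a, b, \<i> * of_real v]" by (simp add: D_def vec_eq_iff forall_3)
  with vel have "velocity \<gamma> = vector [a, b, \<i> * of_real v]" by simp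
  from that[OF cin[unfolded \<gamma>_def] this[unfolded \<gamma>_def]] show ?thesis .
qed

lemma tangent_space_normal_form:
  assumes N: "normal_form c R r N"
  shows "X \<in> tangent_space N 0 \<longleftrightarrow> Re (X $ 3) = 0"
proof
  assume "Re (X $ 3) = 0"
  then have "vector [X $ 1, X $ 2, \<i> * of_real (Im (X $ 3))] = X"
    by (simp add: vec_eq_iff forall_3 complex_eq_iff)
  moreover have "\<exists>\<gamma>. curve_in N 0 \<gamma> \<and> velocity \<gamma> = vector [X $ 1, X $ 2, \<i> * of_real (Im (X $ 3))]"
    by (rule normal_form_curve[OF N, of "X $ 1" "X $ 2" "Im (X $ 3)"]) blast
  ultimately have "\<exists>\<gamma>. curve_in N 0 \<gamma> \<and> velocity \<gamma> = X" by simp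
  then show "X \<in> tangent_space N 0" by (auto simp: tangent_space_def)
qed (use normal_form_tangent[OF N] in \<open>auto simp: tangent_space_def\<close>)

lemma normal_form_transversal:
  assumes N: "normal_form c R r N"
  shows "\<gamma> \<in> transversal_curves N 0 \<longleftrightarrow> curve_in N 0 \<gamma> \<and> velocity \<gamma> $ 3 \<noteq> 0"
proof -
  have "X \<in> complex_tangent_space N 0 \<longleftrightarrow> X $ 3 = 0" for X
    by (auto simp: complex_tangent_space_def tangent_space_normal_form[OF N] complex_eq_iff)
  then show ?thesis by (simp add: transversal_curves_def)
qed

text \<open>For a representative parametrized by \<open>v\<close> the velocity is \<open>(x\<^sub>1 + i y\<^sub>1, s\<^sub>1 + i t\<^sub>1, i)\<close>, and the equations
\<open>s\<^sub>1 = - 2 x\<^sub>1 y\<^sub>1\<close>, \<open>t\<^sub>1 = x\<^sub>1\<^sup>2 - y\<^sub>1\<^sup>2\<close> together say \<open>s\<^sub>1 + i t\<^sub>1 = i (x\<^sub>1 + i y\<^sub>1)\<^sup>2\<close>. This is homogenized to a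
condition on the line spanned by the velocity.\<close>

lemma prolongation_in_Sigma_zero_iff:
  assumes \<phi>: "local_biholomorphism \<phi> M p N 0" and N: "normal_form c R r N"
    and \<gamma>: "\<gamma> \<in> transversal_curves M p"
  defines "V \<equiv> jac \<phi> p *v velocity \<gamma>"
  shows "prolongation \<phi> N 0 (same_jet M p `` {\<gamma>}) \<in> Sigma_zero N \<longleftrightarrow> (V $ 1)\<^sup>2 + V $ 2 * V $ 3 = 0"
proof -
  define J where "J = same_jet N 0 `` {\<phi> \<circ> \<gamma>}"
  have tr: "\<phi> \<circ> \<gamma> \<in> transversal_curves N 0" by (rule transversal_curves_push[OF \<phi> \<gamma>])
  have vel: "velocity (\<phi> \<circ> \<gamma>) = V"
    unfolding V_def using \<gamma> by (intro curve_in_compose(2)[OF \<phi>]) (simp add: transversal_curves_def)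
  have JS: "J \<in> jet_space N 0" unfolding J_def jet_space_def using tr by (rule quotientI)
  have V3: "V $ 3 \<noteq> 0" using tr normal_form_transversal[OF N] vel by auto
  have ReV: "Re (V $ 3) = 0"
    using normal_form_tangent[OF N, of "\<phi> \<circ> \<gamma>"] tr vel by (auto simp: transversal_curves_def)
  have "J \<in> Sigma_zero N \<longleftrightarrow> (V $ 1)\<^sup>2 + V $ 2 * V $ 3 = 0"
  proof
    assume "J \<in> Sigma_zero N"
    then obtain x y s t u :: "real \<Rightarrow> real" where
      m: "(\<lambda>v. vector [Complex (x v) (y v), Complex (s v) (t v), Complex (u v) v]) \<in> J"
      and eq: "deriv s 0 = - 2 * deriv x 0 * deriv y 0" "deriv t 0 = (deriv x 0)\<^sup>2 - (deriv y 0)\<^sup>2"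
      unfolding Sigma_zero_def by (auto simp: Let_def)
    define \<delta> :: "real \<Rightarrow> complex ^ 3" where
      "\<delta> = (\<lambda>v. vector [Complex (x v) (y v), Complex (s v) (t v), Complex (u v) v])"
    obtain l where l: "l \<noteq> 0" "velocity \<delta> = l *\<^sub>R V" and \<delta>: "\<delta> \<in> transversal_curves N 0"
      using m vel unfolding J_def same_jet_def \<delta>_def[symmetric] by auto
    have \<delta>c: "curve_in N 0 \<delta>" using \<delta> by (simp add: transversal_curves_def)
    then obtain e D where e: "e > 0"
      and D: "\<And>t. t \<in> {-e<..<e} \<Longrightarrow> (\<delta> has_vector_derivative D t) (at t)"
      unfolding curve_in_def C1_differentiable_on_def by blast
    have "(\<delta> has_vector_derivative velocity \<delta>) (at 0)"
      using D[of 0] e vector_derivative_at[OF D[of 0]] by (simp add: velocity_def)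
    then have c: "((\<lambda>v. \<delta> v $ i) has_vector_derivative velocity \<delta> $ i) (at 0)" for i
      by (rule bounded_linear.has_vector_derivative[OF bounded_linear_vec_nth])
    have re: "((\<lambda>v. Re (\<delta> v $ i)) has_field_derivative Re (velocity \<delta> $ i)) (at 0)"
      and im: "((\<lambda>v. Im (\<delta> v $ i)) has_field_derivative Im (velocity \<delta> $ i)) (at 0)" for i
      using bounded_linear.has_vector_derivative[OF bounded_linear_Re c]
        bounded_linear.has_vector_derivative[OF bounded_linear_Im c]
      by (auto simp: has_real_derivative_iff_has_vector_derivative)
    have "deriv x 0 = Re (velocity \<delta> $ 1)" "deriv y 0 = Im (velocity \<delta> $ 1)"
      "deriv s 0 = Re (velocity \<delta> $ 2)" "deriv t 0 = Im (velocity \<delta> $ 2)"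
      using re[of 1] im[of 1] re[of 2] im[of 2] by (auto simp: \<delta>_def intro: DERIV_imp_deriv)
    moreover have "Im (velocity \<delta> $ 3) = 1"
      using im[of 3] DERIV_unique[OF _ DERIV_ident] by (simp add: \<delta>_def)
    moreover have "Re (velocity \<delta> $ 3) = 0" by (rule normal_form_tangent[OF N \<delta>c])
    ultimately have "(velocity \<delta> $ 1)\<^sup>2 + velocity \<delta> $ 2 * velocity \<delta> $ 3 = 0"
      using eq by (simp add: complex_eq_iff power2_eq_square algebra_simps)
    then have "of_real (l\<^sup>2) * ((V $ 1)\<^sup>2 + V $ 2 * V $ 3) = 0"
      unfolding l vector_scaleR_component by (simp add: scaleR_conv_of_real power2_eq_square algebra_simps)
    then show "(V $ 1)\<^sup>2 + V $ 2 * V $ 3 = 0" using l by simp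
  next
    assume conic: "(V $ 1)\<^sup>2 + V $ 2 * V $ 3 = 0"
    define m where "m = Im (V $ 3)"
    have m: "m \<noteq> 0" "V $ 3 = \<i> * of_real m" using V3 ReV by (auto simp: m_def complex_eq_iff)
    define a b where "a = V $ 1 / of_real m" and "b = V $ 2 / of_real m"
    obtain u where u: "curve_in N 0 (\<lambda>t. vector [Complex (Re a * t) (Im a * t), Complex (Re b * t) (Im b * t), Complex (u t) (1 * t)])"
      "velocity (\<lambda>t. vector [Complex (Re a * t) (Im a * t), Complex (Re b * t) (Im b * t), Complex (u t) (1 * t)])
        = (vector [a, b, \<i> * of_real 1] :: complex ^ 3)"
      by (rule normal_form_curve[OF N])
    define \<delta> :: "real \<Rightarrow> complex ^ 3" where
      "\<delta> = (\<lambda>t. vector [Complex (Re a * t) (Im a * t), Complex (Re b * t) (Im b * t), Complex (u t) t])"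
    have \<delta>: "curve_in N 0 \<delta>" "velocity \<delta> = vector [a, b, \<i>]" using u by (simp_all add: \<delta>_def)
    have "\<delta> \<in> transversal_curves N 0" using normal_form_transversal[OF N] \<delta> by simp
    moreover have "velocity \<delta> = inverse m *\<^sub>R V"
      using m by (simp add: \<delta> vec_eq_iff forall_3 a_def b_def) (simp add: scaleR_conv_of_real field_simps)
    ultimately have "\<delta> \<in> J"
      unfolding J_def same_jet_def using tr vel m(1) by (auto intro!: exI[of _ "inverse m"])
    moreover have "deriv (\<lambda>t. k * t) 0 = k" for k :: real
      by (rule DERIV_imp_deriv) (auto intro!: derivative_eq_intros)
    moreover have "a\<^sup>2 + b * \<i> = 0"
      using conic m by (simp add: a_def b_def field_simps power2_eq_square)
    then have "Re b = - 2 * Re a * Im a" "Im b = (Re a)\<^sup>2 - (Im a)\<^sup>2"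
      by (auto simp: complex_eq_iff power2_eq_square algebra_simps)
    ultimately show "J \<in> Sigma_zero N"
      unfolding Sigma_zero_def \<delta>_def using JS
      by (intro CollectI conjI exI[of _ "\<lambda>t. Re a * t"] exI[of _ "\<lambda>t. Im a * t"]
          exI[of _ "\<lambda>t. Re b * t"] exI[of _ "\<lambda>t. Im b * t"] exI[of _ u]) (simp_all add: Let_def)
  qed
  then show ?thesis using prolongation_class[OF \<phi> \<gamma>] by (simp add: J_def)
qed

section \<open>Germs of holomorphic functions vanishing at 0\<close>

text \<open>Germs at 0 that vanish at 0 are closed under the algebraic operations and under composition, which
spares the bookkeeping of radii.\<close>

definition hgerm :: "(complex ^ 'n \<Rightarrow> complex) \<Rightarrow> bool" where
  "hgerm f \<longleftrightarrow> f 0 = 0 \<and> (\<exists>r K. bounded_hol f r K)"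

lemma curve_hol_mono: "curve_hol f r \<Longrightarrow> r' \<le> r \<Longrightarrow> curve_hol f r'"
  unfolding curve_hol_def by (meson less_le_trans)

lemma hgerm_linear_bound:
  assumes "hgerm f"
  obtains r C where "0 < r" "0 \<le> C" "curve_hol f r"
    "\<And>y m. (\<And>i. norm (y $ i) \<le> m) \<Longrightarrow> m \<le> r \<Longrightarrow> norm (f y) \<le> C * m"
proof -
  obtain r K where f: "f 0 = 0" "bounded_hol f r K" using assms by (auto simp: hgerm_def)
  then have r: "0 < r" and ch: "curve_hol f r" by (auto simp: bounded_hol_def)
  have K: "norm (f 0) \<le> K" using f(2) r unfolding bounded_hol_def by (metis norm_zero zero_index)
  have "norm (f y) \<le> 8 * K / r * m" if "\<And>i. norm (y $ i) \<le> m" "m \<le> r/8" for y m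
    using bounded_hol_lipschitz[OF f(2), of 0 y m] that r f(1) by simp
  moreover have "0 \<le> 8 * K / r" using order_trans[OF norm_ge_zero K] r by simp
  ultimately show ?thesis
    using that[of "r/8" "8 * K / r"] r curve_hol_mono[OF ch, of "r/8"] by auto
qed

lemma hgerm_small:
  assumes "hgerm f" "0 < \<eta>"
  obtains r where "0 < r" "curve_hol f r" "\<And>y. (\<And>i. norm (y $ i) < r) \<Longrightarrow> norm (f y) < \<eta>"
proof -
  obtain r C where r: "0 < r" and C: "0 \<le> C" and ch: "curve_hol f r"
    and b: "\<And>y m. (\<And>i. norm (y $ i) \<le> m) \<Longrightarrow> m \<le> r \<Longrightarrow> norm (f y) \<le> C * m"
    using hgerm_linear_bound[OF assms(1)] by metis
  define s where "s = min r (\<eta> / (2 * (C + 1)))"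
  have s: "0 < s" "s \<le> r" "s \<le> \<eta> / (2 * (C + 1))" using r C assms(2) by (auto simp: s_def)
  have "C * s \<le> (C + 1) * (\<eta> / (2 * (C + 1)))" using s C by (intro mult_mono) auto
  also have "\<dots> = \<eta> / 2" using C by (simp add: field_simps)
  also have "\<dots> < \<eta>" using assms(2) by simp
  finally have "C * s < \<eta>" .
  then have "norm (f y) < \<eta>" if "\<And>i. norm (y $ i) < s" for y
    using b[of y s] s(2) that by (meson less_imp_le le_less_trans)
  with s curve_hol_mono[OF ch s(2)] show ?thesis using that by blast
qed

lemma hgermI:
  assumes "f 0 = 0" "0 < r" "curve_hol f r" "\<And>y. (\<And>i. norm (y $ i) < r) \<Longrightarrow> norm (f y) < K"
  shows "hgerm f"
  using assms unfolding hgerm_def bounded_hol_def by (metis less_imp_le)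

lemma finite_radius:
  fixes P :: "'m::finite \<Rightarrow> real \<Rightarrow> bool"
  assumes "\<And>j. \<exists>r>0. P j r" and "\<And>j r r'. P j r \<Longrightarrow> 0 < r' \<Longrightarrow> r' \<le> r \<Longrightarrow> P j r'"
  obtains r where "0 < r" "\<And>j. P j r"
proof -
  obtain \<rho> where \<rho>: "\<And>j. 0 < \<rho> j" "\<And>j. P j (\<rho> j)" using assms(1) by metis
  have "0 < Min (range \<rho>)" using \<rho> by (subst Min_gr_iff) auto
  moreover have "P j (Min (range \<rho>))" for j using \<rho>(2) calculation by (rule assms(2)) simp
  ultimately show ?thesis using that by blast
qed

lemma hgerm_compose:
  fixes f :: "complex ^ 'm \<Rightarrow> complex" and G :: "complex ^ 'n \<Rightarrow> complex ^ 'm"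
  assumes f: "hgerm f" and G: "\<And>j. hgerm (\<lambda>y. G y $ j)"
  shows "hgerm (\<lambda>y. f (G y))"
proof -
  obtain r where r: "0 < r" "curve_hol f r" "\<And>y. (\<And>i. norm (y $ i) < r) \<Longrightarrow> norm (f y) < 1"
    using hgerm_small[OF f, of 1] by auto
  define P where "P = (\<lambda>j s. curve_hol (\<lambda>y. G y $ j) s \<and> (\<forall>y. (\<forall>i. norm (y $ i) < s) \<longrightarrow> norm (G y $ j) < r))"
  obtain s where s: "0 < s" "\<And>j. P j s"
  proof (rule finite_radius[of P])
    show "\<exists>s>0. P j s" for j
      using hgerm_small[OF G[of j] r(1)] unfolding P_def by metis
    show "P j s'" if "P j s" "0 < s'" "s' \<le> s" for j s s'
      using that curve_hol_mono unfolding P_def by (meson less_le_trans)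
  qed blast
  have Gs: "norm (G y $ j) < r" if "\<And>i. norm (y $ i) < s" for y j using s(2) that unfolding P_def by blast
  show ?thesis
  proof (rule hgermI[OF _ s(1)])
    have "G 0 = 0" using G by (simp add: vec_eq_iff hgerm_def)
    then show "f (G 0) = 0" using f by (simp add: hgerm_def)
    show "curve_hol (\<lambda>y. f (G y)) s"
      unfolding curve_hol_def
    proof (intro allI impI)
      fix T and x :: "complex \<Rightarrow> complex ^ 'n"
      assume T: "open T" "\<forall>i. (\<lambda>t. x t $ i) holomorphic_on T" "\<forall>t\<in>T. \<forall>i. norm (x t $ i) < s"
      show "(\<lambda>t. f (G (x t))) holomorphic_on T"
      proof (rule curve_holD[OF r(2) T(1)])
        show "(\<lambda>t. G (x t) $ j) holomorphic_on T" for j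
          using s(2)[of j] T unfolding P_def curve_hol_def by blast
      qed (use T(3) Gs in blast)
    qed
    show "norm (f (G y)) < 1" if "\<And>i. norm (y $ i) < s" for y using r(3) Gs that by blast
  qed
qed

lemma hgerm_nth: "hgerm (\<lambda>y. y $ i)"
  by (rule hgermI[of _ 1 1]) (auto simp: curve_hol_def)

lemma hgerm_0: "hgerm (\<lambda>y. 0)"
  by (rule hgermI[of _ 1 1]) (auto simp: curve_hol_def)

text \<open>A binary operation on germs is the composition with a germ in two variables.\<close>

lemma hgerm_binary:
  fixes f g :: "complex ^ 'n \<Rightarrow> complex" and op :: "complex \<Rightarrow> complex \<Rightarrow> complex"
  assumes "hgerm f" "hgerm g" and z: "op 0 0 = 0"
    and hol: "\<And>T u v. u holomorphic_on T \<Longrightarrow> v holomorphic_on T \<Longrightarrow> (\<lambda>t. op (u t) (v t)) holomorphic_on T"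
    and b: "\<And>a b. norm a < 1 \<Longrightarrow> norm b < 1 \<Longrightarrow> norm (op a b) < K"
  shows "hgerm (\<lambda>y. op (f y) (g y))"
proof -
  have "hgerm (\<lambda>y::complex^2. op (y $ 1) (y $ 2))"
    by (rule hgermI[of _ 1 K]) (auto simp: z curve_hol_def intro!: hol b)
  moreover have "\<forall>j. hgerm (\<lambda>y. (vector [f y, g y] :: complex ^ 2) $ j)"
    unfolding forall_2 using assms(1,2) by simp
  ultimately have "hgerm (\<lambda>y. op ((vector [f y, g y] :: complex ^ 2) $ 1) ((vector [f y, g y] :: complex ^ 2) $ 2))"
    using hgerm_compose[of "\<lambda>y::complex^2. op (y $ 1) (y $ 2)" "\<lambda>y. vector [f y, g y]"] by blast
  then show ?thesis by simp
qed

lemma hgerm_add: "hgerm f \<Longrightarrow> hgerm g \<Longrightarrow> hgerm (\<lambda>y. f y + g y)"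
  by (rule hgerm_binary[where op = "(+)" and K = 2])
     (auto intro!: holomorphic_intros intro: le_less_trans[OF norm_triangle_ineq])

lemma hgerm_mult: "hgerm f \<Longrightarrow> hgerm g \<Longrightarrow> hgerm (\<lambda>y. f y * g y)"
proof (rule hgerm_binary[where op = "(*)" and K = 1])
  show "norm (a * b) < 1" if "norm a < 1" "norm b < 1" for a b :: complex
    using mult_strict_mono'[OF that] by (simp add: norm_mult)
qed (auto intro!: holomorphic_intros)

lemma hgerm_cmult: "hgerm f \<Longrightarrow> hgerm (\<lambda>y. a * f y)"
proof (rule hgerm_binary[where op = "\<lambda>x _. a * x" and K = "norm a + 1" and g = f])
  show "norm (a * x) < norm a + 1" if "norm x < 1" for x
    using mult_left_mono[of "norm x" 1 "norm a"] that by (simp add: norm_mult)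
qed (auto intro!: holomorphic_intros)

lemma hgerm_diff: "hgerm f \<Longrightarrow> hgerm g \<Longrightarrow> hgerm (\<lambda>y. f y - g y)"
  using hgerm_add[of f "\<lambda>y. -1 * g y"] hgerm_cmult[of g "-1"] by simp

lemma hgerm_vector_3:
  assumes "hgerm f" "hgerm a" "hgerm b" "hgerm c"
  shows "hgerm (\<lambda>y. f (vector [a y, b y, c y] :: complex ^ 3))"
proof (rule hgerm_compose[OF assms(1)])
  show "hgerm (\<lambda>y. (vector [a y, b y, c y] :: complex ^ 3) $ j)" for j
    using exhaust_3[of j] assms by (elim disjE) simp_all
qed

lemma hgerm_vector_5:
  assumes "hgerm f" "hgerm a" "hgerm b" "hgerm c" "hgerm d" "hgerm e"
  shows "hgerm (\<lambda>y. f (vector [a y, b y, c y, d y, e y] :: complex ^ 5))"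
proof (rule hgerm_compose[OF assms(1)])
  show "hgerm (\<lambda>y. (vector [a y, b y, c y, d y, e y] :: complex ^ 5) $ j)" for j
    using exhaust_5[of j] assms by (elim disjE) (simp_all add: vector_5)
qed

lemma hgerm_cnj:
  fixes f :: "complex ^ 'n \<Rightarrow> complex"
  assumes "hgerm f"
  shows "hgerm (\<lambda>y. cnj (f (conj_vec y)))"
proof -
  obtain r where r: "0 < r" "curve_hol f r" "\<And>y. (\<And>i. norm (y $ i) < r) \<Longrightarrow> norm (f y) < 1"
    using hgerm_small[OF assms, of 1] by auto
  show ?thesis
  proof (rule hgermI[OF _ r(1)])
    have "conj_vec (0 :: complex ^ 'n) = 0" by (simp add: conj_vec_def vec_eq_iff)
    then show "cnj (f (conj_vec 0)) = 0" using assms by (simp add: hgerm_def)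
    show "norm (cnj (f (conj_vec y))) < 1" if "\<And>i. norm (y $ i) < r" for y
      using r(3)[of "conj_vec y"] that by (simp add: conj_vec_def)
    show "curve_hol (\<lambda>y. cnj (f (conj_vec y))) r"
      unfolding curve_hol_def
    proof (intro allI impI)
      fix T and x :: "complex \<Rightarrow> complex ^ 'n"
      assume T: "open T" and hol: "\<forall>i. (\<lambda>t. x t $ i) holomorphic_on T" and b: "\<forall>t\<in>T. \<forall>i. norm (x t $ i) < r"
      have "cnj ` T = cnj -` T" by (force simp: image_iff)
      then have T': "open (cnj ` T)" using open_vimage[OF T, of cnj] by (simp add: continuous_on_cnj)
      have "(\<lambda>s. f (conj_vec (x (cnj s)))) holomorphic_on cnj ` T"
      proof (rule curve_holD[OF r(2) T'])
        show "(\<lambda>s. conj_vec (x (cnj s)) $ i) holomorphic_on cnj ` T" for i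
          using holomorphic_on_compose_cnj_cnj[of "\<lambda>t. x t $ i" "cnj ` T"] hol T'
          by (simp add: conj_vec_def o_def image_image)
      qed (use b in \<open>auto simp: conj_vec_def\<close>)
      then show "(\<lambda>t. cnj (f (conj_vec (x t)))) holomorphic_on T"
        using holomorphic_on_compose_cnj_cnj[of "\<lambda>s. f (conj_vec (x (cnj s)))" T] T
        by (simp add: o_def)
    qed
  qed
qed

lemma holomorphic_near_hgerm:
  assumes "holomorphic_near f a"
  shows "hgerm (\<lambda>y. f (a + y) - f a)"
proof -
  obtain c r where c: "abs_conv c r" and f: "\<And>y. (\<And>i. norm (y $ i) \<le> r) \<Longrightarrow> f (a + y) = psum c y"
    using holomorphic_near_psum[OF assms] by blast
  have r: "0 < r" using c by (simp add: abs_conv_def)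
  obtain K where K: "bounded_hol (psum c) r K" using bounded_hol_psum[OF c] by blast
  show ?thesis
  proof (rule hgermI[OF _ r])
    show "curve_hol (\<lambda>y. f (a + y) - f a) r"
      unfolding curve_hol_def
    proof (intro allI impI)
      fix T and x :: "complex \<Rightarrow> complex ^ 'a"
      assume T: "open T" "\<forall>i. (\<lambda>t. x t $ i) holomorphic_on T" "\<forall>t\<in>T. \<forall>i. norm (x t $ i) < r"
      have "(\<lambda>t. psum c (x t) - f a) holomorphic_on T"
        using curve_holD[OF curve_hol_psum[OF c] T(1)] T(2,3) by (intro holomorphic_intros) auto
      then show "(\<lambda>t. f (a + x t) - f a) holomorphic_on T"
        by (rule holomorphic_transform) (use T(3) f in \<open>force intro: less_imp_le\<close>)
    qed
    show "norm (f (a + y) - f a) < K + norm (f a) + 1" if y: "\<And>i. norm (y $ i) < r" for y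
    proof -
      have "f (a + y) = psum c y" using f[of y] y by (meson less_imp_le)
      moreover have "norm (psum c y) \<le> K" using K y by (auto simp: bounded_hol_def)
      ultimately show ?thesis using norm_triangle_ineq4[of "f (a + y)" "f a"] by simp
    qed
  qed simp
qed

lemma hgerm_graph_fun:
  assumes N: "normal_form c R r N"
  shows "hgerm (graph_fun c R)"
  using bounded_hol_graph_fun[OF N] graph_fun_has_derivative_0(1)[OF N] unfolding hgerm_def by metis

lemma vanish_real_axis:
  assumes "g holomorphic_on ball 0 r" "\<And>t::real. \<bar>t\<bar> < r \<Longrightarrow> g (of_real t) = 0" "s \<in> ball 0 r"
  shows "g s = 0"
proof (rule analytic_continuation[OF assms(1), of "of_real ` {-r<..<r}" 0])
  have r: "0 < r" using assms(3) by (metis ball_eq_empty empty_iff not_le)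
  show "(0::complex) \<in> ball 0 r" using r by simp
  show "(0::complex) islimpt of_real ` {-r<..<r}"
    unfolding islimpt_approachable
  proof (intro allI impI)
    fix e :: real assume "e > 0"
    then show "\<exists>x'\<in>of_real ` {-r<..<r}. x' \<noteq> 0 \<and> dist x' (0::complex) < e"
      using r by (intro bexI[of _ "of_real (min (r/2) (e/2))"]) auto
  qed
qed (use assms in auto)

text \<open>The real coordinates are made complex one after the other by the identity theorem in one variable.\<close>

lemma vanish_real_vectors:
  fixes g :: "complex ^ 'n \<Rightarrow> complex"
  assumes g: "curve_hol g r"
    and real: "\<And>x. (\<And>i. x $ i \<in> \<real> \<and> norm (x $ i) < r) \<Longrightarrow> g x = 0"
    and x: "\<And>i. norm (x $ i) < r"
  shows "g x = 0"
proof -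
  have "\<forall>x. (\<forall>i. norm (x $ i) < r) \<and> (\<forall>i. i \<notin> S \<longrightarrow> x $ i \<in> \<real>) \<longrightarrow> g x = 0" if "finite S" for S
    using that
  proof induction
    case empty
    then show ?case using real by simp
  next
    case (insert j S)
    show ?case
    proof (intro allI impI)
      fix x :: "complex ^ 'n" assume x: "(\<forall>i. norm (x $ i) < r) \<and> (\<forall>i. i \<notin> insert j S \<longrightarrow> x $ i \<in> \<real>)"
      define l where "l = (\<lambda>t. \<chi> i. if i = j then t else x $ i)"
      have "(\<lambda>t. g (l t)) holomorphic_on ball 0 r"
      proof (rule curve_holD[OF g])
        show "(\<lambda>t. l t $ i) holomorphic_on ball 0 r" for i
          by (cases "i = j") (auto simp: l_def intro!: holomorphic_intros)
      qed (use x in \<open>auto simp: l_def\<close>)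
      moreover have "g (l (of_real t)) = 0" if "\<bar>t\<bar> < r" for t
        using insert.IH x that by (auto simp: l_def)
      moreover have "x $ j \<in> ball 0 r" using x by simp
      ultimately have "g (l (x $ j)) = 0" by (rule vanish_real_axis)
      moreover have "l (x $ j) = x" by (simp add: l_def vec_eq_iff)
      ultimately show "g x = 0" by simp
    qed
  qed
  from this[of UNIV] x show ?thesis by simp
qed

lemma hgerm_eventually:
  assumes "hgerm f" "0 < \<eta>"
  shows "\<forall>\<^sub>F y in nhds 0. norm (f y) < \<eta>"
proof -
  obtain r where r: "0 < r" "\<And>y. (\<And>i. norm (y $ i) < r) \<Longrightarrow> norm (f y) < \<eta>"
    using hgerm_small[OF assms] by metis
  have "norm (f y) < \<eta>" if "dist y 0 < r" for y
    using r(2)[of y] that le_less_trans[OF Finite_Cartesian_Product.norm_nth_le[of y]] by simp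
  then show ?thesis using r(1) unfolding eventually_nhds_metric by blast
qed

lemma eventually_polydisc:
  fixes P :: "complex ^ 'n \<Rightarrow> bool"
  assumes "\<forall>\<^sub>F y in nhds 0. P y"
  obtains r where "0 < r" "\<And>y. (\<And>i. norm (y $ i) < r) \<Longrightarrow> P y"
proof -
  obtain e where e: "e > 0" "\<And>y. norm y < e \<Longrightarrow> P y"
    using assms unfolding eventually_nhds_metric by auto
  define r where "r = e / real CARD('n)"
  have "P y" if "\<And>i. norm (y $ i) < r" for y
  proof (rule e(2))
    have "norm y \<le> (\<Sum>i\<in>UNIV. norm (y $ i))" by (simp add: norm_vec_def L2_set_le_sum)
    also have "\<dots> < (\<Sum>i\<in>(UNIV::'n set). r)" by (intro sum_strict_mono that) auto
    finally show "norm y < e" by (simp add: r_def)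
  qed
  moreover have "0 < r" using e(1) by (simp add: r_def)
  ultimately show ?thesis using that by blast
qed

section \<open>Polarization of the mapping equation\<close>

text \<open>If \<open>b\<close> is the conjugate of \<open>a\<close>, this is twice the difference of the two sides of the equation of the target
hypersurface at \<open>h a\<close>, since then \<open>h a $ 3\<close> and its conjugate give \<open>2 u\<close> as sum and \<open>2 i v\<close> as difference.
In general \<open>a\<close> and \<open>b\<close> are independent.\<close>

definition polarized_equation :: "(complex ^ 3 \<Rightarrow> complex ^ 3) \<Rightarrow> complex \<Rightarrow> (nat ^ 5 \<Rightarrow> complex)
    \<Rightarrow> complex ^ 3 \<Rightarrow> complex ^ 3 \<Rightarrow> complex" where
  "polarized_equation h c R a b = h a $ 3 + cnj (h (conj_vec b) $ 3)
     - 2 * graph_fun c R (vector [h a $ 1, h a $ 2, cnj (h (conj_vec b) $ 1), cnj (h (conj_vec b) $ 2),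
         1 / (2 * \<i>) * (h a $ 3 - cnj (h (conj_vec b) $ 3))])"

lemma hgerm_polarized_equation:
  assumes N: "normal_form c R r N" and h: "\<And>j. hgerm (\<lambda>y. h y $ j)"
    and a: "\<And>j. hgerm (\<lambda>y. a y $ j)" and b: "\<And>j. hgerm (\<lambda>y. b y $ j)"
  shows "hgerm (\<lambda>y. polarized_equation h c R (a y) (b y))"
proof -
  have ha: "hgerm (\<lambda>y. h (a y) $ j)" for j by (rule hgerm_compose[OF h a])
  have hb: "hgerm (\<lambda>y. cnj (h (conj_vec (b y)) $ j))" for j by (rule hgerm_compose[OF hgerm_cnj[OF h] b])
  show ?thesis
    unfolding polarized_equation_def
    by (intro hgerm_diff hgerm_add hgerm_cmult hgerm_vector_5[OF hgerm_graph_fun[OF N]] ha hb)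
qed

lemma hgerm_vector_nth_3:
  "hgerm a \<Longrightarrow> hgerm b \<Longrightarrow> hgerm c \<Longrightarrow> hgerm (\<lambda>y. (vector [a y, b y, c y] :: complex ^ 3) $ j)"
  by (rule hgerm_vector_3[OF hgerm_nth])

text \<open>The arguments parametrize the complexification of \<open>N\<close>. The coordinate change \<open>L\<close> turns the points where
the identity is known, those with mutually conjugate coordinates, into the real vectors.\<close>

lemma polarized_identity:
  assumes N: "normal_form c R r N" and N': "normal_form c' R' r' N'"
    and h: "\<And>j. hgerm (\<lambda>y. h y $ j)"
    and map: "\<forall>\<^sub>F q in nhds 0. q \<in> N \<longrightarrow> h q \<in> N'"
  shows "\<forall>\<^sub>F X in nhds 0. polarized_equation h c' R' (vector [X $ 1, X $ 2, graph_fun c R X + \<i> * X $ 5])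
           (vector [X $ 3, X $ 4, graph_fun c R X - \<i> * X $ 5]) = 0"
proof -
  have r: "0 < r" and r': "0 < r'" using N N' by (auto simp: normal_form_def abs_conv_def)
  define L :: "complex ^ 5 \<Rightarrow> complex ^ 5" where
    "L = (\<lambda>y. vector [y $ 1 + \<i> * y $ 2, y $ 3 + \<i> * y $ 4, y $ 1 - \<i> * y $ 2, y $ 3 - \<i> * y $ 4, y $ 5])"
  define F where "F = (\<lambda>y. graph_fun c R (L y))"
  define a :: "complex ^ 5 \<Rightarrow> complex ^ 3" where "a = (\<lambda>y. vector [L y $ 1, L y $ 2, F y + \<i> * y $ 5])"
  define b :: "complex ^ 5 \<Rightarrow> complex ^ 3" where "b = (\<lambda>y. vector [L y $ 3, L y $ 4, F y - \<i> * y $ 5])"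
  define g where "g = (\<lambda>y. polarized_equation h c' R' (a y) (b y))"
  have L: "hgerm (\<lambda>y. L y $ j)" for j
    unfolding L_def by (intro hgerm_vector_5[OF hgerm_nth] hgerm_add hgerm_diff hgerm_cmult hgerm_nth)
  have F: "hgerm F" unfolding F_def by (rule hgerm_compose[OF hgerm_graph_fun[OF N] L])
  have a: "hgerm (\<lambda>y. a y $ j)" and b: "hgerm (\<lambda>y. b y $ j)" for j
    unfolding a_def b_def by (intro hgerm_vector_nth_3 hgerm_add hgerm_diff hgerm_cmult hgerm_nth L F)+
  have g: "hgerm g" unfolding g_def by (rule hgerm_polarized_equation[OF N' h a b])
  have small: "\<forall>\<^sub>F y in nhds 0. \<forall>j. norm (f y $ j) < \<eta>"
    if "\<And>j. hgerm (\<lambda>y. f y $ j)" "0 < \<eta>" for f :: "complex ^ 5 \<Rightarrow> complex ^ 'm" and \<eta>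
    using hgerm_eventually[OF that(1) that(2)] by (simp add: eventually_all_finite)
  obtain e where e: "0 < e" "\<And>q. (\<And>i. norm (q $ i) < e) \<Longrightarrow> q \<in> N \<Longrightarrow> h q \<in> N'"
    using eventually_polydisc[OF map] by blast
  have "\<forall>\<^sub>F y in nhds 0. (\<forall>i. y $ i \<in> \<real>) \<longrightarrow> g y = 0"
    using small[OF L r] small[OF a r] small[OF a e(1)] small[OF hgerm_compose[OF h a] r']
  proof eventually_elim
    case (elim y)
    show ?case
    proof
      assume y: "\<forall>i. y $ i \<in> \<real>"
      have [simp]: "cnj (y $ i) = y $ i" for i using y by (simp add: Reals_cnj_iff)
      define z \<zeta> v where "z = L y $ 1" and "\<zeta> = L y $ 2" and "v = Re (y $ 5)"
      have v: "y $ 5 = of_real v" using y by (simp add: v_def)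
      have Ly: "L y = real_point z \<zeta> v"
        by (simp add: vec_eq_iff forall_5 vector_5 real_point_def z_def \<zeta>_def L_def v)
      have lt: "norm z < r" "norm \<zeta> < r" "\<bar>v\<bar> < r"
        using elim(1)[rule_format, of 1] elim(1)[rule_format, of 2] elim(1)[rule_format, of 5] 
        by (auto simp: z_def \<zeta>_def L_def vector_5 v)
      then have "Im (F y) = 0" using N unfolding normal_form_def F_def Ly by blast
      then have cF: "cnj (F y) = F y" by (simp add: complex_eq_iff)
      have "Re (a y $ 3) = Re (graph_fun c R (real_point (a y $ 1) (a y $ 2) (Im (a y $ 3))))"
      proof -
        have "a y $ 1 = z" "a y $ 2 = \<zeta>" by (simp_all add: a_def z_def \<zeta>_def)
        moreover have "Im (a y $ 3) = v" "Re (a y $ 3) = Re (F y)"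
          using \<open>Im (F y) = 0\<close> by (simp_all add: a_def v)
        ultimately show ?thesis by (simp only: F_def Ly)
      qed
      then have "a y \<in> N" using N elim(2) unfolding normal_form_def by blast
      then have "h (a y) \<in> N'" using e(2) elim(3) by blast
      then have 1: "Re (h (a y) $ 3) = Re (graph_fun c' R' (real_point (h (a y) $ 1) (h (a y) $ 2) (Im (h (a y) $ 3))))"
        using N' elim(4) unfolding normal_form_def by blast
      have "\<bar>Im (h (a y) $ 3)\<bar> < r'" using elim(4) abs_Im_le_cmod le_less_trans by blast
      then have 2: "Im (graph_fun c' R' (real_point (h (a y) $ 1) (h (a y) $ 2) (Im (h (a y) $ 3)))) = 0"
        using N' elim(4) unfolding normal_form_def by blast
      have c1: "conj_vec (b y) = a y"
        by (simp add: conj_vec_def vec_eq_iff forall_3 a_def b_def L_def vector_5 cF)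
      have c2: "1 / (2 * \<i>) * (h (a y) $ 3 - cnj (h (a y) $ 3)) = of_real (Im (h (a y) $ 3))"
        by (simp add: complex_eq_iff)
      have c3: "h (a y) $ 3 + cnj (h (a y) $ 3) = 2 * of_real (Re (h (a y) $ 3))"
        by (simp add: complex_eq_iff)
      show "g y = 0"
        unfolding g_def polarized_equation_def c1 c2 c3 using 1 2 by (simp add: real_point_def complex_eq_iff)
    qed
  qed
  then obtain \<rho>1 where \<rho>1: "0 < \<rho>1" "\<And>y. (\<And>i. norm (y $ i) < \<rho>1) \<Longrightarrow> (\<forall>i. y $ i \<in> \<real>) \<longrightarrow> g y = 0"
    using eventually_polydisc by blast
  obtain \<rho>2 where \<rho>2: "0 < \<rho>2" "curve_hol g \<rho>2" using hgerm_small[OF g, of 1] by auto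
  define \<rho> where "\<rho> = min \<rho>1 \<rho>2"
  have \<rho>: "0 < \<rho>" "\<rho> \<le> \<rho>1" "\<rho> \<le> \<rho>2" using \<rho>1 \<rho>2 by (auto simp: \<rho>_def)
  have g0: "g y = 0" if y: "\<And>i. norm (y $ i) < \<rho>" for y
  proof (rule vanish_real_vectors[OF curve_hol_mono[OF \<rho>2(2) \<rho>(3)] _ y])
    fix x :: "complex ^ 5" assume "\<And>i. x $ i \<in> \<real> \<and> norm (x $ i) < \<rho>"
    then show "g x = 0" using \<rho>1(2)[of x] \<rho>(2) by (meson less_le_trans)
  qed
  define M :: "complex ^ 5 \<Rightarrow> complex ^ 5" where
    "M = (\<lambda>X. vector [1/2 * (X $ 1 + X $ 3), 1 / (2 * \<i>) * (X $ 1 - X $ 3),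
       1/2 * (X $ 2 + X $ 4), 1 / (2 * \<i>) * (X $ 2 - X $ 4), X $ 5])"
  have M: "hgerm (\<lambda>X. M X $ j)" for j
    unfolding M_def by (intro hgerm_vector_5[OF hgerm_nth] hgerm_add hgerm_diff hgerm_cmult hgerm_nth)
  have LM: "L (M X) = X" for X
    by (simp add: L_def M_def vec_eq_iff forall_5 vector_5 field_simps)
  show ?thesis
    using small[OF M \<rho>(1)]
  proof eventually_elim
    case (elim X)
    then have "g (M X) = 0" using g0 by blast
    then show ?case by (simp add: g_def a_def b_def F_def LM) (simp add: M_def vector_5)
  qed
qed

section \<open>Estimates under weighted scaling\<close>

lemma hgerm_scale:
  fixes f :: "complex ^ 'n \<Rightarrow> complex"
  assumes "hgerm f"
  obtains C where "0 \<le> C"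
    "\<forall>\<^sub>F \<epsilon> in at_right (0::real). \<forall>y. (\<forall>i. norm (y $ i) \<le> B * \<epsilon>) \<longrightarrow> norm (f y) \<le> C * \<epsilon>"
proof -
  obtain r C where r: "0 < r" and C: "0 \<le> C"
    and b: "\<And>y m. (\<And>i. norm (y $ i) \<le> m) \<Longrightarrow> m \<le> r \<Longrightarrow> norm (f y) \<le> C * m"
    using hgerm_linear_bound[OF assms] by metis
  have "\<forall>\<^sub>F \<epsilon> in at_right (0::real). 0 < \<epsilon> \<and> \<epsilon> < r / (\<bar>B\<bar> + 1)"
    using r by (auto simp: eventually_at_right_field intro!: exI[of _ "r / (\<bar>B\<bar> + 1)"])
  then have "\<forall>\<^sub>F \<epsilon> in at_right (0::real). \<forall>y. (\<forall>i. norm (y $ i) \<le> B * \<epsilon>) \<longrightarrow> norm (f y) \<le> C * \<bar>B\<bar> * \<epsilon>"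
  proof eventually_elim
    case (elim \<epsilon>)
    have "\<bar>B\<bar> * \<epsilon> \<le> (\<bar>B\<bar> + 1) * \<epsilon>" using elim by simp
    also have "\<dots> \<le> r" using elim by (simp add: field_simps)
    finally have le: "\<bar>B\<bar> * \<epsilon> \<le> r" .
    have "B * \<epsilon> \<le> \<bar>B\<bar> * \<epsilon>" using elim by (intro mult_right_mono) auto
    then show ?case using b[OF _ le] by (simp add: mult.assoc) (meson order_trans)
  qed
  then show ?thesis using that[of "C * \<bar>B\<bar>"] C by simp
qed

lemma remainder_scale:
  assumes N: "normal_form c R r N" and B: "0 \<le> B"
  obtains C where "0 \<le> C" "\<forall>\<^sub>F \<epsilon> in at_right (0::real). \<forall>X. (\<forall>i. i \<noteq> 5 \<longrightarrow> norm (X $ i) \<le> B * \<epsilon>) \<longrightarrow>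
      norm (X $ 5) \<le> B * \<epsilon>\<^sup>2 \<longrightarrow> norm (psum R X) \<le> C * \<epsilon> ^ 6"
proof -
  have r: "0 < r" "r \<le> 1" using N by (auto simp: normal_form_def abs_conv_def)
  obtain C where C: "\<And>X \<theta>. (\<And>i. i \<noteq> 5 \<Longrightarrow> norm (X $ i) \<le> \<theta> * r) \<Longrightarrow> norm (X $ 5) \<le> \<theta>\<^sup>2 * r \<Longrightarrow>
      0 \<le> \<theta> \<Longrightarrow> \<theta> \<le> 1 \<Longrightarrow> norm (psum R X) \<le> C * \<theta> ^ 6"
    using normal_form_remainder[OF N] by blast
  \<comment> \<open>Since \<open>1 \<le> Q\<close>, this one factor suffices for the coordinates of both weights.\<close>
  define Q where "Q = (1 + B) / r"
  have Q: "1 \<le> Q" "B \<le> Q * r" using r B by (auto simp: Q_def field_simps)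
  have Q2: "B \<le> Q\<^sup>2 * r"
  proof -
    have "Q * r * 1 \<le> Q * r * Q" using Q r by (intro mult_left_mono) auto
    then have "B \<le> Q * r * Q" using Q(2) by linarith
    then show ?thesis by (simp add: power2_eq_square mult_ac)
  qed
  have "\<forall>\<^sub>F \<epsilon> in at_right (0::real). 0 < \<epsilon> \<and> \<epsilon> < 1 / Q"
    using Q by (auto simp: eventually_at_right_field intro!: exI[of _ "1 / Q"])
  then have "\<forall>\<^sub>F \<epsilon> in at_right (0::real). \<forall>X. (\<forall>i. i \<noteq> 5 \<longrightarrow> norm (X $ i) \<le> B * \<epsilon>) \<longrightarrow>
      norm (X $ 5) \<le> B * \<epsilon>\<^sup>2 \<longrightarrow> norm (psum R X) \<le> \<bar>C\<bar> * Q ^ 6 * \<epsilon> ^ 6"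
  proof eventually_elim
    case (elim \<epsilon>)
    show ?case
    proof (intro allI impI)
      fix X :: "complex ^ 5"
      assume X: "\<forall>i. i \<noteq> 5 \<longrightarrow> norm (X $ i) \<le> B * \<epsilon>" "norm (X $ 5) \<le> B * \<epsilon>\<^sup>2"
      have 1: "B * \<epsilon> \<le> Q * \<epsilon> * r" using mult_right_mono[OF Q(2), of \<epsilon>] elim by (simp add: mult_ac)
      have 2: "B * \<epsilon>\<^sup>2 \<le> (Q * \<epsilon>)\<^sup>2 * r"
        using mult_right_mono[OF Q2, of "\<epsilon>\<^sup>2"] by (simp add: power_mult_distrib mult_ac)
      have "norm (psum R X) \<le> C * (Q * \<epsilon>) ^ 6"
      proof (rule C)
        show "norm (X $ i) \<le> Q * \<epsilon> * r" if "i \<noteq> 5" for i using X(1) that 1 order_trans by blast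
        show "norm (X $ 5) \<le> (Q * \<epsilon>)\<^sup>2 * r" using X(2) 2 by (rule order_trans)
        show "0 \<le> Q * \<epsilon>" "Q * \<epsilon> \<le> 1" using elim Q by (auto simp: field_simps)
      qed
      also have "\<dots> \<le> \<bar>C\<bar> * (Q * \<epsilon>) ^ 6" using elim Q by (intro mult_right_mono) auto
      finally show "norm (psum R X) \<le> \<bar>C\<bar> * Q ^ 6 * \<epsilon> ^ 6" by (simp add: power_mult_distrib mult_ac)
    qed
  qed
  then show ?thesis using that[of "\<bar>C\<bar> * Q ^ 6"] Q by simp
qed

text \<open>In the application \<open>f\<close> is the third component of \<open>h\<close>, whose differential annihilates the complex tangent
space. Along the weighted curve \<open>(s \<alpha>, s \<beta>, s\<^sup>2 \<gamma>)\<close> the function has a double zero.\<close>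

lemma hgerm_weighted_scale:
  fixes f :: "complex ^ 3 \<Rightarrow> complex"
  assumes f: "hgerm f" and d: "(f has_derivative (\<lambda>y. l * y $ 3)) (at 0)" and B: "0 \<le> B"
  obtains C where "0 \<le> C" "\<forall>\<^sub>F \<epsilon> in at_right (0::real). \<forall>y. norm (y $ 1) \<le> B * \<epsilon> \<longrightarrow>
      norm (y $ 2) \<le> B * \<epsilon> \<longrightarrow> norm (y $ 3) \<le> B * \<epsilon>\<^sup>2 \<longrightarrow> norm (f y) \<le> C * \<epsilon>\<^sup>2"
proof -
  obtain r where r: "0 < r" "curve_hol f r" "\<And>y. (\<And>i. norm (y $ i) < r) \<Longrightarrow> norm (f y) < 1"
    using hgerm_small[OF f, of 1] by auto
  define \<rho> where "\<rho> = min 1 (r / (B + 1))"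
  have \<rho>: "0 < \<rho>" "\<rho> \<le> 1" and "\<rho> \<le> r / (B + 1)" using r B by (auto simp: \<rho>_def)
  then have \<rho>B: "\<rho> * (B + 1) \<le> r" using B by (simp add: pos_le_divide_eq)
  have "\<forall>\<^sub>F \<epsilon> in at_right (0::real). 0 < \<epsilon> \<and> \<epsilon> < \<rho> / 4"
    using \<rho> by (auto simp: eventually_at_right_field intro!: exI[of _ "\<rho> / 4"])
  then have "\<forall>\<^sub>F \<epsilon> in at_right (0::real). \<forall>y. norm (y $ 1) \<le> B * \<epsilon> \<longrightarrow>
      norm (y $ 2) \<le> B * \<epsilon> \<longrightarrow> norm (y $ 3) \<le> B * \<epsilon>\<^sup>2 \<longrightarrow> norm (f y) \<le> 8 / \<rho>\<^sup>2 * \<epsilon>\<^sup>2"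
  proof eventually_elim
    case (elim \<epsilon>)
    show ?case
    proof (intro allI impI)
      fix y :: "complex ^ 3"
      assume y: "norm (y $ 1) \<le> B * \<epsilon>" "norm (y $ 2) \<le> B * \<epsilon>" "norm (y $ 3) \<le> B * \<epsilon>\<^sup>2"
      define x :: "complex \<Rightarrow> complex ^ 3" where
        "x = (\<lambda>s. vector [s * (y $ 1 / of_real \<epsilon>), s * (y $ 2 / of_real \<epsilon>), s\<^sup>2 * (y $ 3 / of_real (\<epsilon>\<^sup>2))])"
      have q: "norm (y $ 1 / of_real \<epsilon>) \<le> B" "norm (y $ 2 / of_real \<epsilon>) \<le> B" "norm (y $ 3 / of_real (\<epsilon>\<^sup>2)) \<le> B"
        using y elim by (auto simp: norm_divide norm_power field_simps)
      have xb: "norm (x s $ i) < r" if s: "norm s < \<rho>" for s i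
      proof -
        have sB: "norm s * B < r"
        proof -
          have "norm s * B \<le> \<rho> * B" using s B by (intro mult_right_mono) auto
          also have "\<dots> < \<rho> * (B + 1)" using \<rho> by simp
          finally show ?thesis using \<rho>B by simp
        qed
        have "norm s * norm s \<le> norm s * 1" using s \<rho> by (intro mult_left_mono) auto
        then have s2: "norm (s\<^sup>2) \<le> norm s" by (simp add: norm_mult power2_eq_square)
        have "norm (s * (y $ 1 / of_real \<epsilon>)) \<le> norm s * B" "norm (s * (y $ 2 / of_real \<epsilon>)) \<le> norm s * B"
          unfolding norm_mult[of s] by (intro mult_left_mono q norm_ge_zero)+
        moreover have "norm (s\<^sup>2 * (y $ 3 / of_real (\<epsilon>\<^sup>2))) \<le> norm s * B"
          unfolding norm_mult[of "s\<^sup>2"] by (intro mult_mono s2 q norm_ge_zero)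
        ultimately show ?thesis using sB exhaust_3[of i] by (auto simp: x_def)
      qed
      have hol: "(\<lambda>s. f (x s)) holomorphic_on ball 0 \<rho>"
      proof (rule curve_holD[OF r(2)])
        show "(\<lambda>t. x t $ i) holomorphic_on ball 0 \<rho>" for i
          using exhaust_3[of i] elim unfolding x_def
          by (elim disjE; simp only: vector_3) (intro holomorphic_intros; simp)+
      qed (use xb in auto)
      have x0: "x 0 = 0" by (simp add: x_def vec_eq_iff forall_3)
      have "((\<lambda>s. x s $ j) has_derivative (\<lambda>s. (vector [s * (y $ 1 / of_real \<epsilon>), s * (y $ 2 / of_real \<epsilon>), 0] :: complex ^ 3) $ j)) (at 0)" for j
        using exhaust_3[of j] elim unfolding x_def
        by (elim disjE; simp only: vector_3) (auto intro!: derivative_eq_intros)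
      then have "(x has_derivative (\<lambda>s. vector [s * (y $ 1 / of_real \<epsilon>), s * (y $ 2 / of_real \<epsilon>), 0])) (at 0)"
        by (rule has_derivative_componentwise_vec)
      moreover have "(f has_derivative (\<lambda>y. l * y $ 3)) (at (x 0))" using d by (simp add: x0)
      ultimately have "((\<lambda>s. f (x s)) has_derivative (\<lambda>s. l * (vector [s * (y $ 1 / of_real \<epsilon>), s * (y $ 2 / of_real \<epsilon>), 0] :: complex ^ 3) $ 3)) (at 0)"
        by (rule has_derivative_compose)
      then have "((\<lambda>s. f (x s)) has_field_derivative 0) (at 0)"
        by (simp add: has_field_derivative_def) (simp add: lambda_zero)
      then have d0: "deriv (\<lambda>s. f (x s)) 0 = 0" by (rule DERIV_imp_deriv)
      have "norm (f (x \<epsilon>) - (\<Sum>j<2. (deriv ^^ j) (\<lambda>s. f (x s)) 0 / fact j * (complex_of_real \<epsilon>) ^ j))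
         \<le> 2 * 1 * (2 * norm (complex_of_real \<epsilon>) / \<rho>) ^ 2"
        by (rule holomorphic_taylor_bound[OF hol \<rho>(1)]) (use elim xb r(3) in \<open>auto intro: less_imp_le\<close>)
      also have "(\<Sum>j<2. (deriv ^^ j) (\<lambda>s. f (x s)) 0 / fact j * (complex_of_real \<epsilon>) ^ j) = 0"
        using f by (simp add: numeral_2_eq_2 d0 x0 hgerm_def)
      also have "x \<epsilon> = y" using elim by (simp add: x_def vec_eq_iff forall_3)
      finally show "norm (f y) \<le> 8 / \<rho>\<^sup>2 * \<epsilon>\<^sup>2" by (simp add: power_divide power_mult_distrib)
    qed
  qed
  then show ?thesis using that[of "8 / \<rho>\<^sup>2"] by simp
qed

section \<open>Tangent planes of Segre varieties\<close>

lemma hgerm_mult_const: "hgerm f \<Longrightarrow> hgerm (\<lambda>y. f y * a)"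
  using hgerm_cmult[of f a] by (simp add: mult.commute)

lemma hgerm_normal_poly:
  assumes "hgerm z" "hgerm \<zeta>" "hgerm \<xi>" "hgerm \<eta>"
  shows "hgerm (\<lambda>y. normal_poly c (z y) (\<zeta> y) (\<xi> y) (\<eta> y))"
proof -
  have eq: "normal_poly c z \<zeta> \<xi> \<eta> = z * \<xi> + 1/2 * (\<xi> * \<xi> * \<zeta>) + 1/2 * (z * z * \<eta>) + z * \<xi> * \<zeta> * \<eta>
     + 1/2 * (\<xi> * \<xi> * \<zeta> * \<zeta> * \<eta>) + 1/2 * (z * z * \<eta> * \<zeta> * \<eta>)
     + c * (z * z * z * \<eta> * \<eta>) + cnj c * (\<xi> * \<xi> * \<xi> * \<zeta> * \<zeta>)" for z \<zeta> \<xi> \<eta>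
    by (simp add: normal_poly_def power2_eq_square power3_eq_cube mult_ac)
  have p: "hgerm (\<lambda>y. z y * \<xi> y)" "hgerm (\<lambda>y. \<xi> y * \<xi> y * \<zeta> y)" "hgerm (\<lambda>y. z y * z y * \<eta> y)"
    "hgerm (\<lambda>y. z y * \<xi> y * \<zeta> y * \<eta> y)" "hgerm (\<lambda>y. \<xi> y * \<xi> y * \<zeta> y * \<zeta> y * \<eta> y)"
    "hgerm (\<lambda>y. z y * z y * \<eta> y * \<zeta> y * \<eta> y)" "hgerm (\<lambda>y. z y * z y * z y * \<eta> y * \<eta> y)"
    "hgerm (\<lambda>y. \<xi> y * \<xi> y * \<xi> y * \<zeta> y * \<zeta> y)"
    by (intro hgerm_mult assms)+
  show ?thesis
    unfolding eq by (intro hgerm_add p hgerm_cmult[OF p(2)] hgerm_cmult[OF p(3)] hgerm_cmult[OF p(5)]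
        hgerm_cmult[OF p(6)] hgerm_cmult[OF p(7)] hgerm_cmult[OF p(8)])
qed

lemma normal_poly_has_field_derivative:
  assumes "(f has_field_derivative f') (at 0)" "(g has_field_derivative g') (at 0)" "f 0 = 0" "g 0 = 0"
  shows "((\<lambda>\<mu>. normal_poly c (f \<mu>) (g \<mu>) \<xi> \<eta>) has_field_derivative (\<xi> * f' + 1/2 * \<xi>\<^sup>2 * g')) (at 0)"
  unfolding normal_poly_def by (auto intro!: derivative_eq_intros assms simp: assms(3,4))

text \<open>The tangent plane at 0 of the Segre variety of \<open>N\<close> with parameter \<open>(\<epsilon>, 0, 0)\<close> contains the vector
\<open>q\<close>, up to an error of fifth order, and that of \<open>N'\<close> with parameter \<open>A\<close> is
\<open>w = 2 A z + A\<^sup>2 \<zeta>\<close>. The lemma says that \<open>D\<close> maps the first plane into the second to this order.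

In the proof \<open>(z, \<zeta>) = \<mu> (z0, \<zeta>0)\<close> moves along the Segre variety. The polarized identity bounds the function
\<open>Bf\<close> by a multiple of \<open>\<epsilon> ^ 6\<close> on the disc of radius \<open>2 \<epsilon>\<close>, after both remainders have been discarded, and
Cauchy's inequality on the circle of radius \<open>\<epsilon>\<close> turns this into a bound for the derivative at \<open>\<mu> = 0\<close>.\<close>

lemma segre_tangent_estimate:
  assumes N: "normal_form c R r N" and N': "normal_form c' R' r' N'"
    and h: "\<And>j. hgerm (\<lambda>y. h y $ j)"
    and map: "\<forall>\<^sub>F q in nhds 0. q \<in> N \<longrightarrow> h q \<in> N'"
    and dh: "(h has_derivative (\<lambda>y. D *v y)) (at 0)"
    and D3: "D $ 3 $ 1 = 0" "D $ 3 $ 2 = 0"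
    and z0: "norm z0 \<le> 1" "norm \<zeta>0 \<le> 1"
  obtains C where "\<forall>\<^sub>F \<epsilon> in at_right (0::real).
    let A = cnj (h (vector [of_real \<epsilon>, 0, 0]) $ 1);
        q = vector [z0, \<zeta>0, 2 * of_real \<epsilon> * z0 + (of_real \<epsilon>)\<^sup>2 * \<zeta>0]
    in norm ((D *v q) $ 3 - 2 * A * (D *v q) $ 1 - A\<^sup>2 * (D *v q) $ 2) \<le> C * \<epsilon> ^ 5"
proof -
  define n0 where "n0 = (\<lambda>\<epsilon> \<mu>. normal_poly c (\<mu> * z0) (\<mu> * \<zeta>0) \<epsilon> 0)"
  define p :: "complex \<Rightarrow> complex \<Rightarrow> complex \<Rightarrow> complex ^ 3" where
    "p = (\<lambda>\<epsilon> \<mu> s. vector [\<mu> * z0, \<mu> * \<zeta>0, 2 * n0 \<epsilon> \<mu> + s])"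
  define b :: "complex \<Rightarrow> complex \<Rightarrow> complex ^ 3" where "b = (\<lambda>\<epsilon> s. vector [\<epsilon>, 0, s])"
  define X :: "complex \<Rightarrow> complex \<Rightarrow> complex ^ 5" where
    "X = (\<lambda>\<epsilon> \<mu>. vector [\<mu> * z0, \<mu> * \<zeta>0, \<epsilon>, 0, - \<i> * n0 \<epsilon> \<mu>])"
  define g where "g = (\<lambda>y::complex^3. polarized_equation h c' R' (p (y $ 2) (y $ 1) (y $ 3)) (b (y $ 2) (y $ 3)))"
  have gn: "hgerm (\<lambda>y :: complex ^ 3. n0 (y $ 2) (y $ 1))"
    unfolding n0_def by (intro hgerm_normal_poly hgerm_mult_const hgerm_nth hgerm_0)
  have gp: "hgerm (\<lambda>y :: complex ^ 3. p (y $ 2) (y $ 1) (y $ 3) $ j)" for j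
    unfolding p_def by (intro hgerm_vector_nth_3 hgerm_add hgerm_cmult[OF gn] hgerm_mult_const hgerm_nth)
  have gb: "hgerm (\<lambda>y :: complex ^ 3. b (y $ 2) (y $ 3) $ j)" for j
    unfolding b_def by (intro hgerm_vector_nth_3 hgerm_nth hgerm_0)
  have "hgerm g" unfolding g_def by (rule hgerm_polarized_equation[OF N' h gp gb])
  then obtain rg Kg where Kg: "bounded_hol g rg Kg" by (auto simp: hgerm_def)
  then have rg: "0 < rg" by (simp add: bounded_hol_def)
  define C0 where "C0 = 5 + 2 * norm c"
  have C0: "0 \<le> C0" by (simp add: C0_def)
  \<comment> \<open>A common constant for all coordinates: \<open>2 \<epsilon>\<close> bounds \<open>z\<close> and \<open>\<zeta>\<close>, and
    \<open>8 C0 \<epsilon>\<^sup>2\<close> bounds \<open>w\<close>.\<close>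
  define B where "B = 2 + 8 * C0"
  have B: "0 \<le> B" "2 \<le> B" using C0 by (auto simp: B_def)
  obtain C1 where C1: "0 \<le> C1" "\<forall>\<^sub>F \<epsilon> in at_right (0::real). \<forall>X. (\<forall>i. i \<noteq> 5 \<longrightarrow> norm (X $ i) \<le> B * \<epsilon>) \<longrightarrow>
      norm (X $ 5) \<le> B * \<epsilon>\<^sup>2 \<longrightarrow> norm (psum R X) \<le> C1 * \<epsilon> ^ 6"
    using remainder_scale[OF N B(1)] by blast
  have dh3: "((\<lambda>y. h y $ 3) has_derivative (\<lambda>y. D $ 3 $ 3 * y $ 3)) (at 0)"
    using bounded_linear.has_derivative[OF bounded_linear_vec_nth dh, of 3]
    by (simp add: matrix_vector_mult_def sum_3 D3)
  obtain H1 where H1: "0 \<le> H1" "\<forall>\<^sub>F \<epsilon> in at_right (0::real). \<forall>y. (\<forall>i. norm (y $ i) \<le> B * \<epsilon>) \<longrightarrow> norm (h y $ 1) \<le> H1 * \<epsilon>"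
    using hgerm_scale[OF h] by blast
  obtain H2 where H2: "0 \<le> H2" "\<forall>\<^sub>F \<epsilon> in at_right (0::real). \<forall>y. (\<forall>i. norm (y $ i) \<le> B * \<epsilon>) \<longrightarrow> norm (h y $ 2) \<le> H2 * \<epsilon>"
    using hgerm_scale[OF h] by blast
  obtain H3 where H3: "0 \<le> H3" "\<forall>\<^sub>F \<epsilon> in at_right (0::real). \<forall>y. norm (y $ 1) \<le> B * \<epsilon> \<longrightarrow>
      norm (y $ 2) \<le> B * \<epsilon> \<longrightarrow> norm (y $ 3) \<le> B * \<epsilon>\<^sup>2 \<longrightarrow> norm (h y $ 3) \<le> H3 * \<epsilon>\<^sup>2"
    using hgerm_weighted_scale[OF h dh3 B(1)] by blast
  define B' where "B' = H1 + H2 + H3"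
  have B': "0 \<le> B'" "H1 \<le> B'" "H2 \<le> B'" "H3 \<le> B'" using H1 H2 H3 by (auto simp: B'_def)
  obtain C2 where C2: "0 \<le> C2" "\<forall>\<^sub>F \<epsilon> in at_right (0::real). \<forall>X. (\<forall>i. i \<noteq> 5 \<longrightarrow> norm (X $ i) \<le> B' * \<epsilon>) \<longrightarrow>
      norm (X $ 5) \<le> B' * \<epsilon>\<^sup>2 \<longrightarrow> norm (psum R' X) \<le> C2 * \<epsilon> ^ 6"
    using remainder_scale[OF N' B'(1)] by blast
  obtain \<rho> where \<rho>: "0 < \<rho>" "\<And>X. (\<And>i. norm (X $ i) < \<rho>) \<Longrightarrow>
      polarized_equation h c' R' (vector [X $ 1, X $ 2, graph_fun c R X + \<i> * X $ 5])
           (vector [X $ 3, X $ 4, graph_fun c R X - \<i> * X $ 5]) = 0"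
    using eventually_polydisc[OF polarized_identity[OF N N' h map]] by blast
  obtain rh where rh: "0 < rh" "\<And>j. curve_hol (\<lambda>y. h y $ j) rh"
  proof (rule finite_radius[of "\<lambda>j r. curve_hol (\<lambda>y. h y $ j) r"])
    show "\<exists>r>0. curve_hol (\<lambda>y. h y $ j) r" for j using hgerm_small[OF h[of j], of 1] by auto
  qed (auto intro: curve_hol_mono)
  have c1: "\<forall>\<^sub>F \<epsilon> in at_right (0::real). \<epsilon> * k < m" if "0 < m" for k m :: real
  proof -
    have "((\<lambda>\<epsilon>. \<epsilon> * k) \<longlongrightarrow> 0 * k) (at_right 0)" by (intro tendsto_intros)
    then show ?thesis using order_tendstoD(2)[of _ 0 "at_right 0" m] that by simp
  qed
  have c2: "\<forall>\<^sub>F \<epsilon> in at_right (0::real). 0 < \<epsilon>" by (simp add: eventually_at_right_less)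
  have c3: "\<forall>\<^sub>F \<epsilon> in at_right (0::real). C1 * \<epsilon> ^ 6 < rg / 8"
  proof -
    have "((\<lambda>\<epsilon>. C1 * \<epsilon> ^ 6) \<longlongrightarrow> C1 * 0 ^ 6) (at_right (0::real))" by (intro tendsto_intros)
    then show ?thesis using order_tendstoD(2)[of _ 0 "at_right 0" "rg/8"] rg by simp
  qed
  define C3 where "C3 = 8 * Kg / rg * C1 + 2 * C2"
  have rg8: "0 < rg / 8" using rg by simp
  have "\<forall>\<^sub>F \<epsilon> in at_right (0::real).
    let A = cnj (h (vector [of_real \<epsilon>, 0, 0]) $ 1);
        q = vector [z0, \<zeta>0, 2 * of_real \<epsilon> * z0 + (of_real \<epsilon>)\<^sup>2 * \<zeta>0]
    in norm ((D *v q) $ 3 - 2 * A * (D *v q) $ 1 - A\<^sup>2 * (D *v q) $ 2) \<le> C3 * \<epsilon> ^ 5"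
    using c1[OF zero_less_one, of 2] c1[OF \<rho>(1), of B] c1[OF rh(1), of B] c1[OF rg8, of B] c2 c3 C1(2) H1(2) H2(2) H3(2) C2(2)
  proof eventually_elim
    case (elim \<epsilon>)
    note \<epsilon> = elim(1-6) and C1' = elim(7) and H1' = elim(8) and H2' = elim(9) and H3' = elim(10) and C2' = elim(11)
    have e2: "2 * \<epsilon> \<le> B * \<epsilon>" using B \<epsilon>(5) by simp
    have eB: "B * \<epsilon>\<^sup>2 \<le> B * \<epsilon>"
      using \<epsilon>(1,5) B by (intro mult_left_mono) (auto simp: power2_eq_square)
    define e1 :: "complex ^ 3" where "e1 = vector [of_real \<epsilon>, 0, 0]"
    define Bf where "Bf = (\<lambda>\<mu>. h (p \<epsilon> \<mu> 0) $ 3 + cnj (h e1 $ 3)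
       - 2 * normal_poly c' (h (p \<epsilon> \<mu> 0) $ 1) (h (p \<epsilon> \<mu> 0) $ 2) (cnj (h e1 $ 1)) (cnj (h e1 $ 2)))"
    have n0b: "norm (n0 \<epsilon> \<mu>) \<le> 4 * C0 * \<epsilon>\<^sup>2" and mz: "norm (\<mu> * z0) \<le> 2 * \<epsilon>" "norm (\<mu> * \<zeta>0) \<le> 2 * \<epsilon>"
      if \<mu>: "norm \<mu> < 2 * \<epsilon>" for \<mu>
    proof -
      have "norm \<mu> * norm z0 \<le> 2 * \<epsilon> * 1" "norm \<mu> * norm \<zeta>0 \<le> 2 * \<epsilon> * 1"
        using z0 \<mu> \<epsilon>(5) by (intro mult_mono; simp)+
      then show m: "norm (\<mu> * z0) \<le> 2 * \<epsilon>" "norm (\<mu> * \<zeta>0) \<le> 2 * \<epsilon>" by (simp_all add: norm_mult)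
      have "norm (n0 \<epsilon> \<mu>) \<le> C0 * (2 * \<epsilon>)\<^sup>2"
        unfolding n0_def C0_def by (rule norm_normal_poly_le) (use m \<epsilon> in auto)
      then show "norm (n0 \<epsilon> \<mu>) \<le> 4 * C0 * \<epsilon>\<^sup>2" by (simp add: power_mult_distrib)
    qed
    have C0B: "8 * C0 * \<epsilon>\<^sup>2 \<le> B * \<epsilon>\<^sup>2" "4 * C0 * \<epsilon>\<^sup>2 \<le> B * \<epsilon>\<^sup>2"
      using C0 by (auto simp: B_def intro!: mult_right_mono)
    have p12: "norm (p \<epsilon> \<mu> 0 $ 1) \<le> B * \<epsilon>" "norm (p \<epsilon> \<mu> 0 $ 2) \<le> B * \<epsilon>"
      and p3: "norm (p \<epsilon> \<mu> 0 $ 3) \<le> B * \<epsilon>\<^sup>2" if "norm \<mu> < 2 * \<epsilon>" for \<mu>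
      using mz[OF that] n0b[OF that] e2 C0B by (auto simp: p_def norm_mult)
    have pb: "\<forall>i. norm (p \<epsilon> \<mu> 0 $ i) \<le> B * \<epsilon>" if "norm \<mu> < 2 * \<epsilon>" for \<mu>
      unfolding forall_3 using p12[OF that] p3[OF that] eB by simp
    have e1b: "norm (e1 $ 1) \<le> B * \<epsilon>" "norm (e1 $ 2) \<le> B * \<epsilon>" "norm (e1 $ 3) \<le> B * \<epsilon>\<^sup>2" "\<forall>i. norm (e1 $ i) \<le> B * \<epsilon>"
      unfolding forall_3 using e2 \<epsilon> B by (auto simp: e1_def)
    have bound: "norm (Bf \<mu>) \<le> C3 * \<epsilon> ^ 6" if \<mu>: "norm \<mu> < 2 * \<epsilon>" for \<mu>
    proof -
      \<comment> \<open>The value of \<open>v\<close> in \<open>X\<close> is chosen such that the conjugate of \<open>w\<close>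
        vanishes except for the remainder \<open>s\<close>, which perturbs both points only in the third coordinate.\<close>
      define s where "s = psum R (X \<epsilon> \<mu>)"
      have X5: "norm (X \<epsilon> \<mu> $ 5) \<le> B * \<epsilon>\<^sup>2"
        using n0b[OF \<mu>] C0B(2) by (simp add: X_def vector_5 norm_mult)
      have Xi: "norm (X \<epsilon> \<mu> $ i) \<le> B * \<epsilon>" if "i \<noteq> 5" for i
        using exhaust_5[of i] that order_trans[OF mz(1)[OF \<mu>] e2] order_trans[OF mz(2)[OF \<mu>] e2] \<epsilon>(5) B
        by (elim disjE) (auto simp: X_def vector_5)
      have s: "norm s \<le> C1 * \<epsilon> ^ 6" unfolding s_def using C1' Xi X5 by blast
      have "norm (X \<epsilon> \<mu> $ i) < \<rho>" for i
        using Xi[of i] X5 eB \<epsilon>(2) by (cases "i = 5") (auto simp: mult.commute)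
      note zero = \<rho>(2)[OF this]
      have nn: "normal_poly c (\<mu> * z0) (\<mu> * \<zeta>0) (of_real \<epsilon>) 0 = n0 \<epsilon> \<mu>" by (simp add: n0_def)
      have "polarized_equation h c' R' (p \<epsilon> \<mu> s) (b \<epsilon> s) = 0"
        using zero by (simp add: p_def b_def s_def graph_fun_def nn X_def vector_5)
      then have g0: "g (vector [\<mu>, \<epsilon>, s]) = 0" by (simp add: g_def)
      have "norm (g (vector [\<mu>, \<epsilon>, s]) - g (vector [\<mu>, \<epsilon>, 0])) \<le> 8 * Kg / rg * (C1 * \<epsilon> ^ 6)"
      proof (rule bounded_hol_lipschitz[OF Kg])
        have "2 * \<epsilon> \<le> \<epsilon> * B" using e2 by (simp only: mult.commute)
        then have "norm \<mu> \<le> rg / 2" "\<epsilon> \<le> rg / 2" "0 \<le> rg / 2" using \<mu> \<epsilon>(4,5) rg by linarith+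
        then have "\<forall>i. norm ((vector [\<mu>, \<epsilon>, 0] :: complex ^ 3) $ i) \<le> rg / 2"
          unfolding forall_3 using \<epsilon>(5) by auto
        then show "norm ((vector [\<mu>, \<epsilon>, 0] :: complex ^ 3) $ i) \<le> rg / 2" for i by blast
        have "\<forall>i. norm ((vector [\<mu>, \<epsilon>, s] :: complex ^ 3) $ i - (vector [\<mu>, \<epsilon>, 0] :: complex ^ 3) $ i) \<le> C1 * \<epsilon> ^ 6"
          unfolding forall_3 using s C1(1) \<epsilon>(5) by auto
        then show "norm ((vector [\<mu>, \<epsilon>, s] :: complex ^ 3) $ i - (vector [\<mu>, \<epsilon>, 0] :: complex ^ 3) $ i) \<le> C1 * \<epsilon> ^ 6" for i
          by blast
      qed (use \<epsilon>(6) in simp)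
      then have 1: "norm (polarized_equation h c' R' (p \<epsilon> \<mu> 0) (b \<epsilon> 0)) \<le> 8 * Kg / rg * C1 * \<epsilon> ^ 6"
        unfolding g0 by (simp add: g_def mult.assoc)
      define Y :: "complex ^ 5" where "Y = vector [h (p \<epsilon> \<mu> 0) $ 1, h (p \<epsilon> \<mu> 0) $ 2, cnj (h e1 $ 1), cnj (h e1 $ 2),
         1 / (2 * \<i>) * (h (p \<epsilon> \<mu> 0) $ 3 - cnj (h e1 $ 3))]"
      have "conj_vec (b \<epsilon> 0) = e1" by (simp add: conj_vec_def b_def e1_def vec_eq_iff forall_3)
      then have 2: "Bf \<mu> = polarized_equation h c' R' (p \<epsilon> \<mu> 0) (b \<epsilon> 0) + 2 * psum R' Y"
        by (simp add: polarized_equation_def Bf_def graph_fun_def Y_def vector_5)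
      have "norm (Y $ i) \<le> B' * \<epsilon>" if "i \<noteq> 5" for i
      proof -
        have "H1 * \<epsilon> \<le> B' * \<epsilon>" "H2 * \<epsilon> \<le> B' * \<epsilon>" using B' \<epsilon>(5) by (auto intro: mult_right_mono)
        moreover have "norm (h (p \<epsilon> \<mu> 0) $ 1) \<le> H1 * \<epsilon>" "norm (h e1 $ 1) \<le> H1 * \<epsilon>"
          "norm (h (p \<epsilon> \<mu> 0) $ 2) \<le> H2 * \<epsilon>" "norm (h e1 $ 2) \<le> H2 * \<epsilon>"
          using H1' H2' pb[OF \<mu>] e1b(4) by blast+
        ultimately show ?thesis using exhaust_5[of i] that by (elim disjE) (auto simp: Y_def vector_5)
      qed
      moreover have "norm (Y $ 5) \<le> B' * \<epsilon>\<^sup>2"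
      proof -
        have "norm (h (p \<epsilon> \<mu> 0) $ 3) \<le> H3 * \<epsilon>\<^sup>2" "norm (h e1 $ 3) \<le> H3 * \<epsilon>\<^sup>2"
          using H3' p12[OF \<mu>] p3[OF \<mu>] e1b by blast+
        then have "norm (h (p \<epsilon> \<mu> 0) $ 3 - cnj (h e1 $ 3)) \<le> 2 * (H3 * \<epsilon>\<^sup>2)"
          using norm_triangle_ineq4[of "h (p \<epsilon> \<mu> 0) $ 3" "cnj (h e1 $ 3)"] by simp
        moreover have "H3 * \<epsilon>\<^sup>2 \<le> B' * \<epsilon>\<^sup>2" using B' by (intro mult_right_mono) auto
        ultimately show ?thesis by (simp add: Y_def vector_5 norm_mult norm_divide)
      qed
      ultimately have "norm (psum R' Y) \<le> C2 * \<epsilon> ^ 6" using C2' by blast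
      then show ?thesis
        unfolding 2 C3_def using 1 norm_triangle_ineq[of "polarized_equation h c' R' (p \<epsilon> \<mu> 0) (b \<epsilon> 0)" "2 * psum R' Y"]
        by (simp add: norm_mult distrib_right)
    qed
    have hol: "Bf holomorphic_on ball 0 (2 * \<epsilon>)"
    proof -
      have "(\<lambda>\<mu>. h (p \<epsilon> \<mu> 0) $ j) holomorphic_on ball 0 (2 * \<epsilon>)" for j
      proof (rule curve_holD[OF rh(2)])
        show "(\<lambda>\<mu>. p \<epsilon> \<mu> 0 $ i) holomorphic_on ball 0 (2 * \<epsilon>)" for i
          using exhaust_3[of i] unfolding p_def n0_def normal_poly_def
          by (elim disjE; simp only: vector_3) (intro holomorphic_intros)+
        show "norm (p \<epsilon> \<mu> 0 $ i) < rh" if "\<mu> \<in> ball 0 (2 * \<epsilon>)" for \<mu> i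
          using pb[of \<mu>] that \<epsilon>(3) by (metis dist_0_norm le_less_trans mem_ball mult.commute)
      qed simp
      then show ?thesis unfolding Bf_def normal_poly_def by (intro holomorphic_intros)
    qed
    have "norm ((deriv ^^ 1) Bf 0) \<le> fact 1 * (C3 * \<epsilon> ^ 6) / \<epsilon> ^ 1"
    proof (rule Cauchy_inequality)
      show "Bf holomorphic_on ball 0 \<epsilon>" using hol \<epsilon>(5) by (auto elim!: holomorphic_on_subset)
      show "continuous_on (cball 0 \<epsilon>) Bf"
        using hol \<epsilon>(5) by (intro holomorphic_on_imp_continuous_on) (auto elim!: holomorphic_on_subset)
      show "norm (Bf \<mu>) \<le> C3 * \<epsilon> ^ 6" if "norm (0 - \<mu>) = \<epsilon>" for \<mu> using bound[of \<mu>] that \<epsilon>(5) by simp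
    qed (rule \<epsilon>(5))
    then have dB: "norm (deriv Bf 0) \<le> C3 * \<epsilon> ^ 5" using \<epsilon>(5) by (simp add: eval_nat_numeral)
    define q :: "complex ^ 3" where "q = vector [z0, \<zeta>0, 2 * of_real \<epsilon> * z0 + (of_real \<epsilon>)\<^sup>2 * \<zeta>0]"
    have dz: "((\<lambda>\<mu>. \<mu> * z) has_field_derivative z) (at 0)" for z :: complex
      by (auto intro!: derivative_eq_intros)
    have dn: "((\<lambda>\<mu>. n0 \<epsilon> \<mu>) has_field_derivative (\<epsilon> * z0 + 1/2 * (of_real \<epsilon>)\<^sup>2 * \<zeta>0)) (at 0)"
      unfolding n0_def by (intro normal_poly_has_field_derivative dz) auto
    have dp3: "((\<lambda>\<mu>. p \<epsilon> \<mu> 0 $ 3) has_field_derivative q $ 3) (at 0)"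
      using DERIV_cmult[OF dn, of 2] by (simp add: p_def q_def algebra_simps)
    have "\<forall>j. ((\<lambda>\<mu>. p \<epsilon> \<mu> 0 $ j) has_field_derivative q $ j) (at 0)"
      unfolding forall_3 using dp3 dz[of z0] dz[of \<zeta>0] by (simp add: p_def q_def)
    then have "((\<lambda>\<mu>. p \<epsilon> \<mu> 0 $ j) has_derivative (\<lambda>\<mu>. (\<mu> *s q) $ j)) (at 0)" for j
      by (simp add: has_field_derivative_def mult.commute[of _ "q $ j"])
    then have "((\<lambda>\<mu>. p \<epsilon> \<mu> 0) has_derivative (\<lambda>\<mu>. \<mu> *s q)) (at 0)"
      by (rule has_derivative_componentwise_vec)
    moreover have p0: "p \<epsilon> 0 0 = 0" by (simp add: p_def n0_def normal_poly_def vec_eq_iff forall_3)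
    then have "(h has_derivative (\<lambda>y. D *v y)) (at (p \<epsilon> 0 0))" using dh by simp
    ultimately have "((\<lambda>\<mu>. h (p \<epsilon> \<mu> 0)) has_derivative (\<lambda>\<mu>. D *v (\<mu> *s q))) (at 0)"
      by (rule has_derivative_compose)
    from bounded_linear.has_derivative[OF bounded_linear_vec_nth this]
    have dhp: "((\<lambda>\<mu>. h (p \<epsilon> \<mu> 0) $ j) has_field_derivative (D *v q) $ j) (at 0)" for j
      by (simp add: has_field_derivative_def vector_scalar_commute mult_commute_abs)
    have h0: "h 0 $ j = 0" for j using h[of j] by (simp add: hgerm_def)
    define A where "A = cnj (h e1 $ 1)"
    have "(Bf has_field_derivative (D *v q) $ 3 + 0 - 2 * (A * (D *v q) $ 1 + 1/2 * A\<^sup>2 * (D *v q) $ 2)) (at 0)"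
      unfolding Bf_def A_def
      by (intro DERIV_diff DERIV_add DERIV_const DERIV_cmult normal_poly_has_field_derivative dhp) (simp_all add: p0 h0)
    then have "deriv Bf 0 = (D *v q) $ 3 - 2 * A * (D *v q) $ 1 - A\<^sup>2 * (D *v q) $ 2"
      by (intro DERIV_imp_deriv) (simp add: algebra_simps)
    then show ?case using dB by (simp add: Let_def A_def e1_def q_def)
  qed
  then show ?thesis by (rule that)
qed

lemma poly_coeffs_eq_0:
  fixes a :: "nat \<Rightarrow> complex"
  assumes "\<forall>\<^sub>F \<epsilon> in at_right (0::real). norm (\<Sum>j<n. a j * of_real \<epsilon> ^ j) \<le> C * \<epsilon> ^ n"
  shows "\<forall>j<n. a j = 0"
  using assms
proof (induction n arbitrary: a)
  case (Suc n)
  have pos: "\<forall>\<^sub>F \<epsilon> in at_right (0::real). 0 < \<epsilon>" by (simp add: eventually_at_right_less)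
  have "((\<lambda>\<epsilon>. \<Sum>j<Suc n. a j * of_real \<epsilon> ^ j) \<longlongrightarrow> (\<Sum>j<Suc n. a j * of_real 0 ^ j)) (at_right (0::real))"
    by (intro tendsto_intros)
  moreover have "(\<Sum>j<Suc n. a j * of_real 0 ^ j) = a 0"
    by (simp add: sum.lessThan_Suc_shift del: sum.lessThan_Suc)
  moreover have "((\<lambda>\<epsilon>. \<Sum>j<Suc n. a j * of_real \<epsilon> ^ j) \<longlongrightarrow> 0) (at_right (0::real))"
  proof (rule Lim_null_comparison[OF Suc.prems])
    have "((\<lambda>\<epsilon>. C * \<epsilon> ^ Suc n) \<longlongrightarrow> C * 0 ^ Suc n) (at_right (0::real))" by (intro tendsto_intros)
    then show "((\<lambda>\<epsilon>. C * \<epsilon> ^ Suc n) \<longlongrightarrow> 0) (at_right (0::real))" by simp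
  qed
  ultimately have a0: "a 0 = 0"
    using tendsto_unique[OF trivial_limit_at_right_real] by fastforce
  have "\<forall>\<^sub>F \<epsilon> in at_right (0::real). norm (\<Sum>j<n. a (Suc j) * of_real \<epsilon> ^ j) \<le> C * \<epsilon> ^ n"
    using Suc.prems pos
  proof eventually_elim
    case (elim \<epsilon>)
    have "(\<Sum>j<Suc n. a j * of_real \<epsilon> ^ j) = of_real \<epsilon> * (\<Sum>j<n. a (Suc j) * of_real \<epsilon> ^ j)"
      by (subst sum.lessThan_Suc_shift) (simp add: a0 sum_distrib_left mult_ac)
    then have "\<epsilon> * norm (\<Sum>j<n. a (Suc j) * of_real \<epsilon> ^ j) \<le> \<epsilon> * (C * \<epsilon> ^ n)"
      using elim by (simp add: norm_mult mult_ac)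
    then show ?case using elim(2) by simp
  qed
  then have "\<forall>j<n. a (Suc j) = 0" by (rule Suc.IH)
  then show ?case using a0 by (auto simp: less_Suc_eq_0_disj)
qed simp

text \<open>All products are expanded up to the fourth power; \<open>rest\<close> collects the remaining terms of the
polynomial, and the error of \<open>A\<close> contributes only to the fifth order because the other factors stay bounded.\<close>

lemma taylor_coefficient_equations:
  fixes A :: "real \<Rightarrow> complex"
  assumes A: "\<forall>\<^sub>F \<epsilon> in at_right 0. norm (A \<epsilon> - (a1 * \<epsilon> + a2 * \<epsilon>\<^sup>2 + a3 * \<epsilon> ^ 3 + a4 * \<epsilon> ^ 4)) \<le> C1 * \<epsilon> ^ 5"
    and E: "\<forall>\<^sub>F \<epsilon> in at_right 0. norm (k1 * \<epsilon> + k2 * \<epsilon>\<^sup>2 - 2 * A \<epsilon> * (f0 + f1 * \<epsilon> + f2 * \<epsilon>\<^sup>2)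
        - (A \<epsilon>)\<^sup>2 * (g0 + g1 * \<epsilon> + g2 * \<epsilon>\<^sup>2)) \<le> C2 * \<epsilon> ^ 5"
  shows "k1 - 2 * a1 * f0 = 0"
    and "k2 - 2 * (a1 * f1 + a2 * f0) - a1\<^sup>2 * g0 = 0"
    and "2 * (a1 * f2 + a2 * f1 + a3 * f0) + (a1\<^sup>2 * g1 + 2 * a1 * a2 * g0) = 0"
    and "2 * (a2 * f2 + a3 * f1 + a4 * f0) + (a1\<^sup>2 * g2 + 2 * a1 * a2 * g1 + (a2\<^sup>2 + 2 * a1 * a3) * g0) = 0"
proof -
  define P where "P = (\<lambda>e::complex. a1 * e + a2 * e\<^sup>2 + a3 * e ^ 3 + a4 * e ^ 4)"
  define f where "f = (\<lambda>e::complex. f0 + f1 * e + f2 * e\<^sup>2)"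
  define g where "g = (\<lambda>e::complex. g0 + g1 * e + g2 * e\<^sup>2)"
  define rest where "rest = (\<lambda>e::complex. - 2 * (a3 * f2 + a4 * f1 + e * (a4 * f2))
     - (2 * a1 * a4 + 2 * a2 * a3 + (a3\<^sup>2 + 2 * a2 * a4) * e + 2 * a3 * a4 * e\<^sup>2 + a4\<^sup>2 * e ^ 3) * g e
     - (2 * a1 * a2 * g2 + (a2\<^sup>2 + 2 * a1 * a3) * g1 + e * (a2\<^sup>2 + 2 * a1 * a3) * g2))"
  define a :: "nat \<Rightarrow> complex" where "a = (\<lambda>j. [0, k1 - 2 * a1 * f0, k2 - 2 * (a1 * f1 + a2 * f0) - a1\<^sup>2 * g0,
     - (2 * (a1 * f2 + a2 * f1 + a3 * f0) + (a1\<^sup>2 * g1 + 2 * a1 * a2 * g0)),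
     - (2 * (a2 * f2 + a3 * f1 + a4 * f0) + (a1\<^sup>2 * g2 + 2 * a1 * a2 * g1 + (a2\<^sup>2 + 2 * a1 * a3) * g0))] ! j)"
  have eq: "k1 * e + k2 * e\<^sup>2 - 2 * P e * f e - (P e)\<^sup>2 * g e = (\<Sum>j<5. a j * e ^ j) + e ^ 5 * rest e" for e
    unfolding P_def f_def g_def rest_def a_def by (simp add: eval_nat_numeral algebra_simps)
  have bd: "\<forall>\<^sub>F \<epsilon> in at_right (0::real). norm (F (of_real \<epsilon>)) < norm (F 0) + 1" if "isCont F 0" for F :: "complex \<Rightarrow> complex"
  proof -
    have "((\<lambda>\<epsilon>. complex_of_real \<epsilon>) \<longlongrightarrow> of_real 0) (at_right 0)" by (intro tendsto_intros)
    from isCont_tendsto_compose[OF that] this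
    have "((\<lambda>\<epsilon>. norm (F (of_real \<epsilon>))) \<longlongrightarrow> norm (F 0)) (at_right (0::real))" by (intro tendsto_norm) simp
    then show ?thesis by (rule order_tendstoD(2)) simp
  qed
  have c: "isCont P 0" "isCont f 0" "isCont g 0" "isCont rest 0"
    unfolding P_def f_def g_def rest_def by (intro continuous_intros)+
  have lt1: "\<forall>\<^sub>F \<epsilon> in at_right (0::real). 0 < \<epsilon> \<and> \<epsilon> < 1"
    by (auto simp: eventually_at_right_field intro!: exI[of _ 1])
  define K where "K = C2 + \<bar>C1\<bar> * (2 * (norm (f 0) + 1) + (\<bar>C1\<bar> + 2 * (norm (P 0) + 1)) * (norm (g 0) + 1)) + (norm (rest 0) + 1)"
  have "\<forall>\<^sub>F \<epsilon> in at_right (0::real). norm (\<Sum>j<5. a j * of_real \<epsilon> ^ j) \<le> K * \<epsilon> ^ 5"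
    using A E bd[OF c(1)] bd[OF c(2)] bd[OF c(3)] bd[OF c(4)] lt1
  proof eventually_elim
    case (elim \<epsilon>)
    define e where "e = complex_of_real \<epsilon>"
    define d where "d = A \<epsilon> - P e"
    have e: "0 < \<epsilon>" "\<epsilon> < 1" "norm e = \<epsilon>" using elim(7) by (auto simp: e_def)
    have "norm d \<le> C1 * \<epsilon> ^ 5" using elim(1) by (simp add: d_def P_def e_def)
    also have "\<dots> \<le> \<bar>C1\<bar> * \<epsilon> ^ 5" using e by (intro mult_right_mono) auto
    finally have d: "norm d \<le> \<bar>C1\<bar> * \<epsilon> ^ 5" .
    have "\<bar>C1\<bar> * \<epsilon> ^ 5 \<le> \<bar>C1\<bar> * 1" using e by (intro mult_left_mono power_le_one) auto
    then have d1: "norm d \<le> \<bar>C1\<bar>" using d by simp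
    define T where "T = k1 * e + k2 * e\<^sup>2 - 2 * A \<epsilon> * f e - (A \<epsilon>)\<^sup>2 * g e"
    have T: "norm T \<le> C2 * \<epsilon> ^ 5" using elim(2) by (simp add: T_def f_def g_def e_def)
    have A': "A \<epsilon> = P e + d" by (simp add: d_def)
    have sum_eq: "(\<Sum>j<5. a j * e ^ j) = T + d * (2 * f e + (d + 2 * P e) * g e) - e ^ 5 * rest e"
      using eq[of e] by (simp add: T_def A' algebra_simps power2_eq_square)
    have "norm (\<Sum>j<5. a j * e ^ j) \<le> norm T + norm d * norm (2 * f e + (d + 2 * P e) * g e) + norm (e ^ 5) * norm (rest e)"
      using norm_triangle_ineq4[of "T + d * (2 * f e + (d + 2 * P e) * g e)" "e ^ 5 * rest e"]
        norm_triangle_ineq[of T "d * (2 * f e + (d + 2 * P e) * g e)"]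
      unfolding sum_eq norm_mult[of d] norm_mult[of "e ^ 5"] by linarith
    also have "\<dots> \<le> C2 * \<epsilon> ^ 5 + \<bar>C1\<bar> * \<epsilon> ^ 5 * (2 * (norm (f 0) + 1) + (\<bar>C1\<bar> + 2 * (norm (P 0) + 1)) * (norm (g 0) + 1)) + \<epsilon> ^ 5 * (norm (rest 0) + 1)"
    proof (intro add_mono T mult_mono d)
      have "norm (2 * f e + (d + 2 * P e) * g e) \<le> norm (2 * f e) + norm (d + 2 * P e) * norm (g e)"
        unfolding norm_mult[of "d + 2 * P e", symmetric] by (rule norm_triangle_ineq)
      also have "\<dots> \<le> 2 * (norm (f 0) + 1) + (\<bar>C1\<bar> + 2 * (norm (P 0) + 1)) * (norm (g 0) + 1)"
      proof (intro add_mono mult_mono)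
        show "norm (2 * f e) \<le> 2 * (norm (f 0) + 1)" using elim(4) by (simp add: norm_mult e_def)
        show "norm (d + 2 * P e) \<le> \<bar>C1\<bar> + 2 * (norm (P 0) + 1)"
          using norm_triangle_ineq[of d "2 * P e"] d1 elim(3) by (simp add: norm_mult e_def)
        show "norm (g e) \<le> norm (g 0) + 1" using elim(5) by (simp add: e_def)
        show "0 \<le> \<bar>C1\<bar> + 2 * (norm (P 0) + 1)" by (simp add: add_nonneg_nonneg)
      qed simp
      finally show "norm (2 * f e + (d + 2 * P e) * g e) \<le> 2 * (norm (f 0) + 1) + (\<bar>C1\<bar> + 2 * (norm (P 0) + 1)) * (norm (g 0) + 1)" .
      show "norm (rest e) \<le> norm (rest 0) + 1" using elim(6) by (simp add: e_def)
    qed (use e in \<open>auto simp: norm_power\<close>)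
    also have "\<dots> = K * \<epsilon> ^ 5" by (simp add: K_def algebra_simps)
    finally show ?case by (simp add: e_def)
  qed
  then have "\<forall>j<5. a j = 0" by (rule poly_coeffs_eq_0)
  then have z: "a 1 = 0" "a 2 = 0" "a 3 = 0" "a 4 = 0" by auto
  show "k1 - 2 * a1 * f0 = 0" "k2 - 2 * (a1 * f1 + a2 * f0) - a1\<^sup>2 * g0 = 0"
    using z(1,2) by (simp_all add: a_def eval_nat_numeral)
  have a34: "a 3 = - (2 * (a1 * f2 + a2 * f1 + a3 * f0) + (a1\<^sup>2 * g1 + 2 * a1 * a2 * g0))"
    "a 4 = - (2 * (a2 * f2 + a3 * f1 + a4 * f0) + (a1\<^sup>2 * g2 + 2 * a1 * a2 * g1 + (a2\<^sup>2 + 2 * a1 * a3) * g0))"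
    by (simp_all add: a_def eval_nat_numeral)
  show "2 * (a1 * f2 + a2 * f1 + a3 * f0) + (a1\<^sup>2 * g1 + 2 * a1 * a2 * g0) = 0"
    "2 * (a2 * f2 + a3 * f1 + a4 * f0) + (a1\<^sup>2 * g2 + 2 * a1 * a2 * g1 + (a2\<^sup>2 + 2 * a1 * a3) * g0) = 0"
    using z(3,4) unfolding a34 neg_equal_0_iff_equal by this+
qed

section \<open>Invariance of the conic\<close>

text \<open>The tangent estimate is used for the two directions \<open>(z, \<zeta>) = (1, 0)\<close> and \<open>(0, 1)\<close>. With
\<open>D = ((\<sigma>, a, b), (\<tau>, \<mu>, e), (0, 0, \<rho>))\<close> and the Taylor coefficients \<open>a1, a2, a3\<close> of \<open>A\<close>, the
coefficient equations give \<open>a = 0\<close>, \<open>\<rho> = a1 \<sigma>\<close>, \<open>a1 \<mu> = \<sigma>\<close>, \<open>a1 \<tau> = - 2 b\<close> and \<open>\<rho> e = - b\<^sup>2\<close>, the last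
one after elimination of \<open>a2\<close> and \<open>a3\<close>. These are the relations for which the quadratic form is multiplied
by \<open>\<sigma>\<^sup>2\<close>.\<close>

lemma conic_preserved:
  fixes D :: "complex ^ 3 ^ 3"
  assumes N: "normal_form c R r N" and N': "normal_form c' R' r' N'"
    and h: "\<And>j. hgerm (\<lambda>y. h y $ j)"
    and map: "\<forall>\<^sub>F q in nhds 0. q \<in> N \<longrightarrow> h q \<in> N'"
    and dh: "(h has_derivative (\<lambda>y. D *v y)) (at 0)"
    and D3: "D $ 3 $ 1 = 0" "D $ 3 $ 2 = 0" "D $ 3 $ 3 \<noteq> 0"
  obtains \<kappa> where "\<kappa> \<noteq> 0"
    "\<And>V. ((D *v V) $ 1)\<^sup>2 + (D *v V) $ 2 * (D *v V) $ 3 = \<kappa> * ((V $ 1)\<^sup>2 + V $ 2 * V $ 3)"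
proof -
  define A where "A = (\<lambda>\<epsilon>::real. cnj (h (vector [of_real \<epsilon>, 0, 0]) $ 1))"
  define \<sigma> a b \<tau> \<mu> e \<rho> where "\<sigma> = D $ 1 $ 1" and "a = D $ 1 $ 2" and "b = D $ 1 $ 3"
    and "\<tau> = D $ 2 $ 1" and "\<mu> = D $ 2 $ 2" and "e = D $ 2 $ 3" and "\<rho> = D $ 3 $ 3"
  note defs = \<sigma>_def a_def b_def \<tau>_def \<mu>_def e_def \<rho>_def
  have Dv: "(D *v V) $ 1 = \<sigma> * V $ 1 + a * V $ 2 + b * V $ 3"
    "(D *v V) $ 2 = \<tau> * V $ 1 + \<mu> * V $ 2 + e * V $ 3" "(D *v V) $ 3 = \<rho> * V $ 3" for V
    by (simp_all add: matrix_vector_mult_def sum_3 D3 defs)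
  obtain a1 a2 a3 a4 :: complex and K where jet: "\<forall>\<^sub>F \<epsilon> in at_right 0.
      norm (A \<epsilon> - (a1 * of_real \<epsilon> + a2 * (of_real \<epsilon>)\<^sup>2 + a3 * of_real \<epsilon> ^ 3 + a4 * of_real \<epsilon> ^ 4)) \<le> K * \<epsilon> ^ 5"
  proof -
    obtain r where r: "0 < r" "curve_hol (\<lambda>y. h y $ 1) r" "\<And>y. (\<And>i. norm (y $ i) < r) \<Longrightarrow> norm (h y $ 1) < 1"
      using hgerm_small[OF h[of 1], of 1] by auto
    define g where "g = (\<lambda>s. h (vector [s, 0, 0]) $ 1)"
    have v: "norm ((vector [s, 0, 0] :: complex ^ 3) $ i) < r" if "norm s < r" for s :: complex and i
      using exhaust_3[of i] that r(1) by auto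
    have hol: "g holomorphic_on ball 0 r"
      unfolding g_def
    proof (rule curve_holD[OF r(2)])
      show "(\<lambda>s. (vector [s, 0, 0] :: complex ^ 3) $ i) holomorphic_on ball 0 r" for i
        using exhaust_3[of i] by (elim disjE; simp only: vector_3) (intro holomorphic_intros)+
    qed (use v in auto)
    have "vector [0, 0, 0] = (0 :: complex ^ 3)" by (simp add: vec_eq_iff forall_3)
    then have g0: "g 0 = 0" using h[of 1] by (simp add: g_def hgerm_def)
    define t where "t = (\<lambda>j. cnj ((deriv ^^ j) g 0 / fact j))"
    have ev: "\<forall>\<^sub>F \<epsilon> in at_right (0::real). 0 < \<epsilon> \<and> \<epsilon> < r / 4"
      using r by (auto simp: eventually_at_right_field intro!: exI[of _ "r / 4"])
    have "\<forall>\<^sub>F \<epsilon> in at_right 0.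
      norm (A \<epsilon> - (t 1 * of_real \<epsilon> + t 2 * (of_real \<epsilon>)\<^sup>2 + t 3 * of_real \<epsilon> ^ 3 + t 4 * of_real \<epsilon> ^ 4)) \<le> (64 / r ^ 5) * \<epsilon> ^ 5"
      using ev
    proof eventually_elim
      case (elim \<epsilon>)
      have "norm (g \<epsilon> - (\<Sum>j<5. (deriv ^^ j) g 0 / fact j * complex_of_real \<epsilon> ^ j))
          \<le> 2 * 1 * (2 * norm (complex_of_real \<epsilon>) / r) ^ 5"
        by (rule holomorphic_taylor_bound[OF hol r(1)]) (use elim r(3) v in \<open>auto simp: g_def intro: less_imp_le\<close>)
      also have "\<dots> = 64 / r ^ 5 * \<epsilon> ^ 5" using elim by (simp add: power_divide power_mult_distrib)
      also have "norm (g \<epsilon> - (\<Sum>j<5. (deriv ^^ j) g 0 / fact j * complex_of_real \<epsilon> ^ j))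
          = norm (cnj (g \<epsilon> - (\<Sum>j<5. (deriv ^^ j) g 0 / fact j * complex_of_real \<epsilon> ^ j)))"
          by (rule complex_mod_cnj[symmetric])
      also have "cnj (g \<epsilon> - (\<Sum>j<5. (deriv ^^ j) g 0 / fact j * complex_of_real \<epsilon> ^ j))
          = A \<epsilon> - (\<Sum>j<5. t j * complex_of_real \<epsilon> ^ j)"
        by (simp add: A_def g_def t_def)
      also have "(\<Sum>j<5. t j * complex_of_real \<epsilon> ^ j) = t 1 * of_real \<epsilon> + t 2 * (of_real \<epsilon>)\<^sup>2 + t 3 * of_real \<epsilon> ^ 3 + t 4 * of_real \<epsilon> ^ 4"
        using g0 by (simp add: eval_nat_numeral t_def)
      finally show ?case .
    qed
    then show ?thesis by (rule that)
  qed
  obtain C1 where C1: "\<forall>\<^sub>F \<epsilon> in at_right (0::real).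
    let A = cnj (h (vector [of_real \<epsilon>, 0, 0]) $ 1); q = vector [1, 0, 2 * of_real \<epsilon> * 1 + (of_real \<epsilon>)\<^sup>2 * 0]
    in norm ((D *v q) $ 3 - 2 * A * (D *v q) $ 1 - A\<^sup>2 * (D *v q) $ 2) \<le> C1 * \<epsilon> ^ 5"
    using segre_tangent_estimate[OF N N' h map dh D3(1,2), of 1 0] by auto
  have E1: "\<forall>\<^sub>F \<epsilon> in at_right 0. norm (2 * \<rho> * \<epsilon> + 0 * \<epsilon>\<^sup>2 - 2 * A \<epsilon> * (\<sigma> + 2 * b * \<epsilon> + 0 * \<epsilon>\<^sup>2)
        - (A \<epsilon>)\<^sup>2 * (\<tau> + 2 * e * \<epsilon> + 0 * \<epsilon>\<^sup>2)) \<le> C1 * \<epsilon> ^ 5"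
    using C1 by eventually_elim (simp add: Let_def Dv A_def algebra_simps)
  obtain C2 where C2: "\<forall>\<^sub>F \<epsilon> in at_right (0::real).
    let A = cnj (h (vector [of_real \<epsilon>, 0, 0]) $ 1); q = vector [0, 1, 2 * of_real \<epsilon> * 0 + (of_real \<epsilon>)\<^sup>2 * 1]
    in norm ((D *v q) $ 3 - 2 * A * (D *v q) $ 1 - A\<^sup>2 * (D *v q) $ 2) \<le> C2 * \<epsilon> ^ 5"
    using segre_tangent_estimate[OF N N' h map dh D3(1,2), of 0 1] by auto
  have E2: "\<forall>\<^sub>F \<epsilon> in at_right 0. norm (0 * \<epsilon> + \<rho> * \<epsilon>\<^sup>2 - 2 * A \<epsilon> * (a + 0 * \<epsilon> + b * \<epsilon>\<^sup>2)
        - (A \<epsilon>)\<^sup>2 * (\<mu> + 0 * \<epsilon> + e * \<epsilon>\<^sup>2)) \<le> C2 * \<epsilon> ^ 5"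
    using C2 by eventually_elim (simp add: Let_def Dv A_def algebra_simps)
  note J1 = taylor_coefficient_equations[OF jet E1] and J2 = taylor_coefficient_equations[OF jet E2]
  have \<rho>: "\<rho> = a1 * \<sigma>" using J1(1) by simp
  then have nz: "a1 \<noteq> 0" "\<sigma> \<noteq> 0" using D3(3) by (auto simp: defs)
  have a0: "a = 0" using J2(1) nz by simp
  have \<mu>: "a1 * \<mu> = \<sigma>"
  proof -
    have "a1 * (\<sigma> - a1 * \<mu>) = \<rho> - 2 * (a1 * 0 + a2 * a) - a1\<^sup>2 * \<mu>"
      by (simp add: a0 \<rho> power2_eq_square algebra_simps)
    also have "\<dots> = 0" by (rule J2(2))
    finally show ?thesis using nz by simp
  qed
  have a2: "a2 * \<mu> = - b"
  proof -
    have "2 * a1 * (a2 * \<mu> + b) = 0" using J2(3) by (simp add: a0 algebra_simps)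
    then show ?thesis using nz by (simp add: add_eq_0_iff2)
  qed
  have a2': "a2 * \<sigma> = - (a1 * b)" using a2 \<mu> by (metis mult.commute mult.left_commute mult_minus_right)
  have \<tau>: "a1 * \<tau> = - 2 * b"
  proof -
    have "a1 * (a1 * \<tau>) = - 2 * (2 * a1 * b + a2 * \<sigma>)" using J1(2) by (simp add: power2_eq_square algebra_simps)
    also have "\<dots> = a1 * (- 2 * b)" unfolding a2' by (simp add: algebra_simps)
    finally show ?thesis using nz(1) by (simp only: mult_cancel_left simp_thms)
  qed
  have a3: "a3 * \<sigma> = - (a1\<^sup>2 * e)"
  proof -
    have "0 = 2 * (2 * a2 * b + a3 * \<sigma>) + 2 * a1\<^sup>2 * e + 2 * a2 * (a1 * \<tau>)"
      using J1(3) by (simp add: algebra_simps)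
    then have "2 * (a3 * \<sigma> + a1\<^sup>2 * e) = 0" unfolding \<tau> by (simp add: algebra_simps)
    then have "a3 * \<sigma> + a1\<^sup>2 * e = 0" by (metis mult_eq_0_iff zero_neq_numeral)
    then show ?thesis by (simp only: eq_neg_iff_add_eq_0)
  qed
  have e: "\<rho> * e = - b\<^sup>2"
  proof -
    have "0 = 2 * a2 * b + a1\<^sup>2 * e + a2 * (a2 * \<mu>) + 2 * a3 * (a1 * \<mu>)"
      using J2(4) by (simp add: a0 power2_eq_square algebra_simps)
    also have "\<dots> = 2 * a2 * b + a1\<^sup>2 * e + a2 * (- b) + 2 * (a3 * \<sigma>)"
      unfolding a2 \<mu> by (simp only: mult.assoc)
    also have "\<dots> = a2 * b - a1\<^sup>2 * e" unfolding a3 by (simp add: algebra_simps)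
    finally have ab: "a1\<^sup>2 * e = a2 * b" by simp
    have "a1 * (\<rho> * e) = a1\<^sup>2 * e * \<sigma>" by (simp add: \<rho> power2_eq_square mult_ac)
    also have "\<dots> = a2 * \<sigma> * b" unfolding ab by (simp only: mult_ac)
    also have "\<dots> = a1 * (- b\<^sup>2)" unfolding a2' by (simp add: power2_eq_square mult_ac)
    finally have "a1 * (\<rho> * e) = a1 * (- b\<^sup>2)" .
    then show ?thesis using nz(1) by (simp only: mult_cancel_left simp_thms)
  qed
  have m: "\<rho> * \<mu> = \<sigma>\<^sup>2" using \<mu> by (simp add: \<rho> power2_eq_square mult_ac)
  have t: "\<rho> * \<tau> = - 2 * \<sigma> * b" using \<tau> by (simp add: \<rho> mult_ac)
  show ?thesis
  proof
    show "\<sigma>\<^sup>2 \<noteq> 0" using nz by simp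
    fix V :: "complex ^ 3"
    have "((D *v V) $ 1)\<^sup>2 + (D *v V) $ 2 * (D *v V) $ 3
      = \<sigma>\<^sup>2 * (V $ 1)\<^sup>2 + 2 * \<sigma> * b * V $ 1 * V $ 3 + b\<^sup>2 * (V $ 3)\<^sup>2
        + (\<rho> * \<tau>) * V $ 1 * V $ 3 + (\<rho> * \<mu>) * V $ 2 * V $ 3 + (\<rho> * e) * (V $ 3)\<^sup>2"
      by (simp add: Dv a0 power2_eq_square algebra_simps)
    also have "\<dots> = \<sigma>\<^sup>2 * ((V $ 1)\<^sup>2 + V $ 2 * V $ 3)"
      unfolding e m t by (simp add: algebra_simps)
    finally show "((D *v V) $ 1)\<^sup>2 + (D *v V) $ 2 * (D *v V) $ 3 = \<sigma>\<^sup>2 * ((V $ 1)\<^sup>2 + V $ 2 * V $ 3)" .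
  qed
qed

lemma local_biholomorphism_at:
  assumes "local_biholomorphism \<phi> M p N q"
  shows "\<phi> p = q" and "\<And>j. holomorphic_near (\<lambda>x. \<phi> x $ j) p"
    and "(\<phi> has_derivative (\<lambda>y. jac \<phi> p *v y)) (at p)"
    and "\<forall>\<^sub>F x in nhds p. x \<in> M \<longrightarrow> \<phi> x \<in> N"
proof -
  obtain U V where U: "open U" "p \<in> U" and "\<phi> p = q" and hol: "holomorphic_map_on \<phi> U"
    and MN: "\<phi> ` (M \<inter> U) = N \<inter> V"
    using assms unfolding local_biholomorphism_def by blast
  then show "\<phi> p = q" by simp
  show "holomorphic_near (\<lambda>x. \<phi> x $ j) p" for j using hol U(2) by (simp add: holomorphic_map_on_def)
  then show "(\<phi> has_derivative (\<lambda>y. jac \<phi> p *v y)) (at p)" by (rule has_derivative_jac)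
  show "\<forall>\<^sub>F x in nhds p. x \<in> M \<longrightarrow> \<phi> x \<in> N"
    using eventually_nhds_in_open[OF U] by eventually_elim (use MN in blast)
qed

theorem mainTheorem3:
  fixes M N N' :: "(complex ^ 3) set" and p :: "complex ^ 3"
    and \<phi> \<phi>' :: "complex ^ 3 \<Rightarrow> complex ^ 3"
  assumes "class_C21 M" and "p \<in> M"
    and "normalizing_map \<phi> M p N" and "normalizing_map \<phi>' M p N'"
  shows "Sigma_one \<phi> M p N = Sigma_one \<phi>' M p N'"
proof -
  have \<phi>: "local_biholomorphism \<phi> M p N 0" and \<phi>': "local_biholomorphism \<phi>' M p N' 0"
    using assms(3,4) by (auto simp: normalizing_map_def)
  have nf: "\<exists>c R r. normal_form c R r N" if "\<exists>c. normalized_at_0 N c" for N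
    using that by (elim exE) (rule normalized_at_0_normal_form, assumption, blast)
  obtain c R r where N: "normal_form c R r N" using nf assms(3) unfolding normalizing_map_def by blast
  obtain c' R' r' where N': "normal_form c' R' r' N'" using nf assms(4) unfolding normalizing_map_def by blast
  obtain \<psi> where \<psi>: "local_biholomorphism \<psi> N 0 M p"
    and inv: "\<And>X. jac \<psi> 0 *v (jac \<phi> p *v X) = X"
    by (rule local_biholomorphism_inverse[OF \<phi>]) blast
  obtain \<psi>' where inv': "\<And>Y. jac \<phi>' p *v (jac \<psi>' 0 *v Y) = Y"
    by (rule local_biholomorphism_inverse[OF \<phi>']) blast
  define h where "h = (\<lambda>y. \<phi>' (\<psi> y))"
  define D where "D = jac \<phi>' p ** jac \<psi> 0"
  have D: "D *v X = jac \<phi>' p *v (jac \<psi> 0 *v X)" for X by (simp add: D_def matrix_vector_mul_assoc)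
  note f = local_biholomorphism_at[OF \<psi>] and f' = local_biholomorphism_at[OF \<phi>']
  have "hgerm (\<lambda>y. \<phi>' (p + (\<psi> y - p)) $ j - \<phi>' p $ j)" for j
  proof (rule hgerm_compose[of "\<lambda>y. \<phi>' (p + y) $ j - \<phi>' p $ j"])
    show "hgerm (\<lambda>y. (\<psi> y - p) $ i)" for i
      using holomorphic_near_hgerm[OF f(2)[of i]] f(1) by simp
  qed (rule holomorphic_near_hgerm[OF f'(2)])
  then have h: "hgerm (\<lambda>y. h y $ j)" for j by (simp add: h_def f'(1))
  have "(\<phi>' has_derivative (\<lambda>y. jac \<phi>' p *v y)) (at (\<psi> 0))" using f'(3) f(1) by simp
  from has_derivative_compose[OF f(3) this]
  have dh: "(h has_derivative (\<lambda>y. D *v y)) (at 0)" by (simp add: h_def D)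
  have "isCont \<psi> 0" using f(3) has_derivative_continuous by blast
  then have "filterlim \<psi> (nhds p) (nhds 0)"
    using tendsto_at_iff_tendsto_nhds[of \<psi> 0] by (simp only: isCont_def f(1))
  from eventually_compose_filterlim[OF f'(4) this] f(4)
  have map: "\<forall>\<^sub>F q in nhds 0. q \<in> N \<longrightarrow> h q \<in> N'"
    by eventually_elim (simp add: h_def)
  \<comment> \<open>\<open>D\<close> maps the real tangent space \<open>Re X\<^sub>3 = 0\<close> of \<open>N\<close> to that of \<open>N'\<close>; with
    \<open>X\<close> and \<open>i X\<close> this determines the third row.\<close>
  have Re: "Re ((D *v X) $ 3) = 0" if "Re (X $ 3) = 0" for X
  proof -
    have "X \<in> tangent_space N 0" using that tangent_space_normal_form[OF N] by simp
    then have "D *v X \<in> tangent_space N' 0"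
      unfolding D by (intro tangent_space_push[OF \<phi>'] tangent_space_push[OF \<psi>])
    then show ?thesis using tangent_space_normal_form[OF N'] by simp
  qed
  have D3: "D $ 3 $ 1 = 0" "D $ 3 $ 2 = 0"
    using Re[of "vector [1, 0, 0]"] Re[of "vector [\<i>, 0, 0]"] Re[of "vector [0, 1, 0]"] Re[of "vector [0, \<i>, 0]"]
    by (auto simp: matrix_vector_mult_def sum_3 complex_eq_iff)
  have D33: "D $ 3 $ 3 \<noteq> 0"
  proof
    assume z: "D $ 3 $ 3 = 0"
    have "D *v (jac \<phi> p *v (jac \<psi>' 0 *v vector [0, 0, 1])) = vector [0, 0, 1]"
      by (simp add: D inv inv')
    then have "(vector [0, 0, 1] :: complex ^ 3) $ 3 = (D *v (jac \<phi> p *v (jac \<psi>' 0 *v vector [0, 0, 1]))) $ 3"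
      by simp
    also have "\<dots> = 0" by (simp add: matrix_vector_mult_def[of D] sum_3 D3 z)
    finally show False by simp
  qed
  obtain \<kappa> where \<kappa>: "\<kappa> \<noteq> 0"
    "\<And>V. ((D *v V) $ 1)\<^sup>2 + (D *v V) $ 2 * (D *v V) $ 3 = \<kappa> * ((V $ 1)\<^sup>2 + V $ 2 * V $ 3)"
    by (rule conic_preserved[OF N N' h map dh D3 D33]) blast
  have "prolongation \<phi> N 0 J \<in> Sigma_zero N \<longleftrightarrow> prolongation \<phi>' N' 0 J \<in> Sigma_zero N'"
    if J: "J \<in> jet_space M p" for J
  proof -
    obtain \<gamma> where \<gamma>: "\<gamma> \<in> transversal_curves M p" and J: "J = same_jet M p `` {\<gamma>}"
      using J unfolding jet_space_def by (rule quotientE)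
    have "jac \<phi>' p *v velocity \<gamma> = D *v (jac \<phi> p *v velocity \<gamma>)" by (simp add: D inv)
    then show ?thesis
      unfolding J prolongation_in_Sigma_zero_iff[OF \<phi> N \<gamma>] prolongation_in_Sigma_zero_iff[OF \<phi>' N' \<gamma>]
      using \<kappa> by simp
  qed
  then show ?thesis by (auto simp: Sigma_one_def)
qed

end
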